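(* Let $Q$ be a face operator satisfying (Dihedral invariance) and (2Dsimple). The South-West corner fixed point $\overline Q^{SW}$ of $Q$, acting on the orthogonal sum of $\mathcal W_W$ (North side) and $\mathcal W_S$ (East side), has blocks equal to $$C_{NN}=\mathsf F^W(\overline Q^{\infty_{WE},\infty_S})=\mathsf F^W(G^*_{\infty_S}),\qquad C_{EE}=\mathsf F^S(\overline Q^{\infty_W,\infty_{SN}})=\mathsf F^S(G^*_{\infty_W}),$$ $$C_{EN}=V_{\searrow},\qquad C_{NE}=V_{\nwarrow},$$ where $V_\searrow:\mathcal W_W\to\mathcal W_S$ and $V_\nwarrow:\mathcal W_S\to\mathcal W_W$ are defined, for all $k\ge0$, by $$(V_\searrow h)(-k-1)=(U_Q^W)^*\left(\mathrm{id}+\mathsf F^W(\hat W_S)\right)\mathsf F^W(\hat W_S)^k\,h\in\mathcal H_2,$$ $$(V_\nwarrow g)(-k-1)=(U_Q^S)^*\left(\mathrm{id}+\mathsf F^S(\hat W_W)\right)\mathsf F^S(\hat W_W)^k\,g\in\mathcal H_1,$$ and $V_\searrow$ and $V_\nwarrow$ are adjoint to each other.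
   Context: $\mathcal H$ is a finite-dimensional (real or complex) Hilbert space (in the real case functions on $S^1$ take values in the complexification). A face operator is a self-adjoint positive definite operator $Q$ on $\mathcal H_1\oplus\mathcal H_1\oplus\mathcal H_2\oplus\mathcal H_2$, the summands being attached to the South, North, West, East sides ($S,N,W,E$) of a unit square. (Dihedral invariance): $\mathcal H_1=\mathcal H_2=\mathcal H$ and there are self-adjoint $T,A,U$ on $\mathcal H$ with $Q=\begin{pmatrix}T&A&U&U\\ A&T&U&U\\ U&U&T&A\\ U&U&A&T\end{pmatrix}$ (order $S,N,W,E$). (2Dsimple): let $\phi^{SN}(w)=Q_{SS}+Q_{NN}+wQ_{SN}+w^{-1}Q_{NS}$, $\phi^{WE}(z)=Q_{WW}+Q_{EE}+zQ_{WE}+z^{-1}Q_{EW}$, $\Psi_Q(z,w)=\begin{pmatrix}\phi^{SN}(w)&Q_{SW}+zQ_{SE}+w^{-1}Q_{NW}+w^{-1}zQ_{NE}\\ Q_{WS}+z^{-1}Q_{ES}+wQ_{WN}+wz^{-1}Q_{EN}&\phi^{WE}(z)\end{pmatrix}$. The zeroes of $\det\phi^{SN}$, $\det\phi^{WE}$ in $\mathbb C^*$ and of $\det\Psi_Q$ in $(\mathbb C^* )^2$ have multiplicity one with one-dimensional kernels there, and those of $\det\Psi_Q$ lie outside $S^1\times S^1$; for $\det\Psi_Q$, multiplicity one is understood in particular to mean that for each fixed $u\in S^1$ the zeroes in $\mathbb C^*$ of $w\mapsto\det\Psi_Q(u,w)$ and $z\mapsto\det\Psi_Q(z,u)$ are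 simple. One-dimensional operators: for a self-adjoint positive definite $K=\begin{pmatrix}K_{LL}&K_{LR}\\ K_{RL}&K_{RR}\end{pmatrix}$ put $\phi_K(z)=K_{LL}+K_{RR}+zK_{LR}+z^{-1}K_{RL}$; when the non-zero roots of $\det(z\phi_K(z))$ are simple with $\dim\ker\phi_K=1$, $W^L_K$ is the unique operator with $W^L_Kv=z^{-1}v$ for $v\in\ker\phi_K(z)$, $|z|>1$, and $W^L_Kv=0$ for $v\in\ker K_{LR}$. Strip functions, for $z,w\in S^1$: $\mathcal S_{WE}(z)=Q_{[SN],[SN]}-(Q_{[SN],W}+zQ_{[SN],E})\phi^{WE}(z)^{-1}(Q_{W,[SN]}+z^{-1}Q_{E,[SN]})$, $\mathcal S_{SN}(w)=Q_{[WE],[WE]}-(Q_{[WE],S}+w^{-1}Q_{[WE],N})\phi^{SN}(w)^{-1}(Q_{S,[WE]}+wQ_{N,[WE]})$ (block extractions with rows/columns in brackets). Put $\hat W_S(u)=W^L_{\mathcal S_{WE}(u)}$ ($L=S,R=N$), $\hat W_W(u)=W^L_{\mathcal S_{SN}(u)}$ ($L=W,R=E$), $G^*_{\infty_S}(u)=\mathcal S_{WE}(u)_{NN}+\mathcal S_{WE}(u)_{NS}\hat W_S(u)$, $G^*_{\infty_W}(u)=\mathcal S_{SN}(u)_{EE}+\mathcal S_{SN}(u)_{EW}\hat W_W(u)$. $\overline Q^{\infty_{WE},\infty_S}$ and $\overline Q^{\infty_W,\infty_{SN}}$ are the operators on $\ell^2(\mathbb Z;\mathcal H_1)$ and $\ell^2(\mathbb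 Z;\mathcal H_2)$ conjugate, through Fourier series $\hat f(e^{i\theta})=\sum_kf(k)e^{ik\theta}$, to pointwise multiplication by $G^*_{\infty_S}$ and $G^*_{\infty_W}$. Spaces: $\mathcal W_W=\ell^2(\mathbb Z_{<0};\mathcal H_1)$, $\mathcal W_S=\ell^2(\mathbb Z_{<0};\mathcal H_2)$. $U_Q^W:\mathcal H_2\to\mathcal W_W$ is $(U_Q^Wf)(-k-1)=U(\mathrm{id}+W)W^kf$, $k\geq0$, with $W=W^L_{Q_{[WE],[WE]}}$; $U_Q^S:\mathcal H_1\to\mathcal W_S$ is $(U_Q^Sf)(-k-1)=U(\mathrm{id}+W')W'^kf$ with $W'=W^L_{Q_{[SN],[SN]}}$. Folding: on $\ell^2(\mathbb Z;V)$ let $P$ be the orthogonal projection on $\ell^2(\mathbb Z_{<0};V)$ and $(Jf)(k)=f(-1-k)$. For bounded $M$, $\mathsf F(M)=PMP-PMJP$ on $\ell^2(\mathbb Z_{<0};V)$; it is written $\mathsf F^W$ when $V=\mathcal H_1$ is attached to horizontal edges (acting on $\mathcal W_W$) and $\mathsf F^S$ when $V=\mathcal H_2$ is attached to vertical edges (acting on $\mathcal W_S$). For a continuous $\hat a:S^1\to\mathrm{End}(V)$, $\mathsf F(\hat a)$ is $\mathsf F$ of the operator conjugate to multiplication by $\hat a$. Fixed points: West half-strip: $S,N$ sides $\mathcal W_W$, East side $\mathcal H_2$; South half-strip: $W,E$ sides $\mathcal W_S$, North side $\mathcal H_1$; South-West corner: North side $\mathcal W_W$, East side $\mathcal W_S$.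 For each of these shapes, $\mathcal Q_c$ is the set of bounded self-adjoint $M$ on the orthogonal sum of side spaces with $\inf_{x\ne0}\langle x,Mx\rangle/\langle x,x\rangle>0$. Gluing along a common side with space $V$: add the quadratic forms with a common variable on that side, take the Schur complement with respect to $V$ ($\mathrm{Schur}_{V_2}(M)=M_{11}-M_{12}M_{22}^{-1}M_{21}$), and identify a half-line followed by a unit segment with the half-line by conjugating with the unitary $D_1^L(w,h)(-1)=h$, $D_1^L(w,h)(k)=w(k+1)$ for $k<-1$. $\overline Q^W$ (resp. $\overline Q^S$) is the West (resp. South) half-strip element unchanged by gluing a face $Q$ along its East (resp. North) side. $\overline Q^{SW}$ is the corner element unchanged by gluing $\overline Q^S$ along its East side and unchanged by gluing $\overline Q^W$ along its North side. *)

theory Defs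
  imports "HOL-Complex_Analysis.Complex_Analysis"
begin

section \<open>Real or complex scalars\<close>

text \<open>
  The two instances, \<open>real\<close> and \<open>complex\<close>, treat real and complex Hilbert spaces
  simultaneously; \<open>to_complex\<close> is the inclusion used for complexification. On complex spaces the
  library inner product \<open>\<bullet>\<close> is the real part of the Hermitian one. For complex-linear
  operators, self-adjointness, adjoints and the numbers \<open>\<langle>x, M x\<rangle>\<close> (\<open>M\<close> self-adjoint) are the
  same for both.
\<close>

class real_or_complex = real_normed_field + real_inner +
  fixes to_complex :: "'a \<Rightarrow> complex"
  assumes to_complex_add: "to_complex (x + y) = to_complex x + to_complex y"
    and to_complex_mult: "to_complex (x * y) = to_complex x * to_complex y"
    and norm_to_complex: "norm (to_complex x) = norm x"
    and range_to_complex: "range to_complex = \<real> \<or> range to_complex = UNIV"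

instantiation real :: real_or_complex
begin
definition to_complex_real :: "real \<Rightarrow> complex" where "to_complex_real = complex_of_real"
instance by standard (auto simp: to_complex_real_def Reals_def)
end

instantiation complex :: real_or_complex
begin
definition to_complex_complex :: "complex \<Rightarrow> complex" where "to_complex_complex = id"
instance by standard (auto simp: to_complex_complex_def norm_mult)
end

definition to_complex_vec :: "'k::real_or_complex ^ 'n \<Rightarrow> complex ^ 'n" where
  "to_complex_vec v = (\<chi> i. to_complex (v $ i))"

lemma to_complex_0 [simp]: "to_complex 0 = 0"
  using to_complex_add[of 0 0] by simp

lemma norm_vector_scalar_mult:
  "norm (c *s (v :: 'k::real_or_complex ^ 'n)) = norm c * norm v"
  by (simp add: norm_vec_def norm_mult L2_set_right_distrib)

lemma norm_to_complex_vec [simp]: "norm (to_complex_vec v) = norm v"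
  by (simp add: norm_vec_def to_complex_vec_def norm_to_complex)


section \<open>Square-summable families\<close>

typedef (overloaded) ('i, 'a::real_inner) ell2 =
    "{f :: 'i \<Rightarrow> 'a. (\<lambda>i. (norm (f i))\<^sup>2) summable_on UNIV}"
  morphisms ell2_nth Abs_ell2
  by (rule exI[of _ "\<lambda>_. 0"]) simp

setup_lifting type_definition_ell2

lemma square_summable_bound:
  fixes f :: "'i \<Rightarrow> 'a::real_inner" and g :: "'i \<Rightarrow> real"
  assumes "g summable_on UNIV" "\<And>i. (norm (f i))\<^sup>2 \<le> g i"
  shows "(\<lambda>i. (norm (f i))\<^sup>2) summable_on UNIV"
  by (rule summable_on_comparison_test[of g UNIV]) (use assms in auto)

lemma square_summable_add:
  fixes f g :: "'i \<Rightarrow> 'a::real_inner"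
  assumes "(\<lambda>i. (norm (f i))\<^sup>2) summable_on UNIV" "(\<lambda>i. (norm (g i))\<^sup>2) summable_on UNIV"
  shows "(\<lambda>i. (norm (f i + g i))\<^sup>2) summable_on UNIV"
proof (rule square_summable_bound)
  show "(\<lambda>i. 2 * (norm (f i))\<^sup>2 + 2 * (norm (g i))\<^sup>2) summable_on UNIV"
    by (rule summable_on_add[OF summable_on_cmult_right summable_on_cmult_right]) (rule assms)+
  show "(norm (f i + g i))\<^sup>2 \<le> 2 * (norm (f i))\<^sup>2 + 2 * (norm (g i))\<^sup>2" for i
  proof -
    have "(norm (f i + g i))\<^sup>2 \<le> (norm (f i) + norm (g i))\<^sup>2"
      by (intro power_mono norm_triangle_ineq) simp
    also have "\<dots> \<le> 2 * (norm (f i))\<^sup>2 + 2 * (norm (g i))\<^sup>2"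
      using sum_squares_bound[of "norm (f i)" "norm (g i)"] by (simp add: power2_sum)
    finally show ?thesis .
  qed
qed

lemma square_summable_scaleR:
  fixes f :: "'i \<Rightarrow> 'a::real_inner"
  assumes "(\<lambda>i. (norm (f i))\<^sup>2) summable_on UNIV"
  shows "(\<lambda>i. (norm (c *\<^sub>R f i))\<^sup>2) summable_on UNIV"
  unfolding norm_scaleR power_mult_distrib by (rule summable_on_cmult_right) (rule assms)

lemma inner_summable:
  fixes f g :: "'i \<Rightarrow> 'a::real_inner"
  assumes f: "(\<lambda>i. (norm (f i))\<^sup>2) summable_on UNIV"
    and g: "(\<lambda>i. (norm (g i))\<^sup>2) summable_on UNIV"
  shows "(\<lambda>i. f i \<bullet> g i) summable_on UNIV"
proof -
  have "(\<lambda>i. norm (f i \<bullet> g i)) summable_on UNIV"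
  proof (rule summable_on_comparison_test)
    show "(\<lambda>i. (norm (f i))\<^sup>2 + (norm (g i))\<^sup>2) summable_on UNIV"
      using f g by (rule summable_on_add)
    show "norm (f i \<bullet> g i) \<le> (norm (f i))\<^sup>2 + (norm (g i))\<^sup>2" for i
    proof -
      have "norm (f i \<bullet> g i) \<le> norm (f i) * norm (g i)"
        using Cauchy_Schwarz_ineq2 by simp
      also have "\<dots> \<le> 2 * norm (f i) * norm (g i)" by simp
      also have "\<dots> \<le> (norm (f i))\<^sup>2 + (norm (g i))\<^sup>2"
        by (rule sum_squares_bound)
      finally show ?thesis .
    qed
  qed auto
  then show ?thesis by (rule abs_summable_summable)
qed

instantiation ell2 :: (type, real_inner) real_vector
begin

lift_definition zero_ell2 :: "('a, 'b) ell2" is "\<lambda>_. 0" by simp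

lift_definition plus_ell2 :: "('a, 'b) ell2 \<Rightarrow> ('a, 'b) ell2 \<Rightarrow> ('a, 'b) ell2"
  is "\<lambda>f g i. f i + g i" by (rule square_summable_add)

lift_definition uminus_ell2 :: "('a, 'b) ell2 \<Rightarrow> ('a, 'b) ell2" is "\<lambda>f i. - f i" by simp

lift_definition minus_ell2 :: "('a, 'b) ell2 \<Rightarrow> ('a, 'b) ell2 \<Rightarrow> ('a, 'b) ell2"
  is "\<lambda>f g i. f i - g i"
proof -
  fix f g :: "'a \<Rightarrow> 'b"
  assume "(\<lambda>i. (norm (f i))\<^sup>2) summable_on UNIV" "(\<lambda>i. (norm (g i))\<^sup>2) summable_on UNIV"
  then show "(\<lambda>i. (norm (f i - g i))\<^sup>2) summable_on UNIV"
    using square_summable_add[of f "\<lambda>i. - g i"] by simp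
qed

lift_definition scaleR_ell2 :: "real \<Rightarrow> ('a, 'b) ell2 \<Rightarrow> ('a, 'b) ell2"
  is "\<lambda>c f i. c *\<^sub>R f i" by (rule square_summable_scaleR)

instance
  by standard (transfer; simp add: algebra_simps)+

end

instantiation ell2 :: (type, real_inner) real_inner
begin

definition inner_ell2 :: "('a, 'b) ell2 \<Rightarrow> ('a, 'b) ell2 \<Rightarrow> real" where
  "inner_ell2 f g = (\<Sum>\<^sub>\<infinity>i. ell2_nth f i \<bullet> ell2_nth g i)"

definition norm_ell2 :: "('a, 'b) ell2 \<Rightarrow> real" where "norm_ell2 f = sqrt (f \<bullet> f)"

definition sgn_ell2 :: "('a, 'b) ell2 \<Rightarrow> ('a, 'b) ell2" where "sgn_ell2 f = f /\<^sub>R norm f"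

definition dist_ell2 :: "('a, 'b) ell2 \<Rightarrow> ('a, 'b) ell2 \<Rightarrow> real" where
  "dist_ell2 f g = norm (f - g)"

definition uniformity_ell2 :: "(('a, 'b) ell2 \<times> ('a, 'b) ell2) filter" where
  "uniformity_ell2 = (INF e\<in>{0 <..}. principal {(f, g). dist f g < e})"

definition open_ell2 :: "('a, 'b) ell2 set \<Rightarrow> bool" where
  "open_ell2 A = (\<forall>f\<in>A. \<forall>\<^sub>F (f', g) in uniformity. f' = f \<longrightarrow> g \<in> A)"

instance
proof
  fix f g h :: "('a, 'b) ell2" and c :: real
  have s: "(\<lambda>i. ell2_nth f i \<bullet> ell2_nth g i) summable_on UNIV" for f g :: "('a, 'b) ell2"
    using ell2_nth[of f] ell2_nth[of g] by (intro inner_summable) auto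
  show "sgn f = f /\<^sub>R norm f" by (rule sgn_ell2_def)
  show "dist f g = norm (f - g)" by (rule dist_ell2_def)
  show "(uniformity :: (('a, 'b) ell2 \<times> ('a, 'b) ell2) filter)
      = (INF e\<in>{0 <..}. principal {(f, g). dist f g < e})"
    by (rule uniformity_ell2_def)
  show "open A = (\<forall>f\<in>A. \<forall>\<^sub>F (f', g) in uniformity. f' = f \<longrightarrow> g \<in> A)"
    for A :: "('a, 'b) ell2 set" by (rule open_ell2_def)
  show "f \<bullet> g = g \<bullet> f" by (simp add: inner_ell2_def inner_commute)
  show "(f + g) \<bullet> h = f \<bullet> h + g \<bullet> h"
    by (simp add: inner_ell2_def plus_ell2.rep_eq inner_add_left infsum_add s)
  show "(c *\<^sub>R f) \<bullet> g = c * (f \<bullet> g)"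
    by (simp add: inner_ell2_def scaleR_ell2.rep_eq infsum_cmult_right')
  show "0 \<le> f \<bullet> f" by (simp add: inner_ell2_def infsum_nonneg)
  show "(f \<bullet> f = 0) = (f = 0)"
  proof
    assume "f \<bullet> f = 0"
    then have "ell2_nth f i \<bullet> ell2_nth f i = 0" for i
      using nonneg_infsum_le_0D[of "\<lambda>i. ell2_nth f i \<bullet> ell2_nth f i" UNIV i] s[of f f]
      by (simp add: inner_ell2_def)
    then have "ell2_nth f = (\<lambda>_. 0)" by auto
    then show "f = 0" by transfer
  qed (simp add: inner_ell2_def zero_ell2.rep_eq)
  show "norm f = sqrt (f \<bullet> f)" by (rule norm_ell2_def)
qed

end

lift_definition ell2_scale ::
    "'k::real_or_complex \<Rightarrow> ('i, 'k ^ 'n) ell2 \<Rightarrow> ('i, 'k ^ 'n) ell2"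
  is "\<lambda>c f i. c *s f i"
  unfolding norm_vector_scalar_mult power_mult_distrib by (rule summable_on_cmult_right)

lift_definition to_complex_ell2 ::
    "('i, 'k::real_or_complex ^ 'n) ell2 \<Rightarrow> ('i, complex ^ 'n) ell2"
  is "\<lambda>f i. to_complex_vec (f i)"
  by simp


section \<open>Half-lines and folding\<close>

text \<open>
  \<open>(int, 'a) ell2\<close> is $\ell^2(\mathbb{Z};V)$. The half-line space $\ell^2(\mathbb{Z}_{<0};V)$ is
  \<open>(nat, 'a) ell2\<close>, the index \<open>k :: nat\<close> standing for the site $-k-1$.
\<close>

lemma summable_on_half_line:
  "(\<lambda>k. g (- int k - 1)) summable_on UNIV \<longleftrightarrow> g summable_on {..<0::int}"
proof (rule summable_on_reindex_bij_betw)
  show "bij_betw (\<lambda>k. - int k - 1) UNIV {..<0}"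
    by (rule bij_betw_byWitness[where f' = "\<lambda>j. nat (- j - 1)"]) auto
qed

lift_definition half_restrict :: "(int, 'a::real_inner) ell2 \<Rightarrow> (nat, 'a) ell2"
  is "\<lambda>f k. f (- int k - 1)"
proof -
  fix f :: "int \<Rightarrow> 'a"
  assume "(\<lambda>i. (norm (f i))\<^sup>2) summable_on UNIV"
  then have "(\<lambda>i. (norm (f i))\<^sup>2) summable_on {..<0}"
    by (rule summable_on_subset_banach) simp
  then show "(\<lambda>k. (norm (f (- int k - 1)))\<^sup>2) summable_on UNIV"
    using summable_on_half_line[of "\<lambda>i. (norm (f i))\<^sup>2"] by simp
qed

lift_definition half_extend :: "(nat, 'a::real_inner) ell2 \<Rightarrow> (int, 'a) ell2"
  is "\<lambda>f j. if j < 0 then f (nat (- j - 1)) else 0"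
proof -
  fix f :: "nat \<Rightarrow> 'a"
  let ?g = "\<lambda>j::int. (norm (if j < 0 then f (nat (- j - 1)) else 0))\<^sup>2"
  assume "(\<lambda>i. (norm (f i))\<^sup>2) summable_on UNIV"
  then have "?g summable_on {..<0}"
    using summable_on_half_line[of ?g] by simp
  moreover have "?g summable_on {..<0} \<longleftrightarrow> ?g summable_on UNIV"
    by (rule summable_on_cong_neutral) auto
  ultimately show "?g summable_on UNIV" by simp
qed

lift_definition flip :: "(int, 'a::real_inner) ell2 \<Rightarrow> (int, 'a) ell2"
  is "\<lambda>f k. f (-1 - k)"
proof -
  fix f :: "int \<Rightarrow> 'a"
  have "bij_betw (\<lambda>k. -1 - k) (UNIV :: int set) UNIV"
    by (rule bij_betw_byWitness[where f' = "\<lambda>k. -1 - k"]) auto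
  moreover assume "(\<lambda>i. (norm (f i))\<^sup>2) summable_on UNIV"
  ultimately show "(\<lambda>k. (norm (f (-1 - k)))\<^sup>2) summable_on UNIV"
    using summable_on_reindex_bij_betw[of "\<lambda>k. -1 - k" UNIV UNIV "\<lambda>i. (norm (f i))\<^sup>2"] by simp
qed

text \<open>
  $\mathsf{F}(M) = PMP - PMJP$ as an operator on the half-line space: there $P$ on the right is
  the extension by zero, and $P$ on the left is the restriction.
\<close>

definition half_fold ::
    "((int, 'a::real_inner) ell2 \<Rightarrow> (int, 'a) ell2) \<Rightarrow> (nat, 'a) ell2 \<Rightarrow> (nat, 'a) ell2" where
  "half_fold M f = half_restrict (M (half_extend f)) - half_restrict (M (flip (half_extend f)))"

text \<open>
  The unitary $D_1^L$: the new value sits at site $-1$ (index 0), the old ones are moved one step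
  to the left.
\<close>

lift_definition ell2_push :: "(nat, 'a::real_inner) ell2 \<Rightarrow> 'a \<Rightarrow> (nat, 'a) ell2"
  is "\<lambda>w h k. case k of 0 \<Rightarrow> h | Suc m \<Rightarrow> w m"
proof -
  fix w :: "nat \<Rightarrow> 'a" and h :: 'a
  let ?g = "\<lambda>k. (norm (case k of 0 \<Rightarrow> h | Suc m \<Rightarrow> w m))\<^sup>2"
  assume "(\<lambda>i. (norm (w i))\<^sup>2) summable_on UNIV"
  then have "?g summable_on (range Suc)"
    by (subst summable_on_reindex) (simp_all add: o_def)
  then have "?g summable_on ({0} \<union> range Suc)"
    by (intro summable_on_Un_disjoint) auto
  moreover have "{0} \<union> range Suc = UNIV"
    unfolding insert_is_Un[symmetric]
    by (rule UNIV_nat_eq[symmetric])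
  ultimately show "?g summable_on UNIV" by simp
qed


section \<open>Fourier multipliers\<close>

text \<open>
  \<open>has_fourier_series f F\<close>: \<open>F\<close> represents $\hat f(e^{i\theta}) = \sum_k f(k) e^{ik\theta}$ in
  $L^2(S^1)$.
\<close>

definition fourier_coeff :: "(complex \<Rightarrow> complex ^ 'n) \<Rightarrow> int \<Rightarrow> complex ^ 'n" where
  "fourier_coeff F k =
     (1 / (2 * pi)) *\<^sub>R (LINT \<theta>:{0..2*pi}|lborel. cis (- of_int k * \<theta>) *s F (cis \<theta>))"

definition has_fourier_series ::
    "(int, complex ^ 'n) ell2 \<Rightarrow> (complex \<Rightarrow> complex ^ 'n) \<Rightarrow> bool" where
  "has_fourier_series f F \<longleftrightarrow>
     (\<lambda>\<theta>. F (cis \<theta>)) \<in> borel_measurable borel \<and>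
     set_integrable lborel {0..2*pi} (\<lambda>\<theta>. (norm (F (cis \<theta>)))\<^sup>2) \<and>
     (\<forall>k. ell2_nth f k = fourier_coeff F k)"

definition laurent_op ::
    "(complex \<Rightarrow> complex ^ 'n ^ 'n) \<Rightarrow> (int, complex ^ 'n) ell2 \<Rightarrow> (int, complex ^ 'n) ell2" where
  "laurent_op a = (THE M. bounded_linear M \<and>
     (\<forall>f F. has_fourier_series f F \<longrightarrow> has_fourier_series (M f) (\<lambda>u. a u *v F u)))"

abbreviation half_fold_symbol ::
    "(complex \<Rightarrow> complex ^ 'n ^ 'n) \<Rightarrow> (nat, complex ^ 'n) ell2 \<Rightarrow> (nat, complex ^ 'n) ell2" where
  "half_fold_symbol a \<equiv> half_fold (laurent_op a)"


section \<open>Face operators\<close>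

datatype side = South | North | West | East

text \<open>
  \<open>Q a b\<close> is the block of \<open>Q\<close> from the summand of side \<open>b\<close> to that of side \<open>a\<close>; all four
  summands are $\mathcal{H} = \mathbb{K}^n$, the setting of dihedral invariance.
\<close>

type_synonym ('k, 'n) blocks = "side \<Rightarrow> side \<Rightarrow> 'k ^ 'n ^ 'n"
type_synonym ('k, 'n) face_space = "('k ^ 'n) \<times> ('k ^ 'n) \<times> ('k ^ 'n) \<times> ('k ^ 'n)"

definition face_map ::
    "('k::real_or_complex, 'n::finite) blocks \<Rightarrow>
     ('k, 'n) face_space \<Rightarrow> ('k, 'n) face_space" where
  "face_map Q = (\<lambda>(s, n, w, e).
     let row = (\<lambda>a. Q a South *v s + Q a North *v n + Q a West *v w + Q a East *v e)
     in (row South, row North, row West, row East))"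

definition face_operator :: "('k::real_or_complex, 'n::finite) blocks \<Rightarrow> bool" where
  "face_operator Q \<longleftrightarrow>
     (\<forall>x y. face_map Q x \<bullet> y = x \<bullet> face_map Q y) \<and> (\<forall>x. x \<noteq> 0 \<longrightarrow> 0 < x \<bullet> face_map Q x)"

definition self_adjoint_matrix :: "'k::real_or_complex ^ 'n ^ 'n \<Rightarrow> bool" where
  "self_adjoint_matrix X \<longleftrightarrow> (\<forall>x y. (X *v x) \<bullet> y = x \<bullet> (X *v y))"

definition dihedral_blocks ::
    "'k::real_or_complex ^ 'n ^ 'n \<Rightarrow> 'k ^ 'n ^ 'n \<Rightarrow> 'k ^ 'n ^ 'n \<Rightarrow> ('k, 'n::finite) blocks" where
  "dihedral_blocks T A U = (\<lambda>a b.
     if a = b then T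
     else if {a, b} = {South, North} \<or> {a, b} = {West, East} then A
     else U)"

definition to_complex_blocks ::
    "('k::real_or_complex, 'n::finite) blocks \<Rightarrow> (complex, 'n) blocks" where
  "to_complex_blocks Q = (\<lambda>a b. map_matrix to_complex (Q a b))"


section \<open>Symbols and the simplicity assumption\<close>

definition cscale_matrix :: "complex \<Rightarrow> complex ^ 'm ^ 'n \<Rightarrow> complex ^ 'm ^ 'n" (infixr "*\<^sub>M" 75)
  where "c *\<^sub>M X = map_matrix ((*) c) X"

text \<open>
  \<open>line_symbol K l r\<close> is $\phi_K$ for the one-dimensional operator with left side \<open>l\<close> and right
  side \<open>r\<close>; in particular $\phi^{SN}$ is \<open>line_symbol Q South North\<close> and $\phi^{WE}$ is
  \<open>line_symbol Q West East\<close>.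
\<close>

definition line_symbol ::
    "(complex, 'n::finite) blocks \<Rightarrow> side \<Rightarrow> side \<Rightarrow> complex \<Rightarrow> complex ^ 'n ^ 'n" where
  "line_symbol K l r z = K l l + K r r + z *\<^sub>M K l r + inverse z *\<^sub>M K r l"

definition block_matrix ::
    "'a ^ 'n ^ 'n \<Rightarrow> 'a ^ 'n ^ 'n \<Rightarrow> 'a ^ 'n ^ 'n \<Rightarrow> 'a ^ 'n ^ 'n \<Rightarrow> 'a ^ ('n + 'n) ^ ('n + 'n::finite)" where
  "block_matrix X Y Z V = (\<chi> i j. case i of
       Inl i' \<Rightarrow> (case j of Inl j' \<Rightarrow> X $ i' $ j' | Inr j' \<Rightarrow> Y $ i' $ j')
     | Inr i' \<Rightarrow> (case j of Inl j' \<Rightarrow> Z $ i' $ j' | Inr j' \<Rightarrow> V $ i' $ j'))"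

definition face_symbol ::
    "(complex, 'n::finite) blocks \<Rightarrow> complex \<Rightarrow> complex \<Rightarrow> complex ^ ('n + 'n) ^ ('n + 'n)" where
  "face_symbol Q z w = block_matrix
     (line_symbol Q South North w)
     (Q South West + z *\<^sub>M Q South East + inverse w *\<^sub>M Q North West
        + (inverse w * z) *\<^sub>M Q North East)
     (Q West South + inverse z *\<^sub>M Q East South + w *\<^sub>M Q West North
        + (w * inverse z) *\<^sub>M Q East North)
     (line_symbol Q West East z)"

text \<open>
  The dimension of a kernel is the complex one, \<open>vec.dim\<close> (\<open>dim\<close> is the real one).
  A zero of a function of two variables has multiplicity one if some first-order
  partial derivative does not vanish there.
\<close>

definition simple_line_zeroes :: "(complex \<Rightarrow> complex ^ 'n ^ 'n) \<Rightarrow> bool" where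
  "simple_line_zeroes \<phi> \<longleftrightarrow>
     (\<forall>z. z \<noteq> 0 \<and> det (\<phi> z) = 0 \<longrightarrow>
        zorder (\<lambda>z. det (\<phi> z)) z = 1 \<and> vec.dim {v. \<phi> z *v v = 0} = 1)"

definition simple_2d :: "(complex, 'n::finite) blocks \<Rightarrow> bool" where
  "simple_2d Q \<longleftrightarrow>
     simple_line_zeroes (line_symbol Q South North) \<and>
     simple_line_zeroes (line_symbol Q West East) \<and>
     (\<forall>z w. z \<noteq> 0 \<and> w \<noteq> 0 \<and> det (face_symbol Q z w) = 0 \<longrightarrow>
        (deriv (\<lambda>z. det (face_symbol Q z w)) z \<noteq> 0 \<or> deriv (\<lambda>w. det (face_symbol Q z w)) w \<noteq> 0) \<and>
        vec.dim {v. face_symbol Q z w *v v = 0} = 1 \<and>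
        \<not> (norm z = 1 \<and> norm w = 1)) \<and>
     (\<forall>u w. norm u = 1 \<and> w \<noteq> 0 \<and> det (face_symbol Q u w) = 0 \<longrightarrow>
        zorder (\<lambda>w. det (face_symbol Q u w)) w = 1) \<and>
     (\<forall>u z. norm u = 1 \<and> z \<noteq> 0 \<and> det (face_symbol Q z u) = 0 \<longrightarrow>
        zorder (\<lambda>z. det (face_symbol Q z u)) z = 1)"


section \<open>Transfer operators and strip functions\<close>

text \<open>\<open>W_left K l r\<close> is $W^L_K$, with \<open>l\<close> and \<open>r\<close> as in \<open>line_symbol\<close>.\<close>

definition W_left :: "(complex, 'n::finite) blocks \<Rightarrow> side \<Rightarrow> side \<Rightarrow> complex ^ 'n ^ 'n" where
  "W_left K l r = (THE W.
     (\<forall>z v. norm z > 1 \<and> line_symbol K l r z *v v = 0 \<longrightarrow> W *v v = inverse z *s v) \<and>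
     (\<forall>v. K l r *v v = 0 \<longrightarrow> W *v v = 0))"

text \<open>Only the blocks with \<open>a, b\<close> in $\{S,N\}$, respectively $\{W,E\}$, are meant.\<close>

definition strip_WE :: "(complex, 'n::finite) blocks \<Rightarrow> complex \<Rightarrow> (complex, 'n) blocks" where
  "strip_WE Q z = (\<lambda>a b. Q a b -
     (Q a West + z *\<^sub>M Q a East) ** matrix_inv (line_symbol Q West East z)
       ** (Q West b + inverse z *\<^sub>M Q East b))"

definition strip_SN :: "(complex, 'n::finite) blocks \<Rightarrow> complex \<Rightarrow> (complex, 'n) blocks" where
  "strip_SN Q w = (\<lambda>a b. Q a b -
     (Q a South + inverse w *\<^sub>M Q a North) ** matrix_inv (line_symbol Q South North w)
       ** (Q South b + w *\<^sub>M Q North b))"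

definition W_hat_S :: "(complex, 'n::finite) blocks \<Rightarrow> complex \<Rightarrow> complex ^ 'n ^ 'n" where
  "W_hat_S Q u = W_left (strip_WE Q u) South North"

definition W_hat_W :: "(complex, 'n::finite) blocks \<Rightarrow> complex \<Rightarrow> complex ^ 'n ^ 'n" where
  "W_hat_W Q u = W_left (strip_SN Q u) West East"

definition G_inf_S :: "(complex, 'n::finite) blocks \<Rightarrow> complex \<Rightarrow> complex ^ 'n ^ 'n" where
  "G_inf_S Q u = strip_WE Q u North North + strip_WE Q u North South ** W_hat_S Q u"

definition G_inf_W :: "(complex, 'n::finite) blocks \<Rightarrow> complex \<Rightarrow> complex ^ 'n ^ 'n" where
  "G_inf_W Q u = strip_SN Q u East East + strip_SN Q u East West ** W_hat_W Q u"

text \<open>The half-plane operators $\overline Q^{\infty_{WE},\infty_S}$ and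
  $\overline Q^{\infty_W,\infty_{SN}}$.\<close>

definition Q_half_plane_S ::
    "(complex, 'n::finite) blocks \<Rightarrow> (int, complex ^ 'n) ell2 \<Rightarrow> (int, complex ^ 'n) ell2" where
  "Q_half_plane_S Q = laurent_op (G_inf_S Q)"

definition Q_half_plane_W ::
    "(complex, 'n::finite) blocks \<Rightarrow> (int, complex ^ 'n) ell2 \<Rightarrow> (int, complex ^ 'n) ell2" where
  "Q_half_plane_W Q = laurent_op (G_inf_W Q)"

text \<open>\<open>U_line U W\<close> is $f \mapsto (U(\mathrm{id}+W)W^k f)_{-k-1}$.\<close>

definition U_line ::
    "complex ^ 'n ^ 'n \<Rightarrow> complex ^ 'n ^ 'n \<Rightarrow> complex ^ 'n \<Rightarrow> (nat, complex ^ 'n) ell2" where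
  "U_line U W f = Abs_ell2 (\<lambda>k. U *v ((mat 1 + W) *v (((*v) W ^^ k) f)))"

definition U_West ::
    "complex ^ 'n ^ 'n \<Rightarrow> (complex, 'n::finite) blocks \<Rightarrow> complex ^ 'n \<Rightarrow> (nat, complex ^ 'n) ell2" where
  "U_West U Q = U_line U (W_left Q West East)"

definition U_South ::
    "complex ^ 'n ^ 'n \<Rightarrow> (complex, 'n::finite) blocks \<Rightarrow> complex ^ 'n \<Rightarrow> (nat, complex ^ 'n) ell2" where
  "U_South U Q = U_line U (W_left Q South North)"


section \<open>Gluing\<close>

definition pair_scale :: "('k \<Rightarrow> 'a \<Rightarrow> 'a) \<Rightarrow> ('k \<Rightarrow> 'b \<Rightarrow> 'b) \<Rightarrow> 'k \<Rightarrow> 'a \<times> 'b \<Rightarrow> 'a \<times> 'b" where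
  "pair_scale s1 s2 c = map_prod (s1 c) (s2 c)"

text \<open>
  The set $\mathcal{Q}_c$ on the space \<open>'v\<close> with scalar multiplication \<open>smul\<close>.
\<close>

definition coercive_ops :: "('k \<Rightarrow> 'v \<Rightarrow> 'v) \<Rightarrow> ('v::real_inner \<Rightarrow> 'v) set" where
  "coercive_ops smul = {M. bounded_linear M \<and>
     (\<forall>c x. M (smul c x) = smul c (M x)) \<and>
     (\<forall>x y. M x \<bullet> y = x \<bullet> M y) \<and>
     0 < (INF x\<in>-{0}. (x \<bullet> M x) / (x \<bullet> x))}"

text \<open>The Schur complement with respect to the second summand.\<close>

definition schur ::
    "('x::ab_group_add \<times> 'v::ab_group_add \<Rightarrow> 'x \<times> 'v) \<Rightarrow> 'x \<Rightarrow> 'x" where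
  "schur M x = fst (M (x, 0)) - fst (M (0, inv (\<lambda>v. snd (M (0, v))) (snd (M (x, 0)))))"

text \<open>
  \<open>sum_common A B\<close> is the operator of the form
  $\langle (x,v), A(x,v)\rangle + \langle (y,v), B(y,v)\rangle$ in the variables $((x,y),v)$.
\<close>

definition sum_common ::
    "('x \<times> 'v::ab_group_add \<Rightarrow> 'x \<times> 'v) \<Rightarrow> ('y \<times> 'v \<Rightarrow> 'y \<times> 'v) \<Rightarrow>
     ('x \<times> 'y) \<times> 'v \<Rightarrow> ('x \<times> 'y) \<times> 'v" where
  "sum_common A B = (\<lambda>((x, y), v).
     ((fst (A (x, v)), fst (B (y, v))), snd (A (x, v)) + snd (B (y, v))))"

definition glue ::
    "('x::ab_group_add \<times> 'v::ab_group_add \<Rightarrow> 'x \<times> 'v) \<Rightarrow>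
     ('y::ab_group_add \<times> 'v \<Rightarrow> 'y \<times> 'v) \<Rightarrow> 'x \<times> 'y \<Rightarrow> 'x \<times> 'y" where
  "glue A B = schur (sum_common A B)"

definition transport :: "('a \<Rightarrow> 'b) \<Rightarrow> ('a \<Rightarrow> 'a) \<Rightarrow> 'b \<Rightarrow> 'b" where
  "transport r M = r \<circ> M \<circ> inv r"


section \<open>Fixed points\<close>

type_synonym ('k, 'n) half_line = "(nat, 'k ^ 'n) ell2"

text \<open>
  West half-strip operators act on $((S, N), E)$, South half-strip operators on $((W, E), N)$,
  corner operators on $(N, E)$, each letter being the space of that side.
\<close>

type_synonym ('k, 'n) strip_space = "(('k, 'n) half_line \<times> ('k, 'n) half_line) \<times> ('k ^ 'n)"
type_synonym ('k, 'n) corner_space = "('k, 'n) half_line \<times> ('k, 'n) half_line"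

definition strip_ops ::
    "(('k::real_or_complex, 'n::finite) strip_space \<Rightarrow> ('k, 'n) strip_space) set" where
  "strip_ops = coercive_ops (pair_scale (pair_scale ell2_scale ell2_scale) (*s))"

definition corner_ops ::
    "(('k::real_or_complex, 'n::finite) corner_space \<Rightarrow> ('k, 'n) corner_space) set" where
  "corner_ops = coercive_ops (pair_scale ell2_scale ell2_scale)"

definition strip_join ::
    "(('k::real_or_complex, 'n::finite) half_line \<times> ('k, 'n) half_line) \<times> (('k ^ 'n) \<times> ('k ^ 'n) \<times> ('k ^ 'n))
     \<Rightarrow> ('k, 'n) strip_space" where
  "strip_join = (\<lambda>((f, g), (a, b, c)). ((ell2_push f a, ell2_push g b), c))"

definition is_west_fixed_point ::
    "('k::real_or_complex, 'n::finite) blocks \<Rightarrow>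
     (('k, 'n) strip_space \<Rightarrow> ('k, 'n) strip_space) \<Rightarrow> bool" where
  "is_west_fixed_point Q M \<longleftrightarrow> M \<in> strip_ops \<and>
     transport strip_join (glue M (transport (\<lambda>(s, n, w, e). ((s, n, e), w)) (face_map Q))) = M"

definition is_south_fixed_point ::
    "('k::real_or_complex, 'n::finite) blocks \<Rightarrow>
     (('k, 'n) strip_space \<Rightarrow> ('k, 'n) strip_space) \<Rightarrow> bool" where
  "is_south_fixed_point Q M \<longleftrightarrow> M \<in> strip_ops \<and>
     transport strip_join (glue M (transport (\<lambda>(s, n, w, e). ((w, e, n), s)) (face_map Q))) = M"

definition west_fixed_point ::
    "('k::real_or_complex, 'n::finite) blocks \<Rightarrow> ('k, 'n) strip_space \<Rightarrow> ('k, 'n) strip_space" where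
  "west_fixed_point Q = (THE M. is_west_fixed_point Q M)"

definition south_fixed_point ::
    "('k::real_or_complex, 'n::finite) blocks \<Rightarrow> ('k, 'n) strip_space \<Rightarrow> ('k, 'n) strip_space" where
  "south_fixed_point Q = (THE M. is_south_fixed_point Q M)"

text \<open>
  The first equation glues the East side of the corner to the West side of the South half-strip,
  the second one the North side of the corner to the South side of the West half-strip.
\<close>

definition is_corner_fixed_point ::
    "('k::real_or_complex, 'n::finite) blocks \<Rightarrow>
     (('k, 'n) corner_space \<Rightarrow> ('k, 'n) corner_space) \<Rightarrow> bool" where
  "is_corner_fixed_point Q C \<longleftrightarrow> C \<in> corner_ops \<and>
     transport (\<lambda>(f, (g, a)). (ell2_push f a, g))
       (glue C (transport (\<lambda>((w, e), n). ((e, n), w)) (south_fixed_point Q))) = C \<and>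
     transport (\<lambda>(g, (f, a)). (f, ell2_push g a))
       (glue (transport prod.swap C)
             (transport (\<lambda>((s, n), e). ((n, e), s)) (west_fixed_point Q))) = C"

definition corner_fixed_point ::
    "('k::real_or_complex, 'n::finite) blocks \<Rightarrow> ('k, 'n) corner_space \<Rightarrow> ('k, 'n) corner_space" where
  "corner_fixed_point Q = (THE C. is_corner_fixed_point Q C)"

definition corner_NN :: "('a::zero \<times> 'b::zero \<Rightarrow> 'a \<times> 'b) \<Rightarrow> 'a \<Rightarrow> 'a" where
  "corner_NN C h = fst (C (h, 0))"

definition corner_EE :: "('a::zero \<times> 'b::zero \<Rightarrow> 'a \<times> 'b) \<Rightarrow> 'b \<Rightarrow> 'b" where
  "corner_EE C g = snd (C (0, g))"

definition corner_EN :: "('a::zero \<times> 'b::zero \<Rightarrow> 'a \<times> 'b) \<Rightarrow> 'a \<Rightarrow> 'b" where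
  "corner_EN C h = snd (C (h, 0))"

definition corner_NE :: "('a::zero \<times> 'b::zero \<Rightarrow> 'a \<times> 'b) \<Rightarrow> 'b \<Rightarrow> 'a" where
  "corner_NE C g = fst (C (0, g))"

end

theory Submission
  imports Defs
begin

text \<open>
  Every fixed point is a Schur complement of a coercive form on an infinite chain: \<open>strip_op Q\<close>
  minimizes the sum of the face forms along a half-line of faces, and the corner minimizes the sum
  of the half-strip forms along a half-line of half-strips. Uniqueness holds because two solutions
  of the fixed point equation differ, along a minimizing chain, by a remainder depending only on
  the last state, and these states are square-summable. Gluings on the East and on the North
  commute, so the operator that solves one of the corner equations solves both.

  Under dihedral invariance all symbols depend on \<open>u\<close> through \<open>Re u\<close> only. Multiplication by such
  a symbol preserves the sequences that are odd under \<open>flip\<close>, and restricting it to these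
  sequences is exactly the folding, which is therefore an algebra homomorphism that preserves
  self-adjointness and positivity. It turns the pointwise Riccati equation \<open>G = T + A W\<close>,
  \<open>(G + T) W = - A\<close> of the strip functions into the Riccati equation of the half-strip operator,
  whose unique nonnegative solution is the diagonal block of the corner; the off-diagonal block is
  obtained by iterating the optimal transfer \<open>W\<close>. The eigenvectors that define \<open>W\<close> span the
  space because the pencil of \<open>T\<close> and \<open>A\<close> is self-adjoint.
\<close>

section \<open>Hilbert spaces\<close>

text \<open>Coercivity carries the construction of the fixed points: it makes the eliminated block
  bijective, so that gluing is the minimization of a quadratic form, and equations between operators
  are checked on forms. The fixed points live over the scalars \<open>'k\<close>, the symbols over
  the complex numbers. Since Schur complements commute with maps that intertwine the operators,
  complexification carries the corner of \<open>Q\<close> to the corner of the complexified face,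
  and the blocks are computed there. The matrix symbols are never factorized: a pointwise solution
  of the Riccati equation is the end block of the half-strip operator of an auxiliary face, with the
  strip blocks in place of \<open>T\<close> and \<open>A\<close> and with \<open>U = 0\<close>. It
  is bounded and unique, so that a closed graph argument makes it continuous in
  \<open>x = Re u\<close>. Continuity is what gives access to the Laurent operators: they arise as
  limits of polynomials in the sum of the two shifts, and commutation with \<open>flip\<close> is
  inherited from there.\<close>

lemma to_complex_minus: "to_complex (- x) = - to_complex (x :: 'k::real_or_complex)"
  using to_complex_add[of x "- x"] by (simp add: eq_neg_iff_add_eq_0 add.commute)

lemma to_complex_diff: "to_complex (x - y) = to_complex x - to_complex (y :: 'k::real_or_complex)"
  using to_complex_add[of x "- y"] by (simp add: to_complex_minus)

lemma to_complex_eq_iff [simp]: "to_complex x = to_complex y \<longleftrightarrow> x = (y :: 'k::real_or_complex)"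
  by (metis norm_to_complex norm_eq_zero right_minus_eq to_complex_diff)

lemma to_complex_1 [simp]: "to_complex (1 :: 'k::real_or_complex) = 1"
proof -
  have "to_complex (1 :: 'k) * to_complex (1 :: 'k) = to_complex (1 :: 'k)"
    by (metis mult_1 to_complex_mult)
  moreover have "to_complex (1 :: 'k) \<noteq> 0"
    by (metis norm_to_complex norm_one norm_zero zero_neq_one)
  ultimately show ?thesis by simp
qed

text \<open>The embedding is only known to be additive, multiplicative and isometric. The circle of
  radius \<open>\<bar>r\<bar>\<close> about 0 and the circle of radius
  \<open>\<bar>r - 1\<bar>\<close> about 1 meet only in \<open>r\<close>.\<close>

lemma to_complex_of_real [simp]: "to_complex (of_real r :: 'k::real_or_complex) = of_real r"
proof -
  let ?z = "to_complex (of_real r :: 'k)"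
  have a: "norm ?z = \<bar>r\<bar>" by (simp add: norm_to_complex)
  have b: "norm (?z - 1) = \<bar>r - 1\<bar>"
    by (metis norm_to_complex norm_of_real of_real_1 of_real_diff to_complex_1 to_complex_diff)
  have "(Re ?z)\<^sup>2 + (Im ?z)\<^sup>2 = r\<^sup>2" using a by (metis cmod_power2 power2_abs)
  moreover have "(Re ?z - 1)\<^sup>2 + (Im ?z)\<^sup>2 = (r - 1)\<^sup>2"
    using b cmod_power2[of "?z - 1"] by simp
  ultimately have "Re ?z = r" "Im ?z = 0" by (auto simp: power2_eq_square algebra_simps)
  then show ?thesis by (simp add: complex_eq_iff)
qed

lemma to_complex_scaleR: "to_complex (r *\<^sub>R x) = r *\<^sub>R to_complex (x :: 'k::real_or_complex)"
  by (simp add: scaleR_conv_of_real to_complex_mult)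

lemma bounded_linear_to_complex: "bounded_linear (to_complex :: 'k::real_or_complex \<Rightarrow> complex)"
  by (rule bounded_linear_intro[of _ 1])
    (simp_all add: to_complex_add to_complex_scaleR norm_to_complex)

lemma inner_isometry:
  fixes f :: "'a::real_inner \<Rightarrow> 'b::real_inner"
  assumes "linear f" "\<And>x. norm (f x) = norm x"
  shows "f x \<bullet> f y = x \<bullet> y"
  using assms by (simp add: dot_norm linear_add[symmetric])

lemma inner_to_complex: "to_complex x \<bullet> to_complex y = x \<bullet> (y :: 'k::real_or_complex)"
  by (rule inner_isometry)
    (simp_all add: bounded_linear.linear bounded_linear_to_complex norm_to_complex)

section \<open>Compactness for the scalars and completeness of the sequence spaces\<close>

instance real_or_complex \<subseteq> heine_borel
proof
  fix f :: "nat \<Rightarrow> 'a::real_or_complex"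
  assume "bounded (range f)"
  then obtain B where "\<And>n. norm (f n) \<le> B" by (auto simp: bounded_iff)
  then have "bounded (range (\<lambda>n. to_complex (f n)))"
    by (auto simp: bounded_iff norm_to_complex)
  then obtain l r where r: "strict_mono r" "(\<lambda>n. to_complex (f (r n))) \<longlonglongrightarrow> l"
    using bounded_imp_convergent_subsequence[of "\<lambda>n. to_complex (f n)"] by (auto simp: o_def)
  \<comment> \<open>The range is \<open>\<real>\<close> or everything, so the limit found in the
    complex numbers comes from a scalar.\<close>
  have "closed (range (to_complex :: 'a \<Rightarrow> complex))"
    using range_to_complex[where 'a = 'a] by (metis closed_complex_Reals closed_UNIV)
  with r have "l \<in> range (to_complex :: 'a \<Rightarrow> complex)"
    by (auto intro!: Lim_in_closed_set[OF _ _ _ r(2)])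
  then obtain x where "l = to_complex (x :: 'a)" by auto
  with r have "(\<lambda>n. to_complex (f (r n))) \<longlonglongrightarrow> to_complex x" by simp
  then have "(\<lambda>n. norm (to_complex (f (r n)) - to_complex x)) \<longlonglongrightarrow> 0"
    by (intro tendsto_norm_zero LIM_zero)
  then have "(\<lambda>n. norm ((f \<circ> r) n - x)) \<longlonglongrightarrow> 0"
    by (simp only: to_complex_diff[symmetric] norm_to_complex o_def)
  then have "(f \<circ> r) \<longlonglongrightarrow> x"
    by (rule LIM_zero_cancel[OF tendsto_norm_zero_cancel])
  with r show "\<exists>l r. strict_mono r \<and> (f \<circ> r) \<longlonglongrightarrow> l" by blast
qed

lemma ell2_summable [simp]: "(\<lambda>i. (norm (ell2_nth f i))\<^sup>2) summable_on UNIV"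
  using ell2_nth[of f] by simp

lemma norm_ell2_power2: "(norm f)\<^sup>2 = (\<Sum>\<^sub>\<infinity>i. (norm (ell2_nth f i))\<^sup>2)"
  unfolding power2_norm_eq_inner by (simp add: inner_ell2_def)

lemma ell2_eqI: "(\<And>i. ell2_nth f i = ell2_nth g i) \<Longrightarrow> f = g"
  by (metis ell2_nth_inject ext)

lemma ell2_nth_Abs: "(\<lambda>i. (norm (f i))\<^sup>2) summable_on UNIV \<Longrightarrow> ell2_nth (Abs_ell2 f) = f"
  by (simp add: Abs_ell2_inverse)

lemmas ell2_nth_simps [simp] =
  zero_ell2.rep_eq plus_ell2.rep_eq minus_ell2.rep_eq uminus_ell2.rep_eq scaleR_ell2.rep_eq
  ell2_scale.rep_eq to_complex_ell2.rep_eq half_restrict.rep_eq half_extend.rep_eq flip.rep_eq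

lemma sum_le_norm_ell2: "finite J \<Longrightarrow> (\<Sum>i\<in>J. (norm (ell2_nth f i))\<^sup>2) \<le> (norm f)\<^sup>2"
  unfolding norm_ell2_power2 by (rule finite_sum_le_infsum) auto

lemma norm_ell2_nth_le: "norm (ell2_nth f i) \<le> norm f"
  using sum_le_norm_ell2[of "{i}" f] by (simp add: abs_le_square_iff[symmetric])

lemma ell2_of_finite_sums:
  assumes "\<And>J. finite J \<Longrightarrow> (\<Sum>i\<in>J. (norm (g i))\<^sup>2) \<le> B"
  shows "(\<lambda>i. (norm (g i))\<^sup>2) summable_on UNIV" "(norm (Abs_ell2 g))\<^sup>2 \<le> B"
proof -
  show s: "(\<lambda>i. (norm (g i))\<^sup>2) summable_on UNIV"
    by (rule nonneg_bdd_above_summable_on) (auto intro!: bdd_aboveI2[of _ _ B] assms)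
  show "(norm (Abs_ell2 g))\<^sup>2 \<le> B"
    unfolding norm_ell2_power2 ell2_nth_Abs[OF s]
    by (rule infsum_le_finite_sums[OF s]) (use assms in auto)
qed

lemma norm_ell2_le:
  assumes "\<And>J. finite J \<Longrightarrow> (\<Sum>i\<in>J. (norm (ell2_nth f i))\<^sup>2) \<le> B"
  shows "(norm f)\<^sup>2 \<le> B"
  using ell2_of_finite_sums(2)[OF assms] by (simp add: ell2_nth_inverse)

text \<open>The limit is taken coordinatewise. On a finite set of coordinates the Cauchy estimate
  passes to the limit, and a bound that is uniform in the finite set is a bound in norm.\<close>

instance ell2 :: (type, "{real_inner, complete_space}") complete_space
proof
  fix X :: "nat \<Rightarrow> ('a, 'b) ell2"
  assume X: "Cauchy X"
  have "Cauchy (\<lambda>n. ell2_nth (X n) i)" for i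
    using X unfolding Cauchy_def dist_norm
    by (metis minus_ell2.rep_eq norm_ell2_nth_le order_le_less_trans)
  then have "\<exists>l. (\<lambda>n. ell2_nth (X n) i) \<longlonglongrightarrow> l" for i
    by (simp add: Cauchy_convergent_iff convergent_def)
  then obtain g where g: "\<And>i. (\<lambda>n. ell2_nth (X n) i) \<longlonglongrightarrow> g i" by metis
  have *: "(\<lambda>i. (norm (g i - ell2_nth (X n) i))\<^sup>2) summable_on UNIV \<and>
      (norm (Abs_ell2 (\<lambda>i. g i - ell2_nth (X n) i)))\<^sup>2 \<le> e\<^sup>2"
    if N: "\<And>m. m \<ge> N \<Longrightarrow> norm (X m - X n) < e" for n N e
  proof -
    have **: "(\<Sum>i\<in>J. (norm (g i - ell2_nth (X n) i))\<^sup>2) \<le> e\<^sup>2" if J: "finite J" for J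
    proof -
    have "(\<lambda>m. \<Sum>i\<in>J. (norm (ell2_nth (X m) i - ell2_nth (X n) i))\<^sup>2)
        \<longlonglongrightarrow> (\<Sum>i\<in>J. (norm (g i - ell2_nth (X n) i))\<^sup>2)"
      by (intro tendsto_intros g)
    moreover have "\<forall>m\<ge>N. (\<Sum>i\<in>J. (norm (ell2_nth (X m) i - ell2_nth (X n) i))\<^sup>2) \<le> e\<^sup>2"
    proof (intro allI impI)
      fix m assume "m \<ge> N"
      have "(\<Sum>i\<in>J. (norm (ell2_nth (X m) i - ell2_nth (X n) i))\<^sup>2) \<le> (norm (X m - X n))\<^sup>2"
        using sum_le_norm_ell2[OF J, of "X m - X n"] by simp
      also have "\<dots> \<le> e\<^sup>2" using N[OF \<open>m \<ge> N\<close>] by (intro power_mono) auto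
      finally show "(\<Sum>i\<in>J. (norm (ell2_nth (X m) i - ell2_nth (X n) i))\<^sup>2) \<le> e\<^sup>2" .
    qed
    ultimately show "(\<Sum>i\<in>J. (norm (g i - ell2_nth (X n) i))\<^sup>2) \<le> e\<^sup>2"
      by (intro LIMSEQ_le_const2) auto
    qed
    then show ?thesis using ell2_of_finite_sums[of "\<lambda>i. g i - ell2_nth (X n) i" "e\<^sup>2"] by blast
  qed
  obtain N where "\<And>m. m \<ge> N \<Longrightarrow> norm (X m - X N) < 1"
    using X unfolding Cauchy_def dist_norm by (metis order_refl zero_less_one)
  \<comment> \<open>The limit is the sum of one member \<open>X N\<close> of the sequence and a
    square-summable difference.\<close>
  from *[OF this] have "(\<lambda>i. (norm (g i - ell2_nth (X N) i + ell2_nth (X N) i))\<^sup>2) summable_on UNIV"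
    by (intro square_summable_add) auto
  then have g2: "ell2_nth (Abs_ell2 g) = g" by (simp add: ell2_nth_Abs)
  have "X \<longlonglongrightarrow> Abs_ell2 g"
  proof (rule LIMSEQ_I)
    fix r :: real assume "r > 0"
    then obtain N where N: "\<And>m n. m \<ge> N \<Longrightarrow> n \<ge> N \<Longrightarrow> norm (X m - X n) < r / 2"
      using X unfolding Cauchy_def dist_norm by (metis half_gt_zero)
    have "norm (X n - Abs_ell2 g) < r" if n: "n \<ge> N" for n
    proof -
      have s: "(\<lambda>i. (norm (g i - ell2_nth (X n) i))\<^sup>2) summable_on UNIV"
        and l: "(norm (Abs_ell2 (\<lambda>i. g i - ell2_nth (X n) i)))\<^sup>2 \<le> (r / 2)\<^sup>2"
        using *[of N n "r / 2"] N n by auto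
      have "Abs_ell2 (\<lambda>i. g i - ell2_nth (X n) i) = Abs_ell2 g - X n"
        by (rule ell2_eqI) (simp add: ell2_nth_Abs[OF s] g2)
      with l have "norm (Abs_ell2 g - X n) \<le> r / 2" using \<open>r > 0\<close>
        by (simp add: power2_le_iff_abs_le)
      then show ?thesis using \<open>r > 0\<close> by (simp add: norm_minus_commute)
    qed
    then show "\<exists>no. \<forall>n\<ge>no. norm (X n - Abs_ell2 g) < r" by blast
  qed
  then show "convergent X" by (auto simp: convergent_def)
qed

text \<open>\<open>Abs_ell2\<close> is meaningful only on square-summable families, which
  boundedness of \<open>A\<close> ensures; the facts about the entries therefore assume it.\<close>

definition ell2_map :: "('a::real_inner \<Rightarrow> 'b::real_inner) \<Rightarrow> ('i, 'a) ell2 \<Rightarrow> ('i, 'b) ell2" where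
  "ell2_map A f = Abs_ell2 (\<lambda>i. A (ell2_nth f i))"

lemma ell2_nth_map_bounded:
  assumes "bounded_linear A"
  shows "ell2_nth (ell2_map A f) i = A (ell2_nth f i)"
    and "norm (ell2_map A f) \<le> onorm A * norm f"
proof -
  have b: "(\<Sum>i\<in>J. (norm (A (ell2_nth f i)))\<^sup>2) \<le> (onorm A * norm f)\<^sup>2" if "finite J" for J
  proof -
    have "(\<Sum>i\<in>J. (norm (A (ell2_nth f i)))\<^sup>2) \<le> (\<Sum>i\<in>J. (onorm A * norm (ell2_nth f i))\<^sup>2)"
      by (intro sum_mono power_mono onorm[OF assms]) auto
    also have "\<dots> = (onorm A)\<^sup>2 * (\<Sum>i\<in>J. (norm (ell2_nth f i))\<^sup>2)"
      by (simp add: power_mult_distrib sum_distrib_left)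
    also have "\<dots> \<le> (onorm A)\<^sup>2 * (norm f)\<^sup>2"
      by (intro mult_left_mono sum_le_norm_ell2 that) auto
    finally show ?thesis by (simp add: power_mult_distrib)
  qed
  show "ell2_nth (ell2_map A f) i = A (ell2_nth f i)"
    unfolding ell2_map_def by (subst ell2_nth_Abs[OF ell2_of_finite_sums(1)[OF b]]) auto
  show "norm (ell2_map A f) \<le> onorm A * norm f"
    using ell2_of_finite_sums(2)[OF b] onorm_pos_le[OF assms]
    by (simp add: ell2_map_def power2_le_iff_abs_le)
qed

lemmas ell2_nth_map = ell2_nth_map_bounded(1)

lemma bounded_linear_ell2_map:
  assumes "bounded_linear A"
  shows "bounded_linear (ell2_map A)"
proof (rule bounded_linear_intro)
  show "norm (ell2_map A f) \<le> norm f * onorm A" for f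
    using ell2_nth_map_bounded(2)[OF assms, of f] by (simp add: mult.commute)
qed (auto intro!: ell2_eqI simp: ell2_nth_map assms linear_simps(1,5))

lemma inner_ell2_map_commute:
  assumes "bounded_linear A" "bounded_linear B" "\<And>x y. A x \<bullet> y = x \<bullet> B y"
  shows "ell2_map A f \<bullet> g = f \<bullet> ell2_map B g"
  using assms by (simp add: inner_ell2_def ell2_nth_map)

text \<open>Together with \<open>ell2_scale_eq_map\<close> this makes complexification and scalar
  multiplication two instances of one construction, so that a single intertwining argument serves
  both.\<close>

lemma to_complex_ell2_eq_map:
  "to_complex_ell2 = (ell2_map to_complex_vec :: ('i, 'k::real_or_complex ^ 'n::finite) ell2 \<Rightarrow> _)"
  and bounded_linear_to_complex_vec:
    "bounded_linear (to_complex_vec :: 'k ^ 'n \<Rightarrow> complex ^ 'n)"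
proof -
  show b: "bounded_linear (to_complex_vec :: 'k ^ 'n \<Rightarrow> complex ^ 'n)"
    by (rule bounded_linear_intro[of _ 1])
      (simp_all, simp_all add: to_complex_vec_def to_complex_add to_complex_scaleR vec_eq_iff)
  show "to_complex_ell2 = (ell2_map to_complex_vec :: ('i, 'k ^ 'n) ell2 \<Rightarrow> _)"
    by (rule ext, rule ell2_eqI) (simp add: ell2_nth_map b)
qed

lemma bounded_linear_vector_scalar_mult:
  "bounded_linear ((*s) (c :: 'k::real_or_complex) :: 'k ^ 'n \<Rightarrow> 'k ^ 'n::finite)"
  by (rule bounded_linear_intro[of _ "norm c"])
    (simp_all add: norm_vector_scalar_mult, simp_all add: vec_eq_iff algebra_simps)

lemma ell2_scale_eq_map: "ell2_scale c = ell2_map ((*s) (c :: 'k::real_or_complex))"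
  by (rule ext, rule ell2_eqI) (simp add: ell2_nth_map bounded_linear_vector_scalar_mult)

section \<open>Half-line sequences as an end value followed by a tail\<close>

lemma ell2_nth_push:
  "ell2_nth (ell2_push f a) 0 = a" "ell2_nth (ell2_push f a) (Suc k) = ell2_nth f k"
  by (simp_all add: ell2_push.rep_eq)

lift_definition ell2_pop :: "(nat, 'a::real_inner) ell2 \<Rightarrow> (nat, 'a) ell2" is "\<lambda>f k. f (Suc k)"
proof -
  fix f :: "nat \<Rightarrow> 'a"
  assume "(\<lambda>i. (norm (f i))\<^sup>2) summable_on UNIV"
  then have "(\<lambda>i. (norm (f i))\<^sup>2) summable_on range Suc" by (rule summable_on_subset_banach) simp
  then show "(\<lambda>k. (norm (f (Suc k)))\<^sup>2) summable_on UNIV"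
    by (subst (asm) summable_on_reindex) (simp_all add: o_def)
qed

lemmas ell2_nth_half_line [simp] = ell2_nth_push ell2_pop.rep_eq

lemma ell2_push_pop [simp]: "ell2_push (ell2_pop f) (ell2_nth f 0) = f"
  by (rule ell2_eqI, case_tac i) simp_all

lemma ell2_pop_push [simp]: "ell2_pop (ell2_push f a) = f"
  by (rule ell2_eqI) simp

lemma infsum_nat_split:
  fixes f :: "nat \<Rightarrow> real"
  assumes "f summable_on UNIV"
  shows "infsum f UNIV = f 0 + (\<Sum>\<^sub>\<infinity>k. f (Suc k))"
proof -
  have "infsum f (range Suc) = (\<Sum>\<^sub>\<infinity>k. f (Suc k))"
    by (subst infsum_reindex) (simp_all add: o_def)
  moreover have "infsum f ({0} \<union> range Suc) = infsum f {0} + infsum f (range Suc)"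
    by (rule infsum_Un_disjoint) (auto intro: summable_on_subset_banach[OF assms])
  moreover have "{0} \<union> range Suc = UNIV"
    unfolding insert_is_Un[symmetric] by (rule UNIV_nat_eq[symmetric])
  ultimately show ?thesis by simp
qed

lemma inner_half_line:
  "f \<bullet> g = ell2_nth f 0 \<bullet> ell2_nth g 0 + ell2_pop f \<bullet> ell2_pop (g :: (nat, 'a::real_inner) ell2)"
  unfolding inner_ell2_def by (subst infsum_nat_split) (auto intro!: inner_summable)

lemma inner_ell2_push [simp]: "ell2_push f a \<bullet> ell2_push g b = f \<bullet> g + a \<bullet> b"
  by (simp add: inner_half_line[of "ell2_push f a"])

lemma linear_ell2_push:
  "ell2_push (f + g) (a + b) = ell2_push f a + ell2_push g b"
  "ell2_push (c *\<^sub>R f) (c *\<^sub>R a) = c *\<^sub>R ell2_push f a"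
  "ell2_push 0 0 = 0"
  by (rule ell2_eqI, case_tac i; simp)+

lemma bounded_linear_ell2_nth: "bounded_linear (\<lambda>f. ell2_nth f i)"
  by (rule bounded_linear_intro[of _ 1]) (simp_all add: norm_ell2_nth_le)

lemma norm_half_line: "(norm f)\<^sup>2 = (norm (ell2_nth f 0))\<^sup>2 + (norm (ell2_pop f))\<^sup>2"
  unfolding power2_norm_eq_inner by (rule inner_half_line)

lemma bounded_linear_ell2_pop: "bounded_linear ell2_pop"
proof (rule bounded_linear_intro[of _ 1])
  show "norm (ell2_pop f) \<le> norm f * 1" for f :: "(nat, 'a) ell2"
    using norm_half_line[of f] by (simp add: power2_le_imp_le)
qed (auto intro!: ell2_eqI)

text \<open>The squared norm of the \<open>n\<close>-th tail is the squared norm of \<open>f\<close>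
  minus a partial sum of a series converging to it. This removes the inputs from the remainder in
  the uniqueness argument for half-lines.\<close>

lemma ell2_pop_tendsto_0: "(\<lambda>n. (ell2_pop ^^ n) f) \<longlonglongrightarrow> 0"
proof -
  have s: "(\<lambda>k. (norm (ell2_nth f k))\<^sup>2) sums (norm f)\<^sup>2"
    unfolding norm_ell2_power2 by (intro has_sum_imp_sums) simp
  have *: "(norm ((ell2_pop ^^ n) f))\<^sup>2 = (norm f)\<^sup>2 - (\<Sum>k<n. (norm (ell2_nth f k))\<^sup>2)" for n
  proof (induction n)
    case (Suc n)
    have "ell2_nth ((ell2_pop ^^ n) f) 0 = ell2_nth f n" for n
    proof -
      have "ell2_nth ((ell2_pop ^^ n) f) j = ell2_nth f (j + n)" for j
        by (induction n arbitrary: j) simp_all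
      then show ?thesis by simp
    qed
    then show ?case using Suc norm_half_line[of "(ell2_pop ^^ n) f"] by simp
  qed simp
  have "(\<lambda>n. (norm ((ell2_pop ^^ n) f))\<^sup>2) \<longlonglongrightarrow> (norm f)\<^sup>2 - (norm f)\<^sup>2"
    unfolding * using s by (intro tendsto_diff tendsto_const) (simp add: sums_def)
  then have "(\<lambda>n. sqrt ((norm ((ell2_pop ^^ n) f))\<^sup>2)) \<longlonglongrightarrow> sqrt 0"
    by (intro tendsto_real_sqrt) simp
  then show ?thesis by (simp add: tendsto_norm_zero_iff)
qed

section \<open>Coercive operators, Schur complements and gluing\<close>

definition op_form :: "('v::real_inner \<Rightarrow> 'v) \<Rightarrow> 'v \<Rightarrow> real" where
  "op_form M x = x \<bullet> M x"

text \<open>The minimum has to be attained. Two-stage minimizations can then be composed by choosing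
  minimizers, without approximating an infimum.\<close>

definition is_min :: "real \<Rightarrow> ('v \<Rightarrow> real) \<Rightarrow> bool" where
  "is_min m F \<longleftrightarrow> (\<forall>v. m \<le> F v) \<and> (\<exists>v. m = F v)"

definition symmetric_op :: "('v::real_inner \<Rightarrow> 'v) \<Rightarrow> bool" where
  "symmetric_op M \<longleftrightarrow> bounded_linear M \<and> (\<forall>x y. M x \<bullet> y = x \<bullet> M y)"

definition coercive :: "('v::real_inner \<Rightarrow> 'v) \<Rightarrow> bool" where
  "coercive M \<longleftrightarrow> symmetric_op M \<and> (\<exists>d>0. \<forall>x. d * (norm x)\<^sup>2 \<le> op_form M x)"

lemma coerciveE:
  assumes "coercive M"
  obtains d where "d > 0" "\<And>x. d * (norm x)\<^sup>2 \<le> op_form M x"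
  using assms by (auto simp: coercive_def)

lemma coercive_nonneg: "coercive M \<Longrightarrow> 0 \<le> op_form M x"
  by (metis coerciveE order_trans mult_nonneg_nonneg zero_le_power2 less_imp_le)

lemma symmetric_opD:
  assumes "symmetric_op M"
  shows "bounded_linear M" "M x \<bullet> y = x \<bullet> M y" "linear M"
    "M (x + y) = M x + M y" "M (x - y) = M x - M y" "M (- x) = - M x" "M 0 = 0"
    "M (r *\<^sub>R x) = r *\<^sub>R M x"
  using assms by (auto simp: symmetric_op_def linear_simps bounded_linear.linear)

lemma coercive_symmetric: "coercive M \<Longrightarrow> symmetric_op M"
  by (simp add: coercive_def)

lemma op_form_add:
  "symmetric_op M \<Longrightarrow> op_form M (x + y) = op_form M x + 2 * (M x \<bullet> y) + op_form M y"
  unfolding op_form_def using symmetric_opD(2)[of M x y]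
  by (simp add: symmetric_opD(4) inner_add_left inner_add_right inner_commute algebra_simps)

text \<open>Polarization recovers the operator from its form. This allows operator equations to be
  replaced by statements about minima.\<close>

lemma symmetric_op_eqI:
  assumes "symmetric_op M" "symmetric_op N" "\<And>x. op_form M x = op_form N x"
  shows "M = N"
proof
  fix x
  have "M x \<bullet> y = N x \<bullet> y" for y
    using op_form_add[OF assms(1), of x y] op_form_add[OF assms(2), of x y] assms(3) by simp
  then show "M x = N x" by (metis inner_diff_left inner_eq_zero_iff right_minus_eq)
qed

lemma bounded_op_form_le:
  assumes "bounded_linear M"
  obtains C where "C > 0" "\<And>x. \<bar>op_form M x\<bar> \<le> C * (norm x)\<^sup>2"
proof -
  obtain K where K: "K > 0" "\<And>x. norm (M x) \<le> norm x * K"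
    using bounded_linear.pos_bounded[OF assms] by blast
  have "\<bar>op_form M x\<bar> \<le> K * (norm x)\<^sup>2" for x
  proof -
    have "\<bar>op_form M x\<bar> \<le> norm x * norm (M x)"
      unfolding op_form_def by (rule Cauchy_Schwarz_ineq2)
    also have "\<dots> \<le> norm x * (norm x * K)" by (intro mult_left_mono K) auto
    finally show ?thesis by (simp add: power2_eq_square mult_ac)
  qed
  with K that show thesis by blast
qed

text \<open>The nonzero vector makes the index set of the infimum nonempty, which the passage from a
  lower bound \<open>d\<close> to the infimum requires. Boundedness of \<open>M\<close> bounds the
  quotients from below, so that conversely the infimum is itself such a \<open>d\<close>.\<close>

lemma coercive_ops_iff:
  assumes "(z :: 'v::real_inner) \<noteq> 0"
  shows "M \<in> coercive_ops smul \<longleftrightarrow> coercive M \<and> (\<forall>c (x::'v). M (smul c x) = smul c (M x))"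
proof -
  let ?f = "\<lambda>x. (x \<bullet> M x) / (x \<bullet> x)"
  have "0 < (INF x\<in>-{0}. ?f x) \<longleftrightarrow> (\<exists>d>0. \<forall>x. d * (norm x)\<^sup>2 \<le> op_form M x)"
    if b: "bounded_linear M"
  proof -
    obtain C where C: "C > 0" "\<And>x. \<bar>op_form M x\<bar> \<le> C * (norm x)\<^sup>2"
      using bounded_op_form_le[OF b] by blast
    have bdd: "bdd_below (?f ` (-{0}))"
    proof (rule bdd_belowI2)
      show "- C \<le> ?f x" if "x \<in> -{0}" for x
        using C(2)[of x] that
        by (simp add: op_form_def power2_norm_eq_inner pos_le_divide_eq abs_le_iff)
    qed
    show ?thesis
    proof
      assume pos: "0 < (INF x\<in>-{0}. ?f x)"
      have "(INF x\<in>-{0}. ?f x) * (norm x)\<^sup>2 \<le> op_form M x" for x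
      proof (cases "x = 0")
        case True
        then show ?thesis by (simp add: op_form_def)
      next
        case False
        then have "(INF x\<in>-{0}. ?f x) \<le> ?f x" by (intro cINF_lower bdd) auto
        then show ?thesis using False
          by (simp add: op_form_def power2_norm_eq_inner pos_le_divide_eq)
      qed
      with pos show "\<exists>d>0. \<forall>x. d * (norm x)\<^sup>2 \<le> op_form M x" by blast
    next
      assume "\<exists>d>0. \<forall>x. d * (norm x)\<^sup>2 \<le> op_form M x"
      then obtain d where d: "d > 0" "\<And>x. d * (norm x)\<^sup>2 \<le> op_form M x" by blast
      have "d \<le> (INF x\<in>-{0}. ?f x)"
        using assms d(2)
        by (intro cINF_greatest) (auto simp: op_form_def power2_norm_eq_inner pos_le_divide_eq)
      with d show "0 < (INF x\<in>-{0}. ?f x)" by simp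
    qed
  qed
  then show ?thesis
    unfolding coercive_ops_def coercive_def symmetric_op_def by auto
qed

text \<open>The Lax-Milgram argument through the Banach fixed point theorem: for suitable
  \<open>t\<close> the map taking \<open>x\<close> to \<open>x - t (D x - y)\<close> is a
  contraction, and its fixed points are the solutions of \<open>D x = y\<close>.\<close>

lemma coercive_bij:
  fixes D :: "'v::{real_inner, complete_space} \<Rightarrow> 'v"
  assumes "coercive D"
  shows "bij D"
proof -
  note sym = coercive_symmetric[OF assms]
  obtain d where d: "d > 0" "\<And>x. d * (norm x)\<^sup>2 \<le> op_form D x" using assms unfolding coercive_def by blast
  obtain B where B: "B > 0" "\<And>x. norm (D x) \<le> norm x * B"
    using bounded_linear.pos_bounded[OF symmetric_opD(1)[OF sym]] by blast
  \<comment> \<open>Enlarging the norm bound by \<open>d\<close> gives \<open>C > d\<close>, so that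
    \<open>1 - (d / C)\<^sup>2\<close> below is nonnegative and its square root can serve as
    contraction factor.\<close>
  define C where "C = B + d"
  have C: "C > d" "\<And>x. norm (D x) \<le> C * norm x" using B d
    by (auto simp: C_def algebra_simps intro: order_trans[OF B(2)])
  \<comment> \<open>The minimizer of \<open>1 - 2 * t * d + t\<^sup>2 * C\<^sup>2\<close>, which
    bounds the squared contraction factor.\<close>
  define t where "t = d / C\<^sup>2"
  have C0: "C > 0" using C d by linarith
  have t: "t > 0" "1 - 2 * t * d + t\<^sup>2 * C\<^sup>2 = 1 - (d / C)\<^sup>2"
    using d C0 by (simp_all add: t_def power2_eq_square field_simps)
  have r: "0 \<le> 1 - (d / C)\<^sup>2" "1 - (d / C)\<^sup>2 < 1"
    using d C(1) C0 by (simp_all add: power_le_one)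
  have contr: "norm (x - t *\<^sub>R D x) \<le> sqrt (1 - (d / C)\<^sup>2) * norm x" for x
  proof -
    have "(norm (x - t *\<^sub>R D x))\<^sup>2 = (norm x)\<^sup>2 - 2 * t * op_form D x + t\<^sup>2 * (norm (D x))\<^sup>2"
      unfolding power2_norm_eq_inner op_form_def
      by (simp add: inner_diff_left inner_diff_right inner_commute power2_eq_square algebra_simps)
    also have "\<dots> \<le> (norm x)\<^sup>2 - 2 * t * (d * (norm x)\<^sup>2) + t\<^sup>2 * (C * norm x)\<^sup>2"
      using t d C(2)[of x] by (intro add_mono diff_mono mult_left_mono power_mono) auto
    also have "\<dots> = (1 - 2 * t * d + t\<^sup>2 * C\<^sup>2) * (norm x)\<^sup>2" by (simp add: algebra_simps power_mult_distrib)
    also have "\<dots> = (sqrt (1 - (d / C)\<^sup>2) * norm x)\<^sup>2" using r t(2) by (simp add: power_mult_distrib)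
    finally show ?thesis by (rule power2_le_imp_le) (use r in simp)
  qed
  have "\<exists>!x. x - t *\<^sub>R (D x - y) = x" for y
  proof (rule banach_fix_type)
    show "0 \<le> sqrt (1 - (d / C)\<^sup>2)" "sqrt (1 - (d / C)\<^sup>2) < 1" using r by auto
    have eq: "(x - t *\<^sub>R (D x - y)) - (z - t *\<^sub>R (D z - y)) = (x - z) - t *\<^sub>R D (x - z)" for x z
      by (simp add: symmetric_opD(5)[OF sym] algebra_simps)
    show "\<forall>x z. dist (x - t *\<^sub>R (D x - y)) (z - t *\<^sub>R (D z - y))
        \<le> sqrt (1 - (d / C)\<^sup>2) * dist x z"
      by (simp only: dist_norm eq contr simp_thms)
  qed
  then have "\<exists>!x. D x = y" for y using t(1) by simp
  then show ?thesis by (simp add: bij_iff)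
qed

section \<open>Schur complements and gluing as minimization of forms\<close>

lemma op_form_Pair: "op_form M (x, v) = x \<bullet> fst (M (x, v)) + v \<bullet> snd (M (x, v))"
  by (simp add: op_form_def inner_prod_def)

lemma norm_Pair_power2: "(norm (x, y))\<^sup>2 = (norm x)\<^sup>2 + (norm y)\<^sup>2"
  by (simp add: norm_prod_def)

lemma coercive_snd:
  fixes M :: "'x::real_inner \<times> 'v::real_inner \<Rightarrow> 'x \<times> 'v"
  assumes "coercive M"
  shows "coercive (\<lambda>v. snd (M (0, v)))"
proof -
  note s = coercive_symmetric[OF assms]
  obtain d where d: "d > 0" "\<And>x. d * (norm x)\<^sup>2 \<le> op_form M x" using assms unfolding coercive_def by blast
  have "bounded_linear (\<lambda>v. snd (M (0, v)))"
    by (intro bounded_linear_snd_comp bounded_linear_compose[OF symmetric_opD(1)[OF s]]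
        bounded_linear_Pair bounded_linear_zero bounded_linear_ident)
  moreover have "snd (M (0, v)) \<bullet> w = v \<bullet> snd (M (0, w))" for v w
    using symmetric_opD(2)[OF s, of "(0, v)" "(0, w)"] by (simp add: inner_prod_def)
  moreover have "d * (norm v)\<^sup>2 \<le> op_form (\<lambda>v. snd (M (0, v))) v" for v
    using d(2)[of "(0, v)"] by (simp add: norm_Pair_power2 op_form_Pair) (simp add: op_form_def)
  ultimately show ?thesis using d(1) by (auto simp: coercive_def symmetric_op_def)
qed

text \<open>The inverse in \<open>schur\<close> need not be computed: exhibiting one
  \<open>v\<close> that annihilates the eliminated component determines the value of the
  complement.\<close>

lemma schur_stationary:
  fixes M :: "'x::real_inner \<times> 'v::{real_inner, complete_space} \<Rightarrow> 'x \<times> 'v"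
  assumes "coercive M"
  shows "\<exists>!v. snd (M (x, v)) = 0" "snd (M (x, v)) = 0 \<Longrightarrow> schur M x = fst (M (x, v))"
proof -
  note s = coercive_symmetric[OF assms]
  let ?D = "\<lambda>v. snd (M (0, v))"
  note bij = coercive_bij[OF coercive_snd[OF assms]]
  have split: "M (x, v) = M (x, 0) + M (0, v)" for v
    using symmetric_opD(4)[OF s, of "(x, 0)" "(0, v)"] by simp
  have iff: "snd (M (x, v)) = 0 \<longleftrightarrow> ?D v = - snd (M (x, 0))" for v
    unfolding split[of v] by (simp add: eq_neg_iff_add_eq_0 add.commute)
  show "\<exists>!v. snd (M (x, v)) = 0" unfolding iff using bij by (simp add: bij_iff)
  assume "snd (M (x, v)) = 0"
  then have "?D (- v) = snd (M (x, 0))"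
    using iff[of v] symmetric_opD(6)[OF s, of "(0, v)"] by simp
  then have "inv ?D (snd (M (x, 0))) = - v" by (intro inv_f_eq bij_is_inj bij)
  then show "schur M x = fst (M (x, v))"
    using symmetric_opD(6)[OF s, of "(0, v)"] split[of v] by (simp add: schur_def)
qed

text \<open>Everything is read off the minimizer \<open>v x\<close>, which depends linearly on
  \<open>x\<close> because the stationary point is unique. The complement is the first component of
  \<open>M (x, v x)\<close>, the form at any other point exceeds the minimum by the form of the
  difference, and a bound for \<open>v x\<close> bounds the complement.\<close>

lemma schur_coercive:
  fixes M :: "'x::real_inner \<times> 'v::{real_inner, complete_space} \<Rightarrow> 'x \<times> 'v"
  assumes M: "coercive M"
  shows "coercive (schur M)" "is_min (op_form (schur M) x) (\<lambda>v. op_form M (x, v))"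
proof -
  note s = coercive_symmetric[OF M]
  obtain d where d: "d > 0" "\<And>x. d * (norm x)\<^sup>2 \<le> op_form M x" using M unfolding coercive_def by blast
  obtain B where B: "B > 0" "\<And>x. norm (M x) \<le> norm x * B"
    using bounded_linear.pos_bounded[OF symmetric_opD(1)[OF s]] by blast
  obtain v where v: "\<And>x. snd (M (x, v x)) = 0" using schur_stationary(1)[OF M] by metis
  have S: "M (x, v x) = (schur M x, 0)" for x
    using schur_stationary(2)[OF M v] v by (simp add: prod_eq_iff)
  have v_unique: "snd (M (x, w)) = 0 \<Longrightarrow> w = v x" for x w
    using schur_stationary(1)[OF M, of x] v by blast
  have vadd: "v (x + y) = v x + v y" for x y
    using symmetric_opD(4)[OF s, of "(x, v x)" "(y, v y)"] v v_unique[of "x + y" "v x + v y"] by simp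
  have vscale: "v (r *\<^sub>R x) = r *\<^sub>R v x" for r x
    using symmetric_opD(8)[OF s, of r "(x, v x)"] v v_unique[of "r *\<^sub>R x" "r *\<^sub>R v x"] by simp
  have form: "op_form (schur M) x = op_form M (x, v x)" for x
    by (simp add: op_form_def S)
  have lower: "d * (norm x)\<^sup>2 \<le> op_form (schur M) x" for x
    unfolding form using d(2)[of "(x, v x)"] d(1)
    by (intro order_trans[OF _ d(2)]) (simp add: norm_Pair_power2)
  have min: "op_form (schur M) x \<le> op_form M (x, w)" for x w
  proof -
    have "op_form M ((x, v x) + (0, w - v x)) =
        op_form M (x, v x) + 2 * (M (x, v x) \<bullet> (0, w - v x)) + op_form M (0, w - v x)"
      by (rule op_form_add[OF s])
    then have "op_form M (x, w) = op_form M (x, v x) + op_form M (0, w - v x)" by (simp add: S)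
    then show ?thesis using coercive_nonneg[OF M, of "(0, w - v x)"] by (simp add: form)
  qed
  then show "is_min (op_form (schur M) x) (\<lambda>v. op_form M (x, v))"
    unfolding is_min_def using form by blast
  have symS: "schur M x \<bullet> y = x \<bullet> schur M y" for x y
    using symmetric_opD(2)[OF s, of "(x, v x)" "(y, v y)"] by (simp add: S)
  have add: "schur M (x + y) = schur M x + schur M y" for x y
    using symmetric_opD(4)[OF s, of "(x, v x)" "(y, v y)"] by (simp add: S vadd[symmetric])
  have scale: "schur M (r *\<^sub>R x) = r *\<^sub>R schur M x" for r x
    using symmetric_opD(8)[OF s, of r "(x, v x)"] by (simp add: S vscale[symmetric])
  \<comment> \<open>Coercivity in the direction \<open>(0, v x)\<close>, combined with stationarity,
    bounds the minimizer by the datum.\<close>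
  have bound: "norm (v x) \<le> norm x * (B / d)" for x
  proof -
    have "snd (M (0, v x)) = - snd (M (x, 0))"
      using symmetric_opD(4)[OF s, of "(x, 0)" "(0, v x)"] v[of x]
      by (simp add: eq_neg_iff_add_eq_0 add.commute)
    then have "d * (norm (v x))\<^sup>2 \<le> - (v x \<bullet> snd (M (x, 0)))"
      using d(2)[of "(0, v x)"] by (simp add: op_form_Pair norm_Pair_power2)
    also have "\<dots> \<le> norm (v x) * norm (snd (M (x, 0)))"
      using Cauchy_Schwarz_ineq2[of "v x" "snd (M (x, 0))"] by linarith
    also have "\<dots> \<le> norm (v x) * (norm x * B)"
      using norm_snd_le[of "snd (M (x, 0))" "fst (M (x, 0))"] B(2)[of "(x, 0)"]
      by (intro mult_left_mono) (auto simp: norm_Pair)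
    finally have "d * norm (v x) \<le> norm x * B"
      by (cases "norm (v x) = 0") (use B in \<open>auto simp: power2_eq_square mult_ac\<close>)
    then show ?thesis using d(1) by (simp add: field_simps)
  qed
  have "norm (schur M x) \<le> norm x * ((1 + B / d) * B)" for x
  proof -
    have "norm (schur M x) = norm (M (x, v x))" by (simp add: S norm_Pair)
    also have "\<dots> \<le> norm (x, v x) * B" by (rule B)
    also have "\<dots> \<le> (norm x + norm (v x)) * B"
      using B(1) norm_Pair_le[of x "v x"] by (intro mult_right_mono) auto
    also have "\<dots> \<le> (norm x + norm x * (B / d)) * B"
      using bound B(1) by (intro mult_right_mono add_left_mono) auto
    finally show ?thesis by (simp add: algebra_simps)
  qed
  then have "bounded_linear (schur M)" by (intro bounded_linear_intro[OF add scale])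
  then show "coercive (schur M)"
    unfolding coercive_def symmetric_op_def using symS d(1) lower by blast
qed

text \<open>
  Scalar homogeneity and compatibility with complexification are both instances of the following
  transfer principle.
\<close>

lemma schur_intertwine:
  fixes M :: "'x::real_inner \<times> 'v::{real_inner, complete_space} \<Rightarrow> 'x \<times> 'v"
    and N :: "'y::real_inner \<times> 'w::{real_inner, complete_space} \<Rightarrow> 'y \<times> 'w"
  assumes M: "coercive M" and N: "coercive N" and 0: "s 0 = 0"
    and MN: "\<And>x v. N (r x, s v) = map_prod r s (M (x, v))"
  shows "schur N (r x) = r (schur M x)"
proof -
  obtain v where v: "snd (M (x, v)) = 0" using schur_stationary(1)[OF M] by blast
  then have "snd (N (r x, s v)) = 0" by (simp add: MN 0)
  from schur_stationary(2)[OF N this] schur_stationary(2)[OF M v] show ?thesis by (simp add: MN)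
qed

lemma sum_common_apply:
  "sum_common A B ((x, y), v) =
     ((fst (A (x, v)), fst (B (y, v))), snd (A (x, v)) + snd (B (y, v)))"
  by (simp add: sum_common_def)

lemma op_form_sum_common:
  "op_form (sum_common A B) ((x, y), v) = op_form A (x, v) + op_form B (y, v)"
  by (simp add: op_form_Pair sum_common_apply inner_add_right)

lemma coercive_sum_common:
  fixes A :: "'x::real_inner \<times> 'v::real_inner \<Rightarrow> 'x \<times> 'v" and B :: "'y::real_inner \<times> 'v \<Rightarrow> 'y \<times> 'v"
  assumes A: "coercive A" and B: "coercive B"
  shows "coercive (sum_common A B)"
proof -
  note sA = coercive_symmetric[OF A] and sB = coercive_symmetric[OF B]
  obtain a where a: "a > 0" "\<And>x. a * (norm x)\<^sup>2 \<le> op_form A x" using A unfolding coercive_def by blast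
  obtain b where b: "b > 0" "\<And>x. b * (norm x)\<^sup>2 \<le> op_form B x" using B unfolding coercive_def by blast
  have eq: "sum_common A B = (\<lambda>z. let p = A (fst (fst z), snd z); q = B (snd (fst z), snd z)
      in ((fst p, fst q), snd p + snd q))"
    by (auto simp: sum_common_def fun_eq_iff Let_def)
  have bl: "bounded_linear (sum_common A B)"
    unfolding eq Let_def
    by (intro bounded_linear_Pair bounded_linear_add bounded_linear_fst_comp
        bounded_linear_snd_comp bounded_linear_compose[OF symmetric_opD(1)[OF sA]]
        bounded_linear_compose[OF symmetric_opD(1)[OF sB]] bounded_linear_ident)
  have "sum_common A B z \<bullet> z' = z \<bullet> sum_common A B z'" for z z'
  proof -
    obtain x y v x' y' v' where z: "z = ((x, y), v)" "z' = ((x', y'), v')"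
      by (metis surj_pair)
    show ?thesis unfolding z
      using symmetric_opD(2)[OF sA, of "(x, v)" "(x', v')"] symmetric_opD(2)[OF sB, of "(y, v)" "(y', v')"]
      by (simp add: sum_common_apply inner_prod_def inner_add_left inner_add_right)
  qed
  moreover have "min a b * (norm z)\<^sup>2 \<le> op_form (sum_common A B) z" for z
  proof -
    obtain x y v where z: "z = ((x, y), v)" by (metis surj_pair)
    have "min a b * (norm z)\<^sup>2 \<le> min a b * (norm (x, v))\<^sup>2 + min a b * (norm (y, v))\<^sup>2"
      unfolding z norm_Pair_power2 using a b by (simp add: algebra_simps)
    also have "\<dots> \<le> a * (norm (x, v))\<^sup>2 + b * (norm (y, v))\<^sup>2"
      by (intro add_mono mult_right_mono) auto
    also have "\<dots> \<le> op_form (sum_common A B) z"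
      unfolding z op_form_sum_common by (intro add_mono a b)
    finally show ?thesis .
  qed
  moreover have "min a b > 0" using a b by simp
  ultimately show ?thesis unfolding coercive_def symmetric_op_def using bl by blast
qed

text \<open>The second claim is used to characterize fixed points by their forms, the third to
  evaluate a glued operator once a stationary value on the common side has been guessed.\<close>

lemma glue_coercive:
  fixes A :: "'x::real_inner \<times> 'v::{real_inner, complete_space} \<Rightarrow> 'x \<times> 'v"
    and B :: "'y::real_inner \<times> 'v \<Rightarrow> 'y \<times> 'v"
  assumes A: "coercive A" and B: "coercive B"
  shows "coercive (glue A B)"
    "is_min (op_form (glue A B) (x, y)) (\<lambda>v. op_form A (x, v) + op_form B (y, v))"
    "snd (A (x, v)) + snd (B (y, v)) = 0 \<Longrightarrow> glue A B (x, y) = (fst (A (x, v)), fst (B (y, v)))"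
proof -
  note c = coercive_sum_common[OF A B]
  show "coercive (glue A B)" unfolding glue_def by (rule schur_coercive(1)[OF c])
  show "is_min (op_form (glue A B) (x, y)) (\<lambda>v. op_form A (x, v) + op_form B (y, v))"
    unfolding glue_def op_form_sum_common[symmetric] by (rule schur_coercive(2)[OF c])
  assume "snd (A (x, v)) + snd (B (y, v)) = 0"
  then show "glue A B (x, y) = (fst (A (x, v)), fst (B (y, v)))"
    using schur_stationary(2)[OF c, of "(x, y)" v] by (simp add: glue_def sum_common_apply)
qed

section \<open>Transport along unitary identifications of spaces\<close>

definition unitary :: "('a::real_inner \<Rightarrow> 'b::real_inner) \<Rightarrow> bool" where
  "unitary r \<longleftrightarrow> linear r \<and> bij r \<and> (\<forall>x y. r x \<bullet> r y = x \<bullet> y)"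

lemma transport_apply: "bij r \<Longrightarrow> transport r M (r x) = r (M x)"
  by (simp add: transport_def bij_is_inj)

lemma op_form_transport: "unitary r \<Longrightarrow> op_form (transport r M) (r x) = op_form M x"
  by (simp add: op_form_def unitary_def transport_apply)

lemma unitary_norm: "unitary r \<Longrightarrow> norm (r x) = norm x"
  by (simp add: unitary_def norm_eq_sqrt_inner)

lemma symmetric_op_transport:
  assumes r: "unitary r" and M: "symmetric_op M"
  shows "symmetric_op (transport r M)"
proof -
  have bij: "bij r" and lin: "linear r" and inner: "\<And>x y. r x \<bullet> r y = x \<bullet> y"
    using r by (auto simp: unitary_def)
  have ex: "\<exists>x. y = r x" for y using bij by (metis bij_pointE)
  obtain B where B: "B > 0" "\<And>x. norm (M x) \<le> norm x * B"
    using bounded_linear.pos_bounded[OF symmetric_opD(1)[OF M]] by blast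
  have "bounded_linear (transport r M)"
  proof (rule bounded_linear_intro)
    fix x y c
    obtain a b where [simp]: "x = r a" "y = r b" using ex by metis
    show "transport r M (x + y) = transport r M x + transport r M y"
      by (simp add: transport_apply[OF bij] linear_add[OF lin, symmetric] symmetric_opD(4)[OF M])
    show "transport r M (c *\<^sub>R x) = c *\<^sub>R transport r M x"
      by (simp add: transport_apply[OF bij] linear_scale[OF lin, symmetric] symmetric_opD(8)[OF M])
    show "norm (transport r M x) \<le> norm x * B"
      by (simp add: transport_apply[OF bij] unitary_norm[OF r] B)
  qed
  moreover have "transport r M x \<bullet> y = x \<bullet> transport r M y" for x y
    using ex[of x] ex[of y] symmetric_opD(2)[OF M] by (auto simp: transport_apply[OF bij] inner)
  ultimately show ?thesis by (simp add: symmetric_op_def)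
qed

lemma coercive_transport:
  assumes r: "unitary r" and M: "coercive M"
  shows "coercive (transport r M)"
proof -
  obtain d where d: "d > 0" "\<And>x. d * (norm x)\<^sup>2 \<le> op_form M x" using M unfolding coercive_def by blast
  have "\<exists>x. y = r x" for y using r unfolding unitary_def by (metis bij_pointE)
  then have "d * (norm y)\<^sup>2 \<le> op_form (transport r M) y" for y
    using d(2) op_form_transport[OF r] unitary_norm[OF r] by metis
  with d(1) symmetric_op_transport[OF r coercive_symmetric[OF M]] show ?thesis
    by (auto simp: coercive_def)
qed

section \<open>Fixed points on a half-line\<close>

text \<open>Several half-lines of values become one half-line of tuples, on which the operator of a
  single step acts site by site.\<close>

lift_definition ell2_zip ::
    "('i, 'a::real_inner) ell2 \<Rightarrow> ('i, 'b::real_inner) ell2 \<Rightarrow> ('i, 'a \<times> 'b) ell2"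
  is "\<lambda>f g i. (f i, g i)"
  unfolding norm_Pair_power2 by (rule summable_on_add)

lemmas ell2_nth_zip [simp] = ell2_zip.rep_eq

lemma inner_ell2_zip [simp]: "ell2_zip f g \<bullet> ell2_zip f' g' = f \<bullet> f' + g \<bullet> g'"
  using ell2_nth[of f] ell2_nth[of f'] ell2_nth[of g] ell2_nth[of g']
  by (simp add: inner_ell2_def infsum_add inner_summable)

lemma ell2_map_fst_snd [simp]:
  "ell2_nth (ell2_map fst y) i = fst (ell2_nth y i)"
  "ell2_nth (ell2_map snd y) i = snd (ell2_nth y i)"
  by (simp_all add: ell2_nth_map bounded_linear_fst bounded_linear_snd)

lemma ell2_zip_fst_snd [simp]: "ell2_zip (ell2_map fst y) (ell2_map snd y) = y"
  by (rule ell2_eqI) simp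

lemma ell2_map_zip [simp]: "ell2_map fst (ell2_zip f g) = f" "ell2_map snd (ell2_zip f g) = g"
  by (rule ell2_eqI, simp)+

lemma ell2_map_push: "bounded_linear A \<Longrightarrow> ell2_map A (ell2_push f a) = ell2_push (ell2_map A f) (A a)"
  by (rule ell2_eqI, case_tac i) (simp_all add: ell2_nth_map)

lemma ell2_zip_push: "ell2_zip (ell2_push f a) (ell2_push g b) = ell2_push (ell2_zip f g) (a, b)"
  by (rule ell2_eqI, case_tac i) simp_all

lemma op_form_ell2_map_push:
  "bounded_linear K \<Longrightarrow>
     op_form (ell2_map K) (ell2_push y a) = op_form (ell2_map K) y + op_form K a"
  by (simp add: op_form_def ell2_map_push)

lemma symmetric_op_ell2_map: "symmetric_op K \<Longrightarrow> symmetric_op (ell2_map K)"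
  unfolding symmetric_op_def using bounded_linear_ell2_map inner_ell2_map_commute by blast

lemma coercive_ell2_map:
  assumes "coercive K"
  shows "coercive (ell2_map K)"
proof -
  note s = coercive_symmetric[OF assms]
  note bl = symmetric_opD(1)[OF s]
  obtain d where d: "d > 0" "\<And>x. d * (norm x)\<^sup>2 \<le> op_form K x"
    using assms unfolding coercive_def by blast
  have "d * (norm y)\<^sup>2 \<le> op_form (ell2_map K) y" for y
  proof -
    have "d * (norm y)\<^sup>2 = (\<Sum>\<^sub>\<infinity>i. d * (norm (ell2_nth y i))\<^sup>2)"
      unfolding norm_ell2_power2 by (rule infsum_cmult_right'[symmetric])
    also have "\<dots> \<le> (\<Sum>\<^sub>\<infinity>i. ell2_nth y i \<bullet> ell2_nth (ell2_map K y) i)"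
      using ell2_nth[of y] ell2_nth[of "ell2_map K y"] d(2)
      by (intro infsum_mono inner_summable summable_on_cmult_right)
        (auto simp: ell2_nth_map bl op_form_def)
    finally show ?thesis by (simp add: op_form_def inner_ell2_def)
  qed
  with d(1) symmetric_op_ell2_map[OF s] show ?thesis by (auto simp: coercive_def)
qed

text \<open>
  \<open>K\<close> acts on an input, the state on the left and the state on the right of one step. The states
  of a chain are \<open>e\<close> at the end of the half-line and \<open>v\<close> further left.
\<close>

definition chain_states ::
    "((nat, 'x::real_inner) ell2 \<times> 'v::real_inner) \<times> (nat, 'v) ell2 \<Rightarrow> (nat, 'x \<times> 'v \<times> 'v) ell2" where
  "chain_states = (\<lambda>((f, e), v). ell2_zip f (ell2_zip v (ell2_push v e)))"

text \<open>The state at place \<open>k\<close> is the left state of step \<open>k\<close> and the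
  right state of step \<open>k + 1\<close>, hence the contributions \<open>w\<close> and
  \<open>ell2_pop e\<close> add up; the right state of step 0 is the end of the half-line.\<close>

definition chain_states_adjoint ::
    "(nat, 'x::real_inner \<times> 'v::real_inner \<times> 'v) ell2 \<Rightarrow> ((nat, 'x) ell2 \<times> 'v) \<times> (nat, 'v) ell2" where
  "chain_states_adjoint y =
     (let w = ell2_map fst (ell2_map snd y); e = ell2_map snd (ell2_map snd y)
      in ((ell2_map fst y, ell2_nth e 0), w + ell2_pop e))"

text \<open>Conjugating the stepwise action of \<open>K\<close> by \<open>chain_states\<close> and
  its adjoint gives the operator whose form is the sum of the forms of \<open>K\<close> over all
  steps.\<close>

definition chain_op ::
    "('x::real_inner \<times> 'v::real_inner \<times> 'v \<Rightarrow> 'x \<times> 'v \<times> 'v) \<Rightarrow>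
     ((nat, 'x) ell2 \<times> 'v) \<times> (nat, 'v) ell2 \<Rightarrow> ((nat, 'x) ell2 \<times> 'v) \<times> (nat, 'v) ell2" where
  "chain_op K z = chain_states_adjoint (ell2_map K (chain_states z))"

definition half_line_op ::
    "('x::real_inner \<times> 'v::real_inner \<times> 'v \<Rightarrow> 'x \<times> 'v \<times> 'v) \<Rightarrow>
     (nat, 'x) ell2 \<times> 'v \<Rightarrow> (nat, 'x) ell2 \<times> 'v" where
  "half_line_op K = schur (chain_op K)"

lemma chain_states_inner: "chain_states_adjoint y \<bullet> z = y \<bullet> chain_states z"
proof -
  obtain f e v where z: "z = ((f, e), v)" by (metis surj_pair)
  obtain a w b where y: "y = ell2_zip a (ell2_zip w b)" by (metis ell2_zip_fst_snd)
  show ?thesis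
    using inner_half_line[of b "ell2_push v e"]
    by (simp add: y z chain_states_def chain_states_adjoint_def Let_def inner_prod_def inner_add_left)
qed

lemma chain_states_push:
  "chain_states ((ell2_push f x, e), ell2_push v w) = ell2_push (chain_states ((f, w), v)) (x, w, e)"
  by (simp add: chain_states_def ell2_zip_push)

text \<open>Every variable of the chain occurs in some step, so that the chain inherits the
  coercivity constant of the steps.\<close>

lemma norm_chain_states: "norm z \<le> norm (chain_states z)"
proof -
  obtain f e v where z: "z = ((f, e), v)" by (metis surj_pair)
  show ?thesis
    by (simp add: z chain_states_def norm_eq_sqrt_inner inner_prod_def)
qed

text \<open>The factor 2 is a crude bound: no variable occurs more than twice among the
  steps.\<close>

lemma bounded_linear_chain_states:
  "bounded_linear (chain_states :: ((nat, 'x::real_inner) ell2 \<times> 'v::real_inner) \<times> (nat, 'v) ell2 \<Rightarrow> _)"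
proof (rule bounded_linear_intro[of _ 2])
  show "chain_states (y + z) = chain_states y + chain_states z"
    for y z :: "((nat, 'x) ell2 \<times> 'v) \<times> (nat, 'v) ell2"
    by (cases y, cases z) (auto simp: chain_states_def linear_ell2_push intro!: ell2_eqI)
  show "chain_states (c *\<^sub>R z) = c *\<^sub>R chain_states z"
    for c and z :: "((nat, 'x) ell2 \<times> 'v) \<times> (nat, 'v) ell2"
    by (cases z) (auto simp: chain_states_def linear_ell2_push intro!: ell2_eqI)
  show "norm (chain_states z) \<le> norm z * 2" for z :: "((nat, 'x) ell2 \<times> 'v) \<times> (nat, 'v) ell2"
  proof (rule power2_le_imp_le)
    obtain f e v where z: "z = ((f, e), v)" by (metis surj_pair)
    show "(norm (chain_states z))\<^sup>2 \<le> (norm z * 2)\<^sup>2"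
      by (simp add: z chain_states_def power2_norm_eq_inner inner_prod_def power_mult_distrib)
  qed simp
qed

lemma bounded_linear_chain_states_adjoint: "bounded_linear chain_states_adjoint"
  unfolding chain_states_adjoint_def Let_def
  by (intro bounded_linear_Pair bounded_linear_add bounded_linear_ell2_map bounded_linear_fst
      bounded_linear_snd bounded_linear_compose[OF bounded_linear_ell2_nth]
      bounded_linear_compose[OF bounded_linear_ell2_pop] bounded_linear_compose[OF bounded_linear_ell2_map])

lemma op_form_chain_op: "op_form (chain_op K) z = op_form (ell2_map K) (chain_states z)"
  using chain_states_inner[of "ell2_map K (chain_states z)" z]
  by (simp add: op_form_def chain_op_def inner_commute)

lemma chain_op_coercive:
  assumes "coercive K"
  shows "coercive (chain_op K)"
proof -
  note m = coercive_ell2_map[OF assms]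
  note s = coercive_symmetric[OF m]
  obtain d where d: "d > 0" "\<And>x :: (nat, _) ell2. d * (norm x)\<^sup>2 \<le> op_form (ell2_map K) x"
    using m unfolding coercive_def by blast
  have "bounded_linear (chain_op K)"
    unfolding chain_op_def
    by (intro bounded_linear_compose[OF bounded_linear_chain_states_adjoint]
        bounded_linear_compose[OF symmetric_opD(1)[OF s]] bounded_linear_chain_states)
  moreover have "chain_op K x \<bullet> y = x \<bullet> chain_op K y" for x y
  proof -
    have "chain_op K x \<bullet> y = chain_states x \<bullet> ell2_map K (chain_states y)"
      unfolding chain_op_def chain_states_inner by (rule symmetric_opD(2)[OF s])
    also have "\<dots> = chain_op K y \<bullet> x"
      unfolding chain_op_def chain_states_inner by (rule inner_commute)
    finally show ?thesis by (simp only: inner_commute)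
  qed
  moreover have "d * (norm z)\<^sup>2 \<le> op_form (chain_op K) z" for z
  proof -
    have "d * (norm z)\<^sup>2 \<le> d * (norm (chain_states z))\<^sup>2"
      using d(1) norm_chain_states[of z] by (intro mult_left_mono power_mono) auto
    also have "\<dots> \<le> op_form (ell2_map K) (chain_states z)" by (rule d(2))
    finally show ?thesis by (simp only: op_form_chain_op)
  qed
  ultimately show ?thesis using d(1) by (auto simp: coercive_def symmetric_op_def)
qed

lemma half_line_op_coercive:
  fixes K :: "'x::real_inner \<times> 'v::{real_inner, complete_space} \<times> 'v \<Rightarrow> 'x \<times> 'v \<times> 'v"
  assumes "coercive K"
  shows "coercive (half_line_op K)"
  unfolding half_line_op_def by (rule schur_coercive(1)[OF chain_op_coercive[OF assms]])

lemma is_min_unique: "is_min m F \<Longrightarrow> is_min m' F \<Longrightarrow> m = m'"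
  unfolding is_min_def by (metis order_antisym)

text \<open>The principle of dynamic programming: a chain with one more input is a chain ending in
  some state \<open>w\<close>, followed by the step from \<open>w\<close> to \<open>e\<close>, and
  the minimization may be carried out in two stages.\<close>

lemma half_line_op_min:
  fixes K :: "'x::real_inner \<times> 'v::{real_inner, complete_space} \<times> 'v \<Rightarrow> 'x \<times> 'v \<times> 'v"
  assumes K: "coercive K"
  shows "is_min (op_form (half_line_op K) (ell2_push f x, e))
    (\<lambda>w. op_form (half_line_op K) (f, w) + op_form K (x, w, e))"
proof -
  let ?E = "op_form (half_line_op K)" and ?F = "\<lambda>f e v. op_form (ell2_map K) (chain_states ((f, e), v))"
  have min: "is_min (?E (f, e)) (?F f e)" for f e
    unfolding half_line_op_def op_form_chain_op[symmetric]
    by (rule schur_coercive(2)[OF chain_op_coercive[OF K]])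
  have split: "?F (ell2_push f x) e (ell2_push v w) = ?F f w v + op_form K (x, w, e)" for v w
    unfolding chain_states_push
    by (rule op_form_ell2_map_push[OF symmetric_opD(1)[OF coercive_symmetric[OF K]]])
  have "?E (ell2_push f x, e) \<le> ?E (f, w) + op_form K (x, w, e)" for w
    using min[of f w] min[of "ell2_push f x" e] split unfolding is_min_def by metis
  moreover obtain v where v: "?E (ell2_push f x, e) = ?F (ell2_push f x) e v"
    using min unfolding is_min_def by blast
  then have "?E (f, ell2_nth v 0) + op_form K (x, ell2_nth v 0, e) \<le> ?E (ell2_push f x, e)"
    using min[of f "ell2_nth v 0"] split[of "ell2_pop v" "ell2_nth v 0"]
    unfolding is_min_def by simp
  ultimately show ?thesis unfolding is_min_def by (metis order_antisym)
qed

lemma half_line_op_stationary: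
  fixes K :: "'x::real_inner \<times> 'v::{real_inner, complete_space} \<times> 'v \<Rightarrow> 'x \<times> 'v \<times> 'v"
  assumes "coercive K" "snd (chain_op K ((f, e), v)) = 0"
  shows "half_line_op K (f, e) = fst (chain_op K ((f, e), v))"
  unfolding half_line_op_def using assms by (intro schur_stationary(2) chain_op_coercive)

text \<open>Acting by \<open>r\<close> on inputs and by \<open>s\<close> on states carries chains to
  chains and stationary chains to stationary chains.\<close>

lemma half_line_op_intertwine:
  fixes K :: "'x::real_inner \<times> 'v::{real_inner, complete_space} \<times> 'v \<Rightarrow> 'x \<times> 'v \<times> 'v"
    and L :: "'y::real_inner \<times> 'w::{real_inner, complete_space} \<times> 'w \<Rightarrow> 'y \<times> 'w \<times> 'w"
  assumes K: "coercive K" and L: "coercive L"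
    and r: "bounded_linear r" and s: "bounded_linear s"
    and KL: "\<And>z. L (map_prod r (map_prod s s) z) = map_prod r (map_prod s s) (K z)"
  shows "half_line_op L (ell2_map r f, s e) = map_prod (ell2_map r) s (half_line_op K (f, e))"
proof -
  note bK = symmetric_opD(1)[OF coercive_symmetric[OF K]]
    and bL = symmetric_opD(1)[OF coercive_symmetric[OF L]]
  let ?rs = "map_prod r (map_prod s s)"
  have rs: "bounded_linear ?rs"
    unfolding map_prod_def case_prod_unfold
    by (intro bounded_linear_Pair bounded_linear_fst_comp bounded_linear_snd_comp bounded_linear_ident
        bounded_linear_compose[OF r] bounded_linear_compose[OF s])
  have "chain_op L (map_prod (ell2_map r) s (f, e), ell2_map s v)
      = map_prod (map_prod (ell2_map r) s) (ell2_map s) (chain_op K ((f, e), v))" for f e v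
  proof -
    have "chain_states ((ell2_map r f, s e), ell2_map s v) = ell2_map ?rs (chain_states ((f, e), v))"
      unfolding chain_states_def
      by (rule ell2_eqI, case_tac i) (simp_all add: ell2_nth_map rs r s)
    moreover have "ell2_map L (ell2_map ?rs y) = ell2_map ?rs (ell2_map K y)" for y :: "(nat, _) ell2"
      by (rule ell2_eqI) (simp add: ell2_nth_map bK bL rs KL)
    moreover have "chain_states_adjoint (ell2_map ?rs y)
        = map_prod (map_prod (ell2_map r) s) (ell2_map s) (chain_states_adjoint y)" for y
      unfolding chain_states_adjoint_def Let_def
      by (auto intro!: ell2_eqI simp: ell2_nth_map rs r s linear_simps(1)[OF s])
    ultimately show ?thesis by (simp add: chain_op_def)
  qed
  then have "chain_op L (map_prod (ell2_map r) s z, ell2_map s v)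
      = map_prod (map_prod (ell2_map r) s) (ell2_map s) (chain_op K (z, v))" for z v
    by (cases z) simp
  from schur_intertwine[OF chain_op_coercive[OF K] chain_op_coercive[OF L] _ this, of "(f, e)"]
  show ?thesis
    by (simp add: half_line_op_def linear_simps(3)[OF bounded_linear_ell2_map[OF s]])
qed

text \<open>
  Along a minimizing chain of \<open>E'\<close> the states tend to zero because their squared norms are
  summable, so the remainder of \<open>E\<close> vanishes in the limit.
\<close>

lemma half_line_form_le:
  fixes E E' :: "'i::real_normed_vector \<times> 'v::real_normed_vector \<Rightarrow> real"
  assumes bound: "\<And>f e. E (f, e) \<le> C * ((norm f)\<^sup>2 + (norm e)\<^sup>2)"
    and nonneg: "\<And>z. 0 \<le> E' z"
    and pop: "\<And>f. (\<lambda>n. (pop ^^ n) f) \<longlonglongrightarrow> 0"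
    and d: "d > 0" and k: "\<And>f v e. d * (norm v)\<^sup>2 \<le> k f v e"
    and le: "\<And>f e v. E (f, e) \<le> E (pop f, v) + k f v e"
    and attained: "\<And>f e. \<exists>v. E' (pop f, v) + k f v e \<le> E' (f, e)"
  shows "E (f, e) \<le> E' (f, e)"
proof -
  obtain g where nxt: "\<And>f e. E' (pop f, g f e) + k f (g f e) e \<le> E' (f, e)"
    using attained by metis
  define z where "z = rec_nat (f, e) (\<lambda>_ (f, e). (pop f, g f e))"
  have z: "z 0 = (f, e)" "z (Suc n) = (pop (fst (z n)), g (fst (z n)) (snd (z n)))" for n
    by (simp_all add: z_def case_prod_unfold)
  have fst_z: "fst (z n) = (pop ^^ n) f" for n by (induction n) (simp_all add: z)
  define K where "K n = k (fst (z n)) (snd (z (Suc n))) (snd (z n))" for n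
  have K_ge: "d * (norm (snd (z (Suc n))))\<^sup>2 \<le> K n" for n unfolding K_def by (rule k)
  then have K0: "0 \<le> K n" for n using d by (metis order_trans mult_nonneg_nonneg less_imp_le zero_le_power2)
  \<comment> \<open>The chain \<open>z\<close> is minimizing for \<open>E'\<close> but only
    admissible for \<open>E\<close>: its cost bounds \<open>E'\<close> from below and, up to the
    remainder, \<open>E\<close> from above.\<close>
  have upper: "(\<Sum>j<n. K j) + E' (z n) \<le> E' (f, e)" for n
  proof (induction n)
    case (Suc n)
    have "E' (z (Suc n)) + K n \<le> E' (z n)"
      using nxt[of "fst (z n)" "snd (z n)"] by (simp add: K_def z(2))
    then show ?case using Suc by simp
  qed (simp add: z)
  have lower: "E (f, e) \<le> (\<Sum>j<n. K j) + E (z n)" for n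
  proof (induction n)
    case (Suc n)
    have "E (z n) \<le> E (z (Suc n)) + K n"
      using le[of "fst (z n)" "snd (z n)" "snd (z (Suc n))"] by (simp add: K_def z(2))
    then show ?case using Suc by simp
  qed (simp add: z)
  have "(\<Sum>j<n. K j) \<le> E' (f, e)" for n using upper[of n] nonneg[of "z n"] by linarith
  then have "summable K" using K0 by (intro summableI_nonneg_bounded)
  then have "K \<longlonglongrightarrow> 0" by (rule summable_LIMSEQ_zero)
  then have Kd: "(\<lambda>n. K n / d) \<longlonglongrightarrow> 0" by (rule tendsto_divide_zero)
  \<comment> \<open>\<open>K n\<close> controls the state reached by step \<open>n\<close>; the
    starting state \<open>e\<close> is not controlled, hence the shift by one.\<close>
  have "(\<lambda>n. (norm (snd (z (Suc n))))\<^sup>2) \<longlonglongrightarrow> 0"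
  proof (rule tendsto_sandwich[OF _ _ tendsto_const Kd])
    show "\<forall>\<^sub>F n in sequentially. (norm (snd (z (Suc n))))\<^sup>2 \<le> K n / d"
      using K_ge d by (simp add: pos_le_divide_eq mult.commute)
  qed simp
  moreover have "(\<lambda>n. (norm (fst (z (Suc n))))\<^sup>2) \<longlonglongrightarrow> 0"
    unfolding fst_z using LIMSEQ_Suc[OF tendsto_norm_zero[OF pop[of f]]]
    by (intro tendsto_null_power) auto
  ultimately have lim: "(\<lambda>n. E' (f, e) + C * ((norm (fst (z (Suc n))))\<^sup>2 + (norm (snd (z (Suc n))))\<^sup>2))
      \<longlonglongrightarrow> E' (f, e) + C * (0 + 0)"
    by (intro tendsto_intros)
  have "E (f, e) \<le> E' (f, e) + C * ((norm (fst (z (Suc n))))\<^sup>2 + (norm (snd (z (Suc n))))\<^sup>2)" for n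
    using lower[of "Suc n"] upper[of "Suc n"] nonneg[of "z (Suc n)"] bound[of "fst (z (Suc n))" "snd (z (Suc n))"]
    by simp
  then show ?thesis using LIMSEQ_le_const[OF lim] by fastforce
qed

section \<open>Half-strips and corners\<close>

text \<open>A right inverse is enough, since preservation of inner products already gives
  injectivity.\<close>

lemma unitaryI:
  assumes "\<And>x y. r (x + y) = r x + r y" "\<And>c x. r (c *\<^sub>R x) = c *\<^sub>R r x"
    and "\<And>x y. r x \<bullet> r y = x \<bullet> y" "\<And>y. r (s y) = y"
  shows "unitary r"
proof -
  have lin: "linear r" using assms(1,2) by (rule linearI)
  have "x = y" if "r x = r y" for x y
  proof -
    have "(x - y) \<bullet> (x - y) = r (x - y) \<bullet> r (x - y)" by (simp only: assms(3))
    also have "r (x - y) = 0" using that by (simp add: linear_diff[OF lin])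
    finally show "x = y" by simp
  qed
  then have "bij r" by (metis assms(4) bijI injI surjI)
  with lin assms(3) show ?thesis by (simp add: unitary_def)
qed

lemma unitary_bij: "unitary r \<Longrightarrow> bij r" by (simp add: unitary_def)

lemma unitary_rearrange:
  "unitary (\<lambda>(s, n, w, e). ((s, n), w, e))"
  "unitary (\<lambda>(s, n, w, e). ((s, n, e), w))"
  "unitary (\<lambda>(s, n, w, e). ((w, e, n), s))"
  "unitary (\<lambda>((w, e), n). (n, w, e))"
  "unitary (\<lambda>((w, e), n). ((e, n), w))"
  "unitary prod.swap"
proof -
  show "unitary (\<lambda>(s, n, w, e). ((s, n), w, e))"
    by (rule unitaryI[of _ "\<lambda>((s, n), w, e). (s, n, w, e)"]) (auto simp: inner_prod_def)
  show "unitary (\<lambda>(s, n, w, e). ((s, n, e), w))"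
    by (rule unitaryI[of _ "\<lambda>((s, n, e), w). (s, n, w, e)"]) (auto simp: inner_prod_def)
  show "unitary (\<lambda>(s, n, w, e). ((w, e, n), s))"
    by (rule unitaryI[of _ "\<lambda>((w, e, n), s). (s, n, w, e)"]) (auto simp: inner_prod_def)
  show "unitary (\<lambda>((w, e), n). (n, w, e))"
    by (rule unitaryI[of _ "\<lambda>(n, w, e). ((w, e), n)"]) (auto simp: inner_prod_def)
  show "unitary (\<lambda>((w, e), n). ((e, n), w))"
    by (rule unitaryI[of _ "\<lambda>((e, n), w). ((w, e), n)"]) (auto simp: inner_prod_def)
  show "unitary prod.swap"
    by (rule unitaryI[of _ prod.swap]) (auto simp: inner_prod_def)
qed

lemma unitary_unzip: "unitary (\<lambda>(F, e). ((ell2_map fst F, ell2_map snd F), e))"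
proof (rule unitaryI[of _ "\<lambda>((f, g), e). (ell2_zip f g, e)"], goal_cases)
  case (3 x y)
  show ?case
    using inner_ell2_zip[of "ell2_map fst (fst x)" "ell2_map snd (fst x)" "ell2_map fst (fst y)" "ell2_map snd (fst y)"]
    by (simp add: case_prod_unfold inner_prod_def)
qed (auto intro!: ell2_eqI)

lemma unitary_strip_join: "unitary strip_join"
  by (rule unitaryI[of _ "\<lambda>((f, g), c). ((ell2_pop f, ell2_pop g), (ell2_nth f 0, ell2_nth g 0, c))"])
    (auto simp: strip_join_def inner_prod_def linear_ell2_push)

lemma unitary_push_fst: "unitary (\<lambda>(f, (g, a)). (ell2_push f a, g))"
  by (rule unitaryI[of _ "\<lambda>(f, g). (ell2_pop f, (g, ell2_nth f 0))"])
    (auto simp: inner_prod_def linear_ell2_push)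

lemma unitary_push_snd: "unitary (\<lambda>(g, (f, a)). (f, ell2_push g a))"
  by (rule unitaryI[of _ "\<lambda>(f, g). (ell2_pop g, (f, ell2_nth g 0))"])
    (auto simp: inner_prod_def linear_ell2_push)

lemmas unitary_half_line = unitary_unzip unitary_strip_join unitary_push_fst unitary_push_snd

lemma unitary_surj: "unitary r \<Longrightarrow> \<exists>x. y = r x"
  unfolding unitary_def by (metis bij_pointE)

text \<open>Both sides are self-adjoint, so it suffices to compare forms, and the form of a gluing
  is the minimum over the common side. Every fixed point equation is turned into a family of minimum
  conditions in this way.\<close>

lemma transport_glue_eq_iff:
  fixes A :: "'x::real_inner \<times> 'v::{real_inner, complete_space} \<Rightarrow> 'x \<times> 'v"
    and B :: "'y::real_inner \<times> 'v \<Rightarrow> 'y \<times> 'v"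
  assumes A: "coercive A" and B: "coercive B" and C: "symmetric_op C" and r: "unitary r"
  shows "transport r (glue A B) = C \<longleftrightarrow>
    (\<forall>x y. is_min (op_form C (r (x, y))) (\<lambda>v. op_form A (x, v) + op_form B (y, v)))"
    (is "?l = ?r")
proof
  assume ?l
  then show ?r using glue_coercive(2)[OF A B] op_form_transport[OF r] by metis
next
  assume rhs: ?r
  show ?l
  proof (rule symmetric_op_eqI)
    show "symmetric_op (transport r (glue A B))"
      by (intro symmetric_op_transport r coercive_symmetric glue_coercive A B)
    show "op_form (transport r (glue A B)) z = op_form C z" for z
    proof -
      obtain x y where z: "z = r (x, y)" using unitary_surj[OF r, of z] by auto
      show ?thesis
        unfolding z op_form_transport[OF r]
        using glue_coercive(2)[OF A B] rhs by (blast intro: is_min_unique)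
    qed
  qed (rule C)
qed

lemma bounded_linear_matrix_vector_mult:
  "bounded_linear ((*v) (M :: 'k::real_or_complex ^ 'n::finite ^ 'm::finite))"
proof (rule bounded_linear_intro)
  show "M *v (x + y) = M *v x + M *v y" for x y by (rule matrix_vector_right_distrib)
  show "M *v (c *\<^sub>R x) = c *\<^sub>R (M *v x)" for c x
    by (simp add: matrix_vector_mult_def vec_eq_iff scaleR_sum_right)
  show "norm (M *v x) \<le> norm x * (\<Sum>i\<in>UNIV. \<Sum>j\<in>UNIV. norm (M $ i $ j))" for x
  proof -
    have "norm (M *v x) \<le> (\<Sum>i\<in>UNIV. norm ((M *v x) $ i))"
      unfolding norm_vec_def by (rule L2_set_le_sum) simp
    also have "\<dots> \<le> (\<Sum>i\<in>UNIV. \<Sum>j\<in>UNIV. norm (M $ i $ j) * norm x)"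
    proof (rule sum_mono)
      fix i
      have "norm ((M *v x) $ i) \<le> (\<Sum>j\<in>UNIV. norm (M $ i $ j * x $ j))"
        by (simp add: matrix_vector_mult_def norm_sum)
      also have "\<dots> \<le> (\<Sum>j\<in>UNIV. norm (M $ i $ j) * norm x)"
        unfolding norm_mult by (intro sum_mono mult_left_mono Finite_Cartesian_Product.norm_nth_le) auto
      finally show "norm ((M *v x) $ i) \<le> (\<Sum>j\<in>UNIV. norm (M $ i $ j) * norm x)" .
    qed
    finally show ?thesis by (simp add: sum_distrib_left mult.commute)
  qed
qed

lemma bounded_linear_face_map: "bounded_linear (face_map Q)"
  unfolding face_map_def Let_def case_prod_unfold
  by (intro bounded_linear_Pair bounded_linear_add bounded_linear_fst_comp bounded_linear_snd_comp
      bounded_linear_compose[OF bounded_linear_matrix_vector_mult] bounded_linear_ident)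

text \<open>The form has a positive minimum on the compact unit sphere, and homogeneity extends the
  bound. The vector \<open>z\<close> makes the sphere nonempty.\<close>

lemma coercive_of_positive:
  fixes M :: "'v::{real_inner, heine_borel} \<Rightarrow> 'v"
  assumes M: "symmetric_op M" and pos: "\<And>x. x \<noteq> 0 \<Longrightarrow> 0 < op_form M x" and z: "z \<noteq> (0 :: 'v)"
  shows "coercive M"
proof -
  have "continuous_on (sphere 0 1) (op_form M)"
    unfolding op_form_def
    by (intro continuous_intros bounded_linear.continuous_on[OF symmetric_opD(1)[OF M]])
  moreover have "compact (sphere (0::'v) 1)"
  proof -
    have "sphere 0 1 = {x :: 'v. norm x = 1}" by auto
    moreover have "closed {x :: 'v. norm x = 1}" by (intro closed_Collect_eq continuous_intros)
    moreover have "bounded {x :: 'v. norm x = 1}" by (rule boundedI[of _ 1]) simp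
    ultimately show ?thesis by (simp add: compact_eq_bounded_closed)
  qed
  moreover have "z /\<^sub>R norm z \<in> sphere 0 1" using z by simp
  ultimately obtain a where a: "a \<in> sphere 0 1" "\<And>x. x \<in> sphere 0 1 \<Longrightarrow> op_form M a \<le> op_form M x"
    using continuous_attains_inf[of "sphere 0 1" "op_form M"] by blast
  have "op_form M a * (norm x)\<^sup>2 \<le> op_form M x" for x
  proof (cases "x = 0")
    case False
    have "op_form M a \<le> op_form M (x /\<^sub>R norm x)" using False by (intro a) simp
    also have "\<dots> = op_form M x / (norm x)\<^sup>2"
      by (simp add: op_form_def symmetric_opD(8)[OF M] power2_eq_square field_simps)
    finally show ?thesis using False by (simp add: pos_le_divide_eq)
  qed (simp add: op_form_def)
  moreover have "op_form M a > 0" using a(1) by (intro pos) auto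
  ultimately show ?thesis using M by (auto simp: coercive_def)
qed

section \<open>Half-strips as half-lines of faces\<close>

lemma coercive_face_map:
  assumes "face_operator (Q :: ('k::real_or_complex, 'n::finite) blocks)"
  shows "coercive (face_map Q)"
proof (rule coercive_of_positive)
  show "symmetric_op (face_map Q)"
    using assms by (simp add: symmetric_op_def face_operator_def bounded_linear_face_map)
  show "0 < op_form (face_map Q) x" if "x \<noteq> 0" for x
    using assms that unfolding face_operator_def op_form_def by blast
  show "(axis undefined 1, 0, 0, 0) \<noteq> (0 :: ('k, 'n) face_space)" by (simp add: zero_prod_def)
qed

text \<open>A face read as one step of a horizontal chain: the South and North sides form the input,
  the West and East sides are the states.\<close>

definition strip_step ::
    "('k::real_or_complex, 'n::finite) blocks \<Rightarrow>
     (('k ^ 'n) \<times> ('k ^ 'n)) \<times> ('k ^ 'n) \<times> ('k ^ 'n) \<Rightarrow> (('k ^ 'n) \<times> ('k ^ 'n)) \<times> ('k ^ 'n) \<times> ('k ^ 'n)" where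
  "strip_step Q = transport (\<lambda>(s, n, w, e). ((s, n), w, e)) (face_map Q)"

definition strip_op ::
    "('k::real_or_complex, 'n::finite) blocks \<Rightarrow> ('k, 'n) strip_space \<Rightarrow> ('k, 'n) strip_space" where
  "strip_op Q = transport (\<lambda>(F, e). ((ell2_map fst F, ell2_map snd F), e)) (half_line_op (strip_step Q))"

text \<open>A half-strip read as one step of a chain, from its West half-line to its East half-line,
  with the unit North side as input.\<close>

definition corner_step ::
    "(('k::real_or_complex, 'n::finite) strip_space \<Rightarrow> ('k, 'n) strip_space) \<Rightarrow>
     ('k ^ 'n) \<times> ('k, 'n) half_line \<times> ('k, 'n) half_line \<Rightarrow> ('k ^ 'n) \<times> ('k, 'n) half_line \<times> ('k, 'n) half_line" where
  "corner_step S = transport (\<lambda>((w, e), n). (n, w, e)) S"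

lemma strip_step_apply:
  "strip_step Q ((s, n), w, e) = (\<lambda>(s, n, w, e). ((s, n), w, e)) (face_map Q (s, n, w, e))"
  using transport_apply[OF unitary_bij[OF unitary_rearrange(1)], of "face_map Q" "(s, n, w, e)"]
  by (simp add: strip_step_def)

lemma strip_op_apply:
  "strip_op Q ((f, g), e) =
     (\<lambda>(F, e). ((ell2_map fst F, ell2_map snd F), e)) (half_line_op (strip_step Q) (ell2_zip f g, e))"
  using transport_apply[OF unitary_bij[OF unitary_half_line(1)], of "half_line_op (strip_step Q)" "(ell2_zip f g, e)"]
  by (simp add: strip_op_def)

lemma corner_step_apply:
  "corner_step S (n, w, e) = (\<lambda>((w, e), n). (n, w, e)) (S ((w, e), n))"
  using transport_apply[OF unitary_bij[OF unitary_rearrange(4)], of S "((w, e), n)"]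
  by (simp add: corner_step_def)

lemma op_form_rearrange:
  "op_form (transport (\<lambda>(s, n, w, e). ((s, n, e), w)) M) ((a, b, c), d) = op_form M (a, b, d, c)"
  "op_form (transport (\<lambda>((w, e), n). ((e, n), w)) S) ((g, a), v) = op_form S ((v, g), a)"
  "op_form (transport prod.swap C) (v, f) = op_form C (f, v)"
  "op_form (corner_step S) (a, v, g) = op_form S ((v, g), a)"
  "op_form (strip_step Q) ((a, b), w, e) = op_form (face_map Q) (a, b, w, e)"
  "op_form (strip_op Q) ((f, g), e) = op_form (half_line_op (strip_step Q)) (ell2_zip f g, e)"
  using op_form_transport[OF unitary_rearrange(2), of M "(a, b, d, c)"]
    op_form_transport[OF unitary_rearrange(5), of S "((v, g), a)"]
    op_form_transport[OF unitary_rearrange(6), of C "(f, v)"]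
    op_form_transport[OF unitary_rearrange(4), of S "((v, g), a)"]
    op_form_transport[OF unitary_rearrange(1), of "face_map Q" "(a, b, w, e)"]
    op_form_transport[OF unitary_half_line(1), of "half_line_op (strip_step Q)" "(ell2_zip f g, e)"]
  by (simp_all add: corner_step_def strip_step_def strip_op_def)

context
  fixes Q :: "('k::real_or_complex, 'n::finite) blocks"
  assumes Q: "face_operator Q"
begin

lemma coercive_strip_step: "coercive (strip_step Q)"
  unfolding strip_step_def by (intro coercive_transport unitary_rearrange coercive_face_map Q)

lemma coercive_strip_op: "coercive (strip_op Q)"
  unfolding strip_op_def
  by (intro coercive_transport unitary_half_line half_line_op_coercive coercive_strip_step)

lemma strip_op_min:
  "is_min (op_form (strip_op Q) ((ell2_push f a, ell2_push g b), e))
     (\<lambda>y. op_form (strip_op Q) ((f, g), y) + op_form (face_map Q) (a, b, y, e))"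
  unfolding op_form_rearrange ell2_zip_push
  using half_line_op_min[OF coercive_strip_step, of "ell2_zip f g" "(a, b)" e]
  by (simp only: op_form_rearrange)

lemma strip_equation_iff:
  assumes "symmetric_op M" "coercive M"
  shows "transport strip_join (glue M (transport (\<lambda>(s, n, w, e). ((s, n, e), w)) (face_map Q))) = M \<longleftrightarrow>
    (\<forall>f g a b e. is_min (op_form M ((ell2_push f a, ell2_push g b), e))
       (\<lambda>y. op_form M ((f, g), y) + op_form (face_map Q) (a, b, y, e)))"
  by (subst transport_glue_eq_iff[OF assms(2) _ assms(1) unitary_strip_join])
    (simp_all add: coercive_transport unitary_rearrange coercive_face_map Q
      strip_join_def op_form_rearrange)

lemma pair_pop_tendsto_0:
  "(\<lambda>n. (map_prod ell2_pop ell2_pop ^^ n) p) \<longlonglongrightarrow> 0"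
proof -
  have "(map_prod ell2_pop ell2_pop ^^ n) p = ((ell2_pop ^^ n) (fst p), (ell2_pop ^^ n) (snd p))" for n
    by (induction n) (simp_all add: prod_eq_iff)
  moreover have "(\<lambda>n. ((ell2_pop ^^ n) (fst p), (ell2_pop ^^ n) (snd p))) \<longlonglongrightarrow> (0, 0)"
    by (intro tendsto_Pair ell2_pop_tendsto_0)
  ultimately show ?thesis by (simp add: zero_prod_def)
qed

text \<open>The comparison on half-lines, with the pair of South and North sequences as inputs.
  Exchanging \<open>M\<close> and \<open>N\<close> gives equality of the forms.\<close>

lemma strip_form_le:
  fixes M N :: "('k, 'n) strip_space \<Rightarrow> ('k, 'n) strip_space"
  assumes M: "coercive M" and N: "coercive N"
    and eqM: "\<forall>f g a b e. is_min (op_form M ((ell2_push f a, ell2_push g b), e))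
       (\<lambda>y. op_form M ((f, g), y) + op_form (face_map Q) (a, b, y, e))"
    and eqN: "\<forall>f g a b e. is_min (op_form N ((ell2_push f a, ell2_push g b), e))
       (\<lambda>y. op_form N ((f, g), y) + op_form (face_map Q) (a, b, y, e))"
  shows "op_form M z \<le> op_form N z"
proof -
  obtain C where C: "\<And>x. \<bar>op_form M x\<bar> \<le> C * (norm x)\<^sup>2"
    using bounded_op_form_le[OF symmetric_opD(1)[OF coercive_symmetric[OF M]]] by blast
  obtain d where d: "d > 0" "\<And>x. d * (norm x)\<^sup>2 \<le> op_form (face_map Q) x"
    using coercive_face_map[OF Q] unfolding coercive_def by blast
  let ?k = "\<lambda>p v e. op_form (face_map Q) (ell2_nth (fst p) 0, ell2_nth (snd p) 0, v, e)"
  have "op_form M (fst z, snd z) \<le> op_form N (fst z, snd z)"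
  proof (rule half_line_form_le[where C = C and pop = "map_prod ell2_pop ell2_pop" and k = ?k, OF _ _ _ d(1)])
    show "op_form M (f, e) \<le> C * ((norm f)\<^sup>2 + (norm e)\<^sup>2)" for f e
      using C[of "(f, e)"] by (simp add: norm_Pair_power2)
    show "0 \<le> op_form N z" for z by (rule coercive_nonneg[OF N])
    show "(\<lambda>n. (map_prod ell2_pop ell2_pop ^^ n) f) \<longlonglongrightarrow> 0"
      for f :: "('k, 'n) half_line \<times> ('k, 'n) half_line" by (rule pair_pop_tendsto_0)
    show "d * (norm v)\<^sup>2 \<le> ?k f v e" for f v e
    proof -
      have "d * (norm v)\<^sup>2 \<le> d * (norm (ell2_nth (fst f) 0, ell2_nth (snd f) 0, v, e))\<^sup>2"
        using d(1) by (simp add: norm_Pair_power2)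
      then show ?thesis using d(2) by (rule order_trans)
    qed
    show "op_form M (f, e) \<le> op_form M (map_prod ell2_pop ell2_pop f, v) + ?k f v e" for f e v
      using eqM[rule_format, of "ell2_pop (fst f)" "ell2_nth (fst f) 0" "ell2_pop (snd f)" "ell2_nth (snd f) 0" e]
      by (simp add: is_min_def map_prod_def case_prod_unfold)
    show "\<exists>v. op_form N (map_prod ell2_pop ell2_pop f, v) + ?k f v e \<le> op_form N (f, e)" for f e
      using eqN[rule_format, of "ell2_pop (fst f)" "ell2_nth (fst f) 0" "ell2_pop (snd f)" "ell2_nth (snd f) 0" e]
      by (auto simp: is_min_def map_prod_def case_prod_unfold)
  qed
  then show ?thesis by simp
qed

end

lemma nonzero_strip:
  "(((0, 0), axis undefined 1) :: ('k::real_or_complex, 'n::finite) strip_space) \<noteq> 0"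
  by (simp add: zero_prod_def)

text \<open>With \<open>t\<close> the multiplication by a scalar this gives the homogeneity demanded
  by \<open>strip_ops\<close>; with \<open>t\<close> the complexification it enters the comparison
  of the real and the complex corner.\<close>

lemma strip_op_intertwine:
  fixes Q :: "('k::real_or_complex, 'n::finite) blocks" and R :: "('l::real_or_complex, 'm::finite) blocks"
  assumes Q: "face_operator Q" and R: "face_operator R" and t: "bounded_linear t"
    and QR: "\<And>s n w e. face_map R (t s, t n, t w, t e) =
      map_prod t (map_prod t (map_prod t t)) (face_map Q (s, n, w, e))"
  shows "strip_op R ((ell2_map t f, ell2_map t g), t e) =
    map_prod (map_prod (ell2_map t) (ell2_map t)) t (strip_op Q ((f, g), e))"
proof -
  have tt: "bounded_linear (map_prod t t)"
    unfolding map_prod_def case_prod_unfold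
    by (intro bounded_linear_Pair bounded_linear_compose[OF t] bounded_linear_fst bounded_linear_snd)
  have "half_line_op (strip_step R) (ell2_map (map_prod t t) (ell2_zip f g), t e)
      = map_prod (ell2_map (map_prod t t)) t (half_line_op (strip_step Q) (ell2_zip f g, e))"
  proof (rule half_line_op_intertwine[OF coercive_strip_step[OF Q] coercive_strip_step[OF R] tt t])
    fix z :: "(('k ^ 'n) \<times> ('k ^ 'n)) \<times> ('k ^ 'n) \<times> ('k ^ 'n)"
    obtain s n w e where z: "z = ((s, n), w, e)" by (metis surj_pair)
    show "strip_step R (map_prod (map_prod t t) (map_prod t t) z)
        = map_prod (map_prod t t) (map_prod t t) (strip_step Q z)"
      unfolding z by (cases "face_map Q (s, n, w, e)") (simp add: strip_step_apply QR)
  qed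
  moreover have "ell2_map (map_prod t t) (ell2_zip f g) = ell2_zip (ell2_map t f) (ell2_map t g)"
    by (rule ell2_eqI) (simp add: ell2_nth_map t tt)
  moreover have "ell2_map fst (ell2_map (map_prod t t) F) = ell2_map t (ell2_map fst F)"
    "ell2_map snd (ell2_map (map_prod t t) F) = ell2_map t (ell2_map snd F)" for F :: "(nat, _) ell2"
    by (rule ell2_eqI, simp add: ell2_nth_map t tt)+
  ultimately show ?thesis
    by (cases "half_line_op (strip_step Q) (ell2_zip f g, e)") (simp add: strip_op_apply)
qed

lemma face_map_scale:
  "face_map Q (c *s s, c *s n, c *s w, c *s e) =
     map_prod ((*s) c) (map_prod ((*s) c) (map_prod ((*s) c) ((*s) c))) (face_map Q (s, n, w, e))"
  by (simp add: face_map_def Let_def vector_scalar_commute vec.scale_right_distrib)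

lemma is_west_fixed_point_iff:
  fixes Q :: "('k::real_or_complex, 'n::finite) blocks"
  assumes Q: "face_operator Q"
  shows "is_west_fixed_point Q M \<longleftrightarrow> M = strip_op Q"
proof -
  note c = coercive_strip_op[OF Q]
  have scale: "strip_op Q (pair_scale (pair_scale ell2_scale ell2_scale) (*s) a x)
      = pair_scale (pair_scale ell2_scale ell2_scale) (*s) a (strip_op Q x)" for a x
  proof -
    obtain f g e where x: "x = ((f, g), e)" by (metis surj_pair)
    show ?thesis
      using strip_op_intertwine[OF Q Q bounded_linear_vector_scalar_mult face_map_scale]
      by (simp add: x pair_scale_def ell2_scale_eq_map)
  qed
  have "strip_op Q \<in> strip_ops"
    unfolding strip_ops_def coercive_ops_iff[OF nonzero_strip] using c scale by blast
  moreover have "M = strip_op Q" if "coercive M"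
    "\<forall>f g a b e. is_min (op_form M ((ell2_push f a, ell2_push g b), e))
       (\<lambda>y. op_form M ((f, g), y) + op_form (face_map Q) (a, b, y, e))"
    using that strip_form_le[OF Q _ _ that(2), of "strip_op Q"] strip_form_le[OF Q _ _ _ that(2), of "strip_op Q"]
      strip_op_min[OF Q] c
    by (intro symmetric_op_eqI coercive_symmetric) (auto intro!: order_antisym)
  moreover have co: "M \<in> strip_ops \<Longrightarrow> coercive M"
    unfolding strip_ops_def coercive_ops_iff[OF nonzero_strip] by blast
  ultimately have "is_west_fixed_point Q M \<Longrightarrow> M = strip_op Q"
    unfolding is_west_fixed_point_def using strip_equation_iff[OF Q coercive_symmetric[OF co] co] by blast
  moreover have "is_west_fixed_point Q (strip_op Q)"
    unfolding is_west_fixed_point_def using strip_equation_iff[OF Q coercive_symmetric[OF c] c]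
      strip_op_min[OF Q] \<open>strip_op Q \<in> strip_ops\<close> by blast
  ultimately show ?thesis by blast
qed

subsection \<open>Corners\<close>

context
  fixes S :: "('k::real_or_complex, 'n::finite) strip_space \<Rightarrow> ('k, 'n) strip_space"
  assumes S: "coercive S"
begin

lemma coercive_corner_step: "coercive (corner_step S)"
  unfolding corner_step_def by (intro coercive_transport unitary_rearrange S)

lemma coercive_corner_op: "coercive (half_line_op (corner_step S))"
  by (rule half_line_op_coercive[OF coercive_corner_step])

lemma corner_op_min:
  "is_min (op_form (half_line_op (corner_step S)) (ell2_push f a, g))
     (\<lambda>v. op_form (half_line_op (corner_step S)) (f, v) + op_form S ((v, g), a))"
  using half_line_op_min[OF coercive_corner_step, of f a g] by (simp only: op_form_rearrange)

lemma corner_equation_iff: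
  assumes "symmetric_op M" "coercive C"
  shows "transport (\<lambda>(f, (g, a)). (ell2_push f a, g))
      (glue C (transport (\<lambda>((w, e), n). ((e, n), w)) S)) = M \<longleftrightarrow>
    (\<forall>f a g. is_min (op_form M (ell2_push f a, g)) (\<lambda>v. op_form C (f, v) + op_form S ((v, g), a)))"
  by (subst transport_glue_eq_iff[OF assms(2) _ assms(1) unitary_push_fst])
    (auto simp: coercive_transport unitary_rearrange S op_form_rearrange)

lemma corner_equation_iff':
  assumes "symmetric_op M" "coercive C"
  shows "transport (\<lambda>(g, (f, a)). (f, ell2_push g a))
      (glue (transport prod.swap C) (transport (\<lambda>((s, n), e). ((n, e), s)) S)) = M \<longleftrightarrow>
    (\<forall>f a g. is_min (op_form M (f, ell2_push g a)) (\<lambda>h. op_form C (h, g) + op_form S ((h, f), a)))"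
  by (subst transport_glue_eq_iff[OF _ _ assms(1) unitary_push_snd])
    (auto simp: coercive_transport unitary_rearrange S op_form_rearrange assms(2))

lemma corner_form_le:
  assumes M: "coercive M" and N: "coercive N"
    and eqM: "\<And>f a g. is_min (op_form M (ell2_push f a, g)) (\<lambda>v. op_form M (f, v) + op_form S ((v, g), a))"
    and eqN: "\<And>f a g. is_min (op_form N (ell2_push f a, g)) (\<lambda>v. op_form N (f, v) + op_form S ((v, g), a))"
  shows "op_form M z \<le> op_form N z"
proof -
  obtain C where C: "\<And>x. \<bar>op_form M x\<bar> \<le> C * (norm x)\<^sup>2"
    using bounded_op_form_le[OF symmetric_opD(1)[OF coercive_symmetric[OF M]]] by blast
  obtain d where d: "d > 0" "\<And>x. d * (norm x)\<^sup>2 \<le> op_form S x"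
    using S unfolding coercive_def by blast
  let ?k = "\<lambda>f v g. op_form S ((v, g), ell2_nth f 0)"
  have "op_form M (fst z, snd z) \<le> op_form N (fst z, snd z)"
  proof (rule half_line_form_le[where C = C and pop = ell2_pop and k = ?k, OF _ _ ell2_pop_tendsto_0 d(1)])
    show "op_form M (f, e) \<le> C * ((norm f)\<^sup>2 + (norm e)\<^sup>2)" for f e
      using C[of "(f, e)"] by (simp add: norm_Pair_power2)
    show "0 \<le> op_form N z" for z by (rule coercive_nonneg[OF N])
    show "d * (norm v)\<^sup>2 \<le> ?k f v e" for f v e
    proof -
      have "d * (norm v)\<^sup>2 \<le> d * (norm ((v, e), ell2_nth f 0))\<^sup>2"
        using d(1) by (simp add: norm_Pair_power2)
      then show ?thesis using d(2) by (rule order_trans)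
    qed
    show "op_form M (f, e) \<le> op_form M (ell2_pop f, v) + ?k f v e" for f e v
      using eqM[of "ell2_pop f" "ell2_nth f 0" e] by (simp add: is_min_def)
    show "\<exists>v. op_form N (ell2_pop f, v) + ?k f v e \<le> op_form N (f, e)" for f e
      using eqN[of "ell2_pop f" "ell2_nth f 0" e] by (auto simp: is_min_def)
  qed
  then show ?thesis by simp
qed

text \<open>Gluing along the East side determines the corner by itself. The other equation is
  thereby reduced to showing that gluing along the North side yields a solution of this one.\<close>

lemma corner_form_unique:
  assumes "coercive M"
    and "\<And>f a g. is_min (op_form M (ell2_push f a, g)) (\<lambda>v. op_form M (f, v) + op_form S ((v, g), a))"
  shows "M = half_line_op (corner_step S)"
  using assms coercive_corner_op
  by (intro symmetric_op_eqI coercive_symmetric order_antisym corner_form_le corner_op_min)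

end

text \<open>
  Gluing on the East and gluing on the North commute: both composites minimize over the same four
  variables, with one more face in the corner.
\<close>

lemma commute_gluings:
  assumes E: "\<And>f a g. is_min (E (push f a) g) (\<lambda>v. E f v + s v g a)"
    and s: "\<And>f g a b e. is_min (s (push f a) (push g b) e) (\<lambda>y. s f g y + q a b y e)"
    and E': "\<And>f a g. is_min (E' f (push g a)) (\<lambda>h. E h g + s h f a)"
    and q: "\<And>a b c d. q a b c d = (q c d a b :: real)"
    and push: "\<And>f. \<exists>g a. f = push g a"
  shows "is_min (E' (push f a) g) (\<lambda>v. E' f v + s v g a)"
proof -
  obtain g' b where g: "g = push g' b" using push by blast
  have "E' (push f a) g \<le> E' f v + s v g a" for v
  proof -
    obtain v' y where v: "v = push v' y" using push by blast
    obtain h where h: "E' f (push v' y) = E h v' + s h f y" using E' unfolding is_min_def by meson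
    obtain x where x: "s (push v' y) (push g' b) a = s v' g' x + q y b x a"
      using s unfolding is_min_def by meson
    have "E' (push f a) (push g' b) \<le> E (push h x) g' + s (push h x) (push f a) b"
      using E' unfolding is_min_def by meson
    moreover have "E (push h x) g' \<le> E h v' + s v' g' x" using E unfolding is_min_def by meson
    moreover have "s (push h x) (push f a) b \<le> s h f y + q x a y b" using s unfolding is_min_def by meson
    ultimately show ?thesis using h x q[of x a y b] by (simp add: g v)
  qed
  moreover have "\<exists>v. E' f v + s v g a \<le> E' (push f a) g"
  proof -
    obtain H where H: "E' (push f a) (push g' b) = E H g' + s H (push f a) b"
      using E' unfolding is_min_def by meson
    obtain h x where hx: "H = push h x" using push by blast
    obtain v where v: "E (push h x) g' = E h v + s v g' x" using E unfolding is_min_def by meson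
    obtain y where y: "s (push h x) (push f a) b = s h f y + q x a y b" using s unfolding is_min_def by meson
    have "E' f (push v y) \<le> E h v + s h f y" using E' unfolding is_min_def by meson
    moreover have "s (push v y) (push g' b) a \<le> s v g' x + q y b x a" using s unfolding is_min_def by meson
    ultimately have "E' f (push v y) + s (push v y) g a \<le> E' (push f a) g"
      using H v y q[of x a y b] by (simp add: g hx)
    then show ?thesis by blast
  qed
  ultimately show ?thesis unfolding is_min_def by (metis order_antisym)
qed

lemma corner_op_intertwine:
  fixes Q :: "('k::real_or_complex, 'n::finite) blocks" and R :: "('l::real_or_complex, 'm::finite) blocks"
  assumes Q: "face_operator Q" and R: "face_operator R" and t: "bounded_linear t"
    and QR: "\<And>s n w e. face_map R (t s, t n, t w, t e) =
      map_prod t (map_prod t (map_prod t t)) (face_map Q (s, n, w, e))"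
  shows "half_line_op (corner_step (strip_op R)) (ell2_map t f, ell2_map t g) =
    map_prod (ell2_map t) (ell2_map t) (half_line_op (corner_step (strip_op Q)) (f, g))"
proof (rule half_line_op_intertwine)
  show "coercive (corner_step (strip_op Q))" "coercive (corner_step (strip_op R))"
    by (intro coercive_corner_step coercive_strip_op Q R)+
  show "corner_step (strip_op R) (map_prod t (map_prod (ell2_map t) (ell2_map t)) z)
      = map_prod t (map_prod (ell2_map t) (ell2_map t)) (corner_step (strip_op Q) z)" for z
  proof -
    obtain n w e where z: "z = (n, w, e)" by (metis surj_pair)
    obtain w' e' n' where S: "strip_op Q ((w, e), n) = ((w', e'), n')" by (metis surj_pair)
    show ?thesis
      using strip_op_intertwine[OF Q R t QR, of w e n] by (simp add: z S corner_step_apply)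
  qed
qed (intro t bounded_linear_ell2_map)+

lemma is_corner_fixed_point_iff:
  fixes Q :: "('k::real_or_complex, 'n::finite) blocks"
  assumes Q: "face_operator Q" and W: "west_fixed_point Q = strip_op Q" "south_fixed_point Q = strip_op Q"
    and sym: "\<And>a b c d. op_form (face_map Q) (a, b, c, d) = op_form (face_map Q) (c, d, a, b)"
  shows "is_corner_fixed_point Q C \<longleftrightarrow> C = half_line_op (corner_step (strip_op Q))"
proof -
  let ?S = "strip_op Q" and ?C = "half_line_op (corner_step (strip_op Q))"
  note S = coercive_strip_op[OF Q]
  note C = coercive_corner_op[OF S]
  have nz: "((ell2_push 0 (axis undefined 1), 0) :: ('k, 'n) corner_space) \<noteq> 0"
  proof
    assume "((ell2_push 0 (axis undefined 1), 0) :: ('k, 'n) corner_space) = 0"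
    then have "ell2_nth (ell2_push 0 (axis undefined 1 :: 'k ^ 'n)) 0 = 0"
      by (simp add: zero_prod_def del: ell2_nth_half_line)
    then show False by simp
  qed
  have scale: "?C (pair_scale ell2_scale ell2_scale a x) = pair_scale ell2_scale ell2_scale a (?C x)" for a x
  proof -
    obtain f g where x: "x = (f, g)" by (metis surj_pair)
    show ?thesis
      using corner_op_intertwine[OF Q Q bounded_linear_vector_scalar_mult face_map_scale]
      by (simp add: x pair_scale_def ell2_scale_eq_map)
  qed
  have mem: "?C \<in> corner_ops"
    unfolding corner_ops_def coercive_ops_iff[OF nz] using C scale by blast
  let ?g = "glue (transport prod.swap ?C) (transport (\<lambda>((s, n), e). ((n, e), s)) ?S)"
  define C1 where "C1 = transport (\<lambda>(g, (f, a)). (f, ell2_push g a)) ?g"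
  have C1: "coercive C1"
    unfolding C1_def
    by (intro coercive_transport unitary_push_snd glue_coercive unitary_rearrange C S)
  have C1_min: "is_min (op_form C1 (f, ell2_push g a)) (\<lambda>h. op_form ?C (h, g) + op_form ?S ((h, f), a))"
    for f g a
    using corner_equation_iff'[OF S coercive_symmetric[OF C1] C] C1_def by blast
  have "C1 = ?C"
  proof (rule corner_form_unique[OF S C1])
    fix f a g
    show "is_min (op_form C1 (ell2_push f a, g)) (\<lambda>v. op_form C1 (f, v) + op_form ?S ((v, g), a))"
    proof (rule commute_gluings[where E = "\<lambda>f g. op_form ?C (f, g)" and E' = "\<lambda>f g. op_form C1 (f, g)"
          and s = "\<lambda>f g e. op_form ?S ((f, g), e)" and push = ell2_push
          and q = "\<lambda>a b c d. op_form (face_map Q) (a, b, c, d)"])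
      show "\<exists>g a. f = ell2_push g a" for f :: "('k, 'n) half_line" by (metis ell2_push_pop)
    qed (intro corner_op_min S strip_op_min Q C1_min sym)+
  qed
  then have "transport (\<lambda>(g, (f, a)). (f, ell2_push g a)) ?g = ?C" unfolding C1_def .
  moreover have "transport (\<lambda>(f, (g, a)). (ell2_push f a, g))
      (glue ?C (transport (\<lambda>((w, e), n). ((e, n), w)) ?S)) = ?C"
    by (rule corner_equation_iff[OF S coercive_symmetric[OF C] C, THEN iffD2])
      (intro allI corner_op_min[OF S])
  ultimately have "is_corner_fixed_point Q ?C"
    unfolding is_corner_fixed_point_def W using mem by (intro conjI)
  moreover have co: "C \<in> corner_ops \<Longrightarrow> coercive C"
    unfolding corner_ops_def coercive_ops_iff[OF nz] by blast
  have "is_corner_fixed_point Q C \<Longrightarrow> C = ?C"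
    unfolding is_corner_fixed_point_def W
    using corner_equation_iff[OF S coercive_symmetric[OF co] co] corner_form_unique[OF S co] by blast
  ultimately show ?thesis by blast
qed

section \<open>The Riccati equation and transfer matrices\<close>

text \<open>The comparison on half-lines with a dummy real input that is reset to 0 after every
  step. It serves chains in which only the end state is prescribed.\<close>

lemma no_input_form_le:
  fixes E E' :: "'v::real_normed_vector \<Rightarrow> real"
  assumes bound: "\<And>e. E e \<le> C * (norm e)\<^sup>2" and nonneg: "\<And>e. 0 \<le> E' e"
    and d: "d > 0" and k: "\<And>v e. d * (norm v)\<^sup>2 \<le> k v e"
    and E: "\<And>e. is_min (E e) (\<lambda>v. E v + k v e)" and E': "\<And>e. is_min (E' e) (\<lambda>v. E' v + k v e)"
  shows "E e \<le> E' e"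
proof -
  \<comment> \<open>A negative \<open>C\<close> is replaced by 0, since the bound has to survive the
    added square of the dummy input.\<close>
  have C0: "E e \<le> max C 0 * ((norm (f :: real))\<^sup>2 + (norm e)\<^sup>2)" for f e
  proof -
    have "E e \<le> C * (norm e)\<^sup>2" by (rule bound)
    also have "\<dots> \<le> max C 0 * ((norm f)\<^sup>2 + (norm e)\<^sup>2)"
      by (intro mult_mono) auto
    finally show ?thesis .
  qed
  \<comment> \<open>Only the zeroth iterate can differ from 0.\<close>
  have lim: "(\<lambda>n. ((\<lambda>_ :: real. 0 :: real) ^^ n) f) \<longlonglongrightarrow> 0" for f
    by (rule LIMSEQ_offset[of _ 1]) simp
  show ?thesis
    using half_line_form_le[where E = "\<lambda>(f :: real, e). E e" and E' = "\<lambda>(f :: real, e). E' e"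
        and C = "max C 0" and pop = "\<lambda>_. 0" and k = "\<lambda>_. k" and f = 0 and e = e, OF _ _ lim d k]
      C0 nonneg E E'
    unfolding is_min_def by (auto simp: case_prod_unfold) metis
qed

text \<open>
  By completing the square, the minimum over the next state is attained at \<open>W e\<close>.
\<close>

lemma riccati_is_min:
  assumes G: "symmetric_op G" and T: "symmetric_op T" and A: "symmetric_op A"
    and G0: "\<And>x. 0 \<le> op_form G x" and T0: "\<And>x. 0 \<le> op_form T x"
    and GW: "\<And>e. G e = T e + A (W e)" and W: "\<And>e. G (W e) + T (W e) = - A e"
  shows "is_min (op_form G e) (\<lambda>v. op_form G v + (op_form T v + op_form T e + 2 * (A e \<bullet> v)))"
proof -
  let ?F = "\<lambda>v. op_form G v + (op_form T v + op_form T e + 2 * (A e \<bullet> v))"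
  have Ge: "op_form G e = op_form T e + A e \<bullet> W e"
    using symmetric_opD(2)[OF A, of e "W e"] GW[of e] by (simp add: op_form_def inner_add_right)
  have GWe: "op_form G (W e) + op_form T (W e) = - (A e \<bullet> W e)"
    using arg_cong[OF W[of e], of "\<lambda>x. W e \<bullet> x"] by (simp add: op_form_def inner_add_right inner_commute)
  have Wd: "G (W e) \<bullet> x + T (W e) \<bullet> x = - (A e \<bullet> x)" for x
    using arg_cong[OF W[of e], of "\<lambda>y. y \<bullet> x"] by (simp add: inner_add_left)
  have "?F (W e + x) = op_form G e + (op_form G x + op_form T x)" for x
    using Wd[of x] GWe Ge by (simp add: op_form_add[OF G] op_form_add[OF T] inner_add_right)
  from this[of "v - W e" for v] this[of 0] show ?thesis
    using G0 T0 unfolding is_min_def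
    by (auto simp: op_form_def intro: exI[of _ "W e"] add_nonneg_nonneg)
qed

text \<open>The one-dimensional operator on two sides whose symbol is
  \<open>2 T + (z + 1/z) A\<close>.\<close>

definition line_op :: "('v \<Rightarrow> 'v) \<Rightarrow> ('v \<Rightarrow> 'v) \<Rightarrow> 'v \<times> 'v \<Rightarrow> 'v \<times> 'v::real_inner" where
  "line_op T A = (\<lambda>(v, e). (T v + A e, A v + T e))"

lemma symmetric_op_line_op:
  assumes T: "symmetric_op T" and A: "symmetric_op A"
  shows "symmetric_op (line_op T A)"
proof -
  have "bounded_linear (line_op T A)"
    unfolding line_op_def case_prod_unfold
    by (intro bounded_linear_Pair bounded_linear_add bounded_linear_fst bounded_linear_snd
        bounded_linear_compose[OF symmetric_opD(1)[OF T]] bounded_linear_compose[OF symmetric_opD(1)[OF A]])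
  moreover have "line_op T A y \<bullet> z = y \<bullet> line_op T A z" for y z
    by (cases y, cases z)
      (simp add: line_op_def inner_prod_def inner_add_left inner_add_right symmetric_opD(2)[OF T] symmetric_opD(2)[OF A])
  ultimately show ?thesis by (simp add: symmetric_op_def)
qed

lemma op_form_line_op:
  "symmetric_op A \<Longrightarrow> op_form (line_op T A) (v, e) = op_form T v + op_form T e + 2 * (A e \<bullet> v)"
  using symmetric_opD(2)[of A e v]
  by (simp add: op_form_def line_op_def inner_prod_def inner_add_right inner_commute)

text \<open>The vectors \<open>(v, v)\<close> and \<open>(- v, v)\<close> give the bound for
  \<open>T + A\<close> and \<open>T - A\<close>, and the other values of \<open>r\<close> lie in
  between. This is positivity of the symbol on the unit circle, with \<open>r\<close> the
  cosine.\<close>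

lemma line_op_ge:
  assumes T: "symmetric_op T" and A: "symmetric_op A"
    and d: "\<And>z. d * (norm z)\<^sup>2 \<le> op_form (line_op T A) z"
    and r: "\<bar>r\<bar> \<le> 1"
  shows "d * (norm v)\<^sup>2 \<le> op_form T v + r * op_form A v"
proof -
  have "A v \<bullet> v = op_form A v" "op_form T (- v) = op_form T v"
    by (simp_all add: op_form_def inner_commute symmetric_opD(6)[OF T])
  then have "d * (norm v)\<^sup>2 \<le> op_form T v + op_form A v" "d * (norm v)\<^sup>2 \<le> op_form T v - op_form A v"
    using d[of "(v, v)"] d[of "(- v, v)"] by (simp_all add: op_form_line_op[OF A] norm_Pair_power2)
  moreover have "- \<bar>op_form A v\<bar> \<le> r * op_form A v"
  proof -
    have "\<bar>r * op_form A v\<bar> \<le> 1 * \<bar>op_form A v\<bar>"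
      unfolding abs_mult using r by (intro mult_right_mono) auto
    then show ?thesis by linarith
  qed
  ultimately show ?thesis by linarith
qed

lemma symmetric_op_matrix_iff:
  "symmetric_op ((*v) M) \<longleftrightarrow> self_adjoint_matrix (M :: 'k::real_or_complex ^ 'n ^ 'n::finite)"
  by (simp add: symmetric_op_def self_adjoint_matrix_def bounded_linear_matrix_vector_mult)

text \<open>\<open>G\<close> is the operator of the infinite half-line seen from its end,
  \<open>W\<close> the transfer from the end state to the optimal next state. Nonnegativity of
  \<open>G\<close> selects, among the solutions of the two algebraic equations, the one that belongs
  to this minimization.\<close>

definition riccati ::
    "complex ^ 'n ^ 'n \<Rightarrow> complex ^ 'n ^ 'n \<Rightarrow> complex ^ 'n ^ 'n \<Rightarrow> complex ^ 'n ^ 'n::finite \<Rightarrow> bool" where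
  "riccati T A G W \<longleftrightarrow> self_adjoint_matrix G \<and> (\<forall>x. 0 \<le> op_form ((*v) G) x) \<and>
     G = T + A ** W \<and> (G + T) ** W = - A"

lemma matrix_eqI: "(\<And>x. M *v x = N *v x) \<Longrightarrow> M = (N :: 'a::comm_ring_1 ^ 'n ^ 'n::finite)"
  by (metis matrix_eq)

lemma uminus_matrix_vector_mult: "(- A) *v x = - (A *v (x :: 'a::ring_1 ^ 'n::finite))"
  by (simp add: matrix_vector_mult_def vec_eq_iff sum_negf)

context
  fixes T A :: "complex ^ 'n ^ 'n::finite"
  assumes T: "self_adjoint_matrix T" and A: "self_adjoint_matrix A"
    and TA: "coercive (line_op ((*v) T) ((*v) A))"
begin

lemma line_op_matrix_ge:
  obtains d where "d > 0" "\<And>r v. \<bar>r\<bar> \<le> 1 \<Longrightarrow> d * (norm v)\<^sup>2 \<le> op_form ((*v) T) v + r * op_form ((*v) A) v"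
proof -
  obtain d where "d > 0" "\<And>z. d * (norm z)\<^sup>2 \<le> op_form (line_op ((*v) T) ((*v) A)) z"
    using TA unfolding coercive_def by blast
  with line_op_ge[OF T[folded symmetric_op_matrix_iff] A[folded symmetric_op_matrix_iff]] that
  show thesis by blast
qed

lemma riccati_apply:
  assumes "riccati T A G W"
  shows "G *v e = T *v e + A *v (W *v e)" "G *v (W *v e) + T *v (W *v e) = - (A *v e)"
proof -
  have "G = T + A ** W" "(G + T) ** W = - A" using assms unfolding riccati_def by blast+
  then have "G *v e = (T + A ** W) *v e" "((G + T) ** W) *v e = (- A) *v e" by metis+
  then show "G *v e = T *v e + A *v (W *v e)" "G *v (W *v e) + T *v (W *v e) = - (A *v e)"
    by (simp_all only: matrix_vector_mult_add_rdistrib matrix_vector_mul_assoc[symmetric]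
        uminus_matrix_vector_mult)
qed

text \<open>Both \<open>G\<close> and \<open>G'\<close> satisfy the same minimum equation for chains
  without inputs, hence coincide; then \<open>G + T\<close> is injective and the second equation
  determines \<open>W\<close>.\<close>

lemma riccati_unique:
  assumes GW: "riccati T A G W" and GW': "riccati T A G' W'"
  shows "G = G'" "W = W'"
proof -
  obtain d where d: "d > 0" "\<And>r v. \<bar>r\<bar> \<le> 1 \<Longrightarrow> d * (norm v)\<^sup>2 \<le> op_form ((*v) T) v + r * op_form ((*v) A) v"
    using line_op_matrix_ge by blast
  obtain c where c: "c > 0" "\<And>z. c * (norm z)\<^sup>2 \<le> op_form (line_op ((*v) T) ((*v) A)) z"
    using TA unfolding coercive_def by blast
  note sT = T[folded symmetric_op_matrix_iff] and sA = A[folded symmetric_op_matrix_iff]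
  have T0: "d * (norm x)\<^sup>2 \<le> op_form ((*v) T) x" for x using d(2)[of 0 x] by simp
  then have T0': "0 \<le> op_form ((*v) T) x" for x
    using d(1) by (meson mult_nonneg_nonneg less_imp_le order_trans zero_le_power2)
  let ?k = "\<lambda>v e. op_form ((*v) T) v + op_form ((*v) T) e + 2 * ((A *v e) \<bullet> v)"
  have k: "c * (norm v)\<^sup>2 \<le> ?k v e" for v e
  proof -
    have "c * (norm v)\<^sup>2 \<le> c * (norm (v, e))\<^sup>2" using c(1) by (simp add: norm_Pair_power2)
    also have "\<dots> \<le> ?k v e" using c(2)[of "(v, e)"] by (simp add: op_form_line_op[OF sA])
    finally show ?thesis .
  qed
  have min: "is_min (op_form ((*v) G) e) (\<lambda>v. op_form ((*v) G) v + ?k v e)" if "riccati T A G W" for G W e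
  proof (rule riccati_is_min[where W = "(*v) W", OF _ sT sA _ T0'])
    show "symmetric_op ((*v) G)" "\<And>x. 0 \<le> op_form ((*v) G) x"
      using that unfolding riccati_def symmetric_op_matrix_iff by blast+
  qed (rule riccati_apply[OF that])+
  have le: "op_form ((*v) G) e \<le> op_form ((*v) G') e" if G: "riccati T A G W" and G': "riccati T A G' W'" for G W G' W' e
  proof -
    obtain C where C: "\<And>x. \<bar>op_form ((*v) G) x\<bar> \<le> C * (norm x)\<^sup>2"
      using bounded_op_form_le[OF bounded_linear_matrix_vector_mult] by blast
    show ?thesis
      by (rule no_input_form_le[OF _ _ c(1) k min[OF G] min[OF G'], of C])
        (use C G' in \<open>auto simp: riccati_def intro: order_trans[OF abs_ge_self]\<close>)
  qed
  have "(*v) G = (*v) G'"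
    using GW GW' le[OF GW GW'] le[OF GW' GW]
    by (intro symmetric_op_eqI order_antisym) (auto simp: symmetric_op_matrix_iff riccati_def)
  then show G: "G = G'" by (intro matrix_eqI) (rule fun_cong)
  show "W = W'"
  proof (rule matrix_eqI)
    fix e
    let ?x = "W *v e - W' *v e"
    have "G *v ?x + T *v ?x = 0"
      using riccati_apply(2)[OF GW, of e] riccati_apply(2)[OF GW', of e]
      by (simp add: G matrix_vector_mult_diff_distrib algebra_simps)
    then have "op_form ((*v) G) ?x + op_form ((*v) T) ?x = 0"
      by (simp add: op_form_def inner_add_right[symmetric])
    moreover have "0 \<le> op_form ((*v) G) ?x" using GW unfolding riccati_def by blast
    ultimately have "d * (norm ?x)\<^sup>2 \<le> 0" using T0[of ?x] by linarith
    then show "W *v e = W' *v e" using d(1) by (simp add: mult_le_0_iff)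
  qed
qed

end

text \<open>
  The spectral theorem for a pencil: a maximizer of the Rayleigh quotient on the orthogonal
  complement of the eigenvectors would be a further eigenvector.
\<close>

lemma span_pencil_eigenvectors:
  fixes T A :: "'v::euclidean_space \<Rightarrow> 'v"
  assumes T: "symmetric_op T" and A: "symmetric_op A" and pos: "\<And>x. x \<noteq> 0 \<Longrightarrow> 0 < op_form T x"
  shows "span {v. \<exists>l. A v = l *\<^sub>R T v} = UNIV"
proof (rule ccontr)
  let ?N = "span {v. \<exists>l. A v = l *\<^sub>R T v}"
  assume N: "?N \<noteq> UNIV"
  have inj: "inj T"
  proof (rule injI)
    fix x y assume "T x = T y"
    then have "op_form T (x - y) = 0" by (simp add: op_form_def symmetric_opD(5)[OF T])
    then show "x = y" using pos[of "x - y"] by fastforce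
  qed
  then have surj: "surj T" by (intro linear_inj_imp_surj symmetric_opD(3)[OF T])
  have "T ` ?N \<noteq> UNIV" using N inj_image_mem_iff[OF inj, of _ ?N] by blast
  moreover have "span (T ` ?N) = T ` ?N"
    using linear_span_image[OF symmetric_opD(3)[OF T], of ?N] by (simp only: span_span)
  \<comment> \<open>The set \<open>P\<close> below is the \<open>T\<close>-orthogonal complement of
    the eigenvectors; this \<open>p\<close> shows that it contains a nonzero vector.\<close>
  ultimately obtain p where p: "p \<noteq> 0" "\<forall>x\<in>span (T ` ?N). p \<bullet> x = 0"
    using span_not_UNIV_orthogonal[of "T ` ?N"] by metis
  then have p_perp: "p \<bullet> T y = 0" if "y \<in> ?N" for y
    using that by (simp add: span_base)
  define P where "P = {x. \<forall>y\<in>?N. x \<bullet> T y = 0}"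
  have P_scale: "x \<in> P \<Longrightarrow> c *\<^sub>R x \<in> P" and P_add: "x \<in> P \<Longrightarrow> y \<in> P \<Longrightarrow> x + y \<in> P" for x y c
    by (auto simp: P_def inner_add_left)
  let ?f = "\<lambda>x. op_form A x / op_form T x"
  have bl: "bounded_linear T" "bounded_linear A" using T A by (auto simp: symmetric_op_def)
  have "continuous_on (sphere 0 1 \<inter> P) ?f"
  proof -
    have "x \<bullet> T x \<noteq> 0" if "x \<in> sphere 0 1 \<inter> P" for x
    proof -
      have "x \<noteq> 0" using that by auto
      then show ?thesis using pos[of x] by (simp add: op_form_def)
    qed
    then have "\<forall>x\<in>sphere 0 1 \<inter> P. x \<bullet> T x \<noteq> 0" by blast
    then show ?thesis
      unfolding op_form_def
      by (intro continuous_intros bounded_linear.continuous_on[OF bl(1)] bounded_linear.continuous_on[OF bl(2)])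
  qed
  moreover have "compact (sphere 0 1 \<inter> P)"
  proof (rule compact_Int_closed)
    have "P = (\<Inter>y\<in>?N. {x. x \<bullet> T y = 0})" by (auto simp: P_def)
    also have "closed \<dots>" by (intro closed_INT ballI closed_Collect_eq continuous_intros)
    finally show "closed P" .
  qed simp
  moreover have "p /\<^sub>R norm p \<in> sphere 0 1 \<inter> P"
    using p(1) p_perp by (auto simp: P_def)
  ultimately obtain a where a: "a \<in> sphere 0 1 \<inter> P" "\<And>x. x \<in> sphere 0 1 \<inter> P \<Longrightarrow> ?f x \<le> ?f a"
    using continuous_attains_sup[of "sphere 0 1 \<inter> P" ?f] by blast
  \<comment> \<open>The largest value of the Rayleigh quotient on \<open>P\<close>: the form of
    \<open>B = l T - A\<close> is nonnegative on \<open>P\<close> and vanishes at the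
    maximizer.\<close>
  define l where "l = ?f a"
  define B where "B x = l *\<^sub>R T x - A x" for x
  have B: "symmetric_op B"
    unfolding symmetric_op_def B_def
    using symmetric_opD(2)[OF T] symmetric_opD(2)[OF A]
    by (auto intro!: bounded_linear_sub bounded_linear_scaleR_const bl
        bounded_linear_compose[OF bounded_linear_scaleR_right] simp: inner_diff_left inner_diff_right)
  have a0: "a \<noteq> 0" "a \<in> P" using a by auto
  have PSD: "0 \<le> op_form B x" if "x \<in> P" for x
  proof (cases "x = 0")
    case False
    have "?f (x /\<^sub>R norm x) \<le> l"
      unfolding l_def using False that by (intro a) (auto intro: P_scale)
    moreover have "?f (x /\<^sub>R norm x) = ?f x"
      using False by (simp add: op_form_def symmetric_opD(8)[OF A] symmetric_opD(8)[OF T])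
    ultimately show ?thesis using pos[OF False]
      by (simp add: B_def op_form_def pos_divide_le_eq inner_diff_right)
  qed (simp add: op_form_def)
  have Ba0: "op_form B a = 0"
    using pos[OF a0(1)] by (simp add: B_def l_def op_form_def inner_diff_right)
  have perp: "B a \<bullet> y = 0" if y: "y \<in> P" for y
  proof (rule ccontr)
    assume ne: "B a \<bullet> y \<noteq> 0"
    \<comment> \<open>A nonzero slope at \<open>a\<close> would make the form negative along
      \<open>y\<close>. The added 1 keeps \<open>m\<close> positive, and \<open>q / m < 1\<close>
      leaves a strictly negative value.\<close>
    define q m where "q = op_form B y" and "m = q + 1"
    define t where "t = - (B a \<bullet> y) / m"
    have q: "0 \<le> q" "0 < m" "q < m" using PSD[OF y] by (auto simp: q_def m_def)
    have "0 \<le> op_form B (a + t *\<^sub>R y)" by (intro PSD P_add P_scale a0 y)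
    also have "\<dots> = 2 * t * (B a \<bullet> y) + t\<^sup>2 * q"
      unfolding op_form_add[OF B] Ba0
      by (simp add: op_form_def symmetric_opD(8)[OF B] power2_eq_square q_def)
    also have "\<dots> = (B a \<bullet> y)\<^sup>2 / m * (q / m - 2)"
      using q(2) by (simp add: t_def power2_eq_square field_simps)
    also have "\<dots> < 0"
      using ne q by (intro mult_pos_neg divide_pos_pos) (auto simp: divide_less_eq)
    finally show False by simp
  qed
  \<comment> \<open>\<open>B a\<close> is moved back through \<open>T\<close>: its preimage is
    \<open>T\<close>-orthogonal to the eigenvectors, hence lies in \<open>P\<close>, and is
    therefore \<open>T\<close>-orthogonal to itself.\<close>
  obtain c where c: "T c = B a" using surj by (metis surjD)
  have "c \<bullet> T y = 0" if "y \<in> ?N" for y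
    using that
  proof (induction rule: span_induct_alt)
    case base
    show ?case by (simp add: symmetric_opD(7)[OF T])
  next
    case (step r x y)
    then obtain m where m: "A x = m *\<^sub>R T x" by blast
    have "x \<in> ?N" using m by (intro span_base) blast
    then have aT: "a \<bullet> T x = 0" using a0 by (simp add: P_def)
    have "c \<bullet> T x = B a \<bullet> x" using symmetric_opD(2)[OF T, of c x] c by simp
    also have "\<dots> = a \<bullet> B x" by (rule symmetric_opD(2)[OF B])
    also have "\<dots> = 0" using aT by (simp add: B_def m inner_diff_right)
    finally show ?case
      using step by (simp add: symmetric_opD(4)[OF T] symmetric_opD(8)[OF T] inner_add_right)
  qed
  then have "c \<in> P" by (simp add: P_def)
  then have "op_form T c = 0" using perp[of c] c by (simp add: op_form_def inner_commute)
  then have "c = 0" using pos[of c] by fastforce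
  then have "B a = 0" using c by (simp add: symmetric_opD(7)[OF T])
  then have "A a = l *\<^sub>R T a" by (simp add: B_def)
  then have "a \<in> ?N" by (intro span_base) blast
  then have "op_form T a = 0" using a0 by (simp add: P_def op_form_def)
  then show False using pos[OF a0(1)] by simp
qed

section \<open>Transfer matrices: the definition by eigenvectors and the Riccati solution\<close>

lemma cscale_matrix_vector: "(c *\<^sub>M X) *v v = c *s (X *v v)"
  by (simp add: cscale_matrix_def map_matrix_def matrix_vector_mult_def vec_eq_iff sum_distrib_left mult.assoc)

lemma inner_ii_left: "(\<i> *s x) \<bullet> y = - (x \<bullet> (\<i> *s (y :: complex ^ 'n::finite)))"
  by (simp add: inner_vec_def inner_complex_def sum_negf[symmetric])

lemma complex_scale_split: "c *s (x :: complex ^ 'n::finite) = Re c *\<^sub>R x + Im c *\<^sub>R (\<i> *s x)"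
  by (simp add: vec_eq_iff complex_eq_iff)

text \<open>The Hermitian product of \<open>x\<close> and \<open>A *v x\<close> is real, and
  \<open>\<bullet>\<close> is the real part of the Hermitian product.\<close>

lemma self_adjoint_inner_scale:
  assumes "self_adjoint_matrix (A :: complex ^ 'n ^ 'n::finite)"
  shows "x \<bullet> (c *s (A *v x)) = Re c * op_form ((*v) A) x"
proof -
  have "x \<bullet> (\<i> *s (A *v x)) = - ((A *v (\<i> *s x)) \<bullet> x)"
    using assms inner_ii_left[of x "A *v x"] by (simp add: self_adjoint_matrix_def)
  also have "A *v (\<i> *s x) = \<i> *s (A *v x)" by (simp add: vector_scalar_commute)
  finally have "x \<bullet> (\<i> *s (A *v x)) = 0" by (simp add: inner_commute)
  then show ?thesis by (simp add: complex_scale_split[of c] inner_add_right op_form_def)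
qed

text \<open>The roots of \<open>l z\<^sup>2 + 2 z + l\<close> are real with product 1; the one with
  numerator \<open>1 + s\<close> lies outside the unit disc.\<close>

lemma quadratic_root_outside:
  fixes l :: real
  assumes l: "\<bar>l\<bar> < 1" "l \<noteq> 0"
  obtains z :: real where "\<bar>z\<bar> > 1" "2 + (z + inverse z) * l = 0"
proof -
  define s where "s = sqrt (1 - l\<^sup>2)"
  define z where "z = - (1 + s) / l"
  have s: "s > 0" "s\<^sup>2 = 1 - l\<^sup>2" using l(1) by (auto simp: s_def abs_square_less_1 abs_square_le_1)
  have "\<bar>z\<bar> = (1 + s) / \<bar>l\<bar>" using s by (simp add: z_def)
  also have "\<dots> > 1" using l s by (simp add: less_divide_eq)
  finally have "\<bar>z\<bar> > 1" .
  moreover have "z * l = - (1 + s)" using l by (simp add: z_def)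
  moreover have "inverse z * l = - (1 - s)"
  proof -
    have "l * l = (1 - s) * (1 + s)" using s(2) by (simp add: power2_eq_square algebra_simps)
    then show ?thesis using s l by (simp add: z_def field_simps)
  qed
  ultimately show thesis using that[of z] by (simp add: distrib_right)
qed

text \<open>The Riccati matrix acts on the kernels as \<open>W_left\<close> prescribes, because
  \<open>G + T + w A\<close> is injective for \<open>\<bar>Re w\<bar> \<le> 1\<close>. No other
  matrix does, because the pencil eigenvectors span the space and each of them lies in the kernel of
  \<open>A\<close> or of the symbol at a real point outside the unit disc.\<close>

lemma W_left_riccati:
  fixes T A :: "complex ^ 'n ^ 'n::finite"
  assumes T: "self_adjoint_matrix T" and A: "self_adjoint_matrix A"
    and TA: "coercive (line_op ((*v) T) ((*v) A))" and GW: "riccati T A G W"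
    and K: "K l l = T" "K r r = T" "K l r = A" "K r l = A"
  shows "W_left K l r = W"
proof -
  obtain d where d: "d > 0" "\<And>r v. \<bar>r\<bar> \<le> 1 \<Longrightarrow> d * (norm v)\<^sup>2 \<le> op_form ((*v) T) v + r * op_form ((*v) A) v"
    using line_op_matrix_ge[OF T A TA] by blast
  have symbol: "line_symbol K l r z *v v = 2 *\<^sub>R (T *v v) + (z + inverse z) *s (A *v v)" for z v
    unfolding line_symbol_def K matrix_vector_mult_add_rdistrib cscale_matrix_vector scaleR_2
      vec.scale_left_distrib by (rule add.assoc)
  note GW_apply = riccati_apply[OF T A TA GW]
  have G0: "0 \<le> op_form ((*v) G) x" for x using GW unfolding riccati_def by blast
  have zero: "x = 0" if "G *v x + T *v x + w *s (A *v x) = 0" "\<bar>Re w\<bar> \<le> 1" for x w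
  proof -
    have "op_form ((*v) G) x + op_form ((*v) T) x + Re w * op_form ((*v) A) x = 0"
      using arg_cong[OF that(1), of "\<lambda>y. x \<bullet> y"] self_adjoint_inner_scale[OF A, of x w]
      by (simp add: inner_add_right op_form_def)
    then have "d * (norm x)\<^sup>2 \<le> 0" using d(2)[OF that(2), of x] G0[of x] by linarith
    then show ?thesis using d(1) by (simp add: mult_le_0_iff)
  qed
  let ?P = "\<lambda>W. (\<forall>z v. norm z > 1 \<and> line_symbol K l r z *v v = 0 \<longrightarrow> W *v v = inverse z *s v) \<and>
     (\<forall>v. K l r *v v = 0 \<longrightarrow> W *v v = 0)"
  have PW: "?P W"
  proof (intro conjI allI impI; (elim conjE)?)
    fix z v
    assume z: "norm z > 1" and v: "line_symbol K l r z *v v = 0"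
    define w where "w = inverse z"
    have z0: "z \<noteq> 0" using z by auto
    have w: "norm w \<le> 1" "w * z = 1" using z z0
      by (auto simp: w_def norm_inverse inverse_le_1_iff)
    have "w *s (2 *\<^sub>R (T *v v) + (z + w) *s (A *v v)) = 0" using v by (simp add: symbol w_def)
    then have eq: "2 *\<^sub>R (w *s (T *v v)) + A *v v + w *s (w *s (A *v v)) = 0"
      using w(2) by (simp add: vec_eq_iff algebra_simps scaleR_conv_of_real)
    \<comment> \<open>The residual of \<open>w *s v\<close> as a candidate for
      \<open>W *v v\<close>: by the two Riccati equations it is \<open>- w\<close> times the symbol
      at \<open>z\<close> applied to \<open>v\<close>, hence 0.\<close>
    have "G *v (W *v v - w *s v) + T *v (W *v v - w *s v) + w *s (A *v (W *v v - w *s v)) =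
        (G *v (W *v v) + T *v (W *v v)) - w *s (G *v v) - w *s (T *v v) + w *s (A *v (W *v v)) - w *s (w *s (A *v v))"
      by (simp add: matrix_vector_mult_diff_distrib vector_scalar_commute vec.scale_right_diff_distrib)
    also have "\<dots> = - (2 *\<^sub>R (w *s (T *v v)) + A *v v + w *s (w *s (A *v v)))"
      unfolding GW_apply(2) GW_apply(1)[of v] by (simp add: vec.scale_right_distrib scaleR_2)
    also have "\<dots> = 0" by (simp only: eq minus_zero)
    finally have "W *v v - w *s v = 0"
      by (rule zero) (use w(1) abs_Re_le_cmod[of w] in simp)
    then show "W *v v = inverse z *s v" by (simp add: w_def)
  next
    fix v assume "K l r *v v = 0"
    then show "W *v v = 0"
      using GW_apply(2)[of v] zero[of "W *v v" 0] by (simp add: K)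
  qed
  moreover have "W' = W" if W': "?P W'" for W'
  proof -
    have pos: "x \<noteq> 0 \<Longrightarrow> 0 < op_form ((*v) T) x" for x
    proof -
      assume "x \<noteq> 0"
      then have "0 < d * (norm x)\<^sup>2" using d(1) by simp
      then show ?thesis using d(2)[of 0 x] by simp
    qed
    have "W' *v v = W *v v" if v: "A *v v = l' *\<^sub>R (T *v v)" for v l'
    proof (cases "l' = 0 \<or> v = 0")
      case True
      then have "A *v v = 0" using v by auto
      then show ?thesis using W' PW by (simp add: K)
    next
      case False
      have "op_form ((*v) A) v = l' * op_form ((*v) T) v" by (simp add: op_form_def v)
      moreover have "0 < d * (norm v)\<^sup>2" using d(1) False by simp
      moreover have "d * (norm v)\<^sup>2 \<le> op_form ((*v) T) v + op_form ((*v) A) v"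
        "d * (norm v)\<^sup>2 \<le> op_form ((*v) T) v - op_form ((*v) A) v"
        using d(2)[of 1 v] d(2)[of "-1" v] by simp_all
      ultimately have "0 < (1 + l') * op_form ((*v) T) v" "0 < (1 - l') * op_form ((*v) T) v"
        unfolding distrib_right left_diff_distrib mult_1 by linarith+
      then have "\<bar>l'\<bar> < 1" using pos[of v] False by (auto simp: zero_less_mult_iff)
      then obtain z :: real where z: "\<bar>z\<bar> > 1" "2 + (z + inverse z) * l' = 0"
        using quadratic_root_outside False by blast
      have "line_symbol K l r (complex_of_real z) *v v = (2 + (z + inverse z) * l') *\<^sub>R (T *v v)"
        unfolding symbol v by (simp add: vec_eq_iff scaleR_conv_of_real[where 'a = complex] algebra_simps)
      then have "line_symbol K l r (complex_of_real z) *v v = 0" by (simp add: z)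
      moreover have "norm (complex_of_real z) > 1" using z by simp
      ultimately show ?thesis using W' PW by metis
    qed
    then have "\<And>x. x \<in> {v. \<exists>l'. A *v v = l' *\<^sub>R (T *v v)} \<Longrightarrow> W' *v x = W *v x" by blast
    \<comment> \<open>Real linear combinations suffice: the pencil has real eigenvalues, and both
      maps are in particular real-linear.\<close>
    then have "W' *v x = W *v x" for x
      using span_pencil_eigenvectors[OF T[folded symmetric_op_matrix_iff] A[folded symmetric_op_matrix_iff] pos]
      by (rule_tac linear_eq_on[of "(*v) W'" "(*v) W" x "{v. \<exists>l'. A *v v = l' *\<^sub>R (T *v v)}"])
        (auto intro: bounded_linear.linear bounded_linear_matrix_vector_mult)
    then show ?thesis by (rule matrix_eqI)
  qed
  ultimately show ?thesis unfolding W_left_def by (intro the_equality)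
qed

section \<open>Even Laurent operators\<close>

abbreviation circle_measure :: "real measure" where
  "circle_measure \<equiv> restrict_space lborel {0..2*pi}"

lemma has_fourier_series_iff:
  "has_fourier_series f F \<longleftrightarrow>
     (\<lambda>\<theta>. F (cis \<theta>)) \<in> borel_measurable borel \<and>
     integrable circle_measure (\<lambda>\<theta>. (norm (F (cis \<theta>)))\<^sup>2) \<and>
     (\<forall>k. ell2_nth f k = (1 / (2 * pi)) *\<^sub>R (LINT \<theta>|circle_measure. cis (- of_int k * \<theta>) *s F (cis \<theta>)))"
  by (simp add: has_fourier_series_def fourier_coeff_def set_integrable_def set_lebesgue_integral_def
      integrable_restrict_space integral_restrict_space)

lemma finite_circle_measure: "finite_measure circle_measure"
  by (rule finite_measureI) (simp add: space_restrict_space emeasure_restrict_space)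

lemma measurable_circle: "F \<in> borel_measurable borel \<Longrightarrow> F \<in> borel_measurable circle_measure"
  by (intro measurable_restrict_space1) simp

lemma measurable_norm_power2:
  fixes F :: "real \<Rightarrow> 'a::real_normed_vector"
  assumes "F \<in> borel_measurable borel"
  shows "(\<lambda>\<theta>. (norm (F \<theta>))\<^sup>2) \<in> borel_measurable circle_measure"
  by (intro measurable_circle borel_measurable_power measurable_compose[OF assms borel_measurable_norm])

lemma continuous_on_matrix_vector [continuous_intros]:
  fixes M :: "'a::topological_space \<Rightarrow> complex ^ 'n ^ 'm"
  shows "continuous_on S M \<Longrightarrow> continuous_on S v \<Longrightarrow> continuous_on S (\<lambda>x. M x *v v x)"
  unfolding matrix_vector_mult_def by (intro continuous_intros)

lemma continuous_on_vector_scalar [continuous_intros]: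
  fixes v :: "'a::topological_space \<Rightarrow> complex ^ 'n"
  shows "continuous_on S c \<Longrightarrow> continuous_on S v \<Longrightarrow> continuous_on S (\<lambda>x. c x *s v x)"
  unfolding vector_scalar_mult_def by (intro continuous_intros)

lemma borel_measurable_matrix_vector:
  fixes M :: "real \<Rightarrow> complex ^ 'n::finite ^ 'n"
  assumes "M \<in> borel_measurable borel" "v \<in> borel_measurable borel"
  shows "(\<lambda>x. M x *v v x) \<in> borel_measurable borel"
  by (rule borel_measurable_continuous_Pair[OF assms, of "(*v)"])
    (intro continuous_intros)

lemma borel_measurable_vector_scalar:
  fixes v :: "real \<Rightarrow> complex ^ 'n::finite"
  assumes "c \<in> borel_measurable borel" "v \<in> borel_measurable borel"
  shows "(\<lambda>x. c x *s v x) \<in> borel_measurable borel"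
  by (rule borel_measurable_continuous_Pair[OF assms, of "(*s)"])
    (intro continuous_intros)

lemma borel_measurable_cis: "(\<lambda>\<theta>. cis (r * \<theta>)) \<in> borel_measurable borel"
  by (intro borel_measurable_continuous_onI continuous_intros)

text \<open>On a finite measure space square-integrable functions are integrable, because
  \<open>norm y \<le> 1 + (norm y)\<^sup>2\<close>.\<close>

lemma integrable_fourier:
  assumes m: "(\<lambda>\<theta>. F (cis \<theta>) :: complex ^ 'n::finite) \<in> borel_measurable borel"
    and i: "integrable circle_measure (\<lambda>\<theta>. (norm (F (cis \<theta>)))\<^sup>2)"
  shows "integrable circle_measure (\<lambda>\<theta>. cis (r * \<theta>) *s F (cis \<theta>))"
proof (rule Bochner_Integration.integrable_bound)
  interpret finite_measure circle_measure by (rule finite_circle_measure)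
  show "integrable circle_measure (\<lambda>\<theta>. 1 + (norm (F (cis \<theta>)))\<^sup>2)"
    by (intro Bochner_Integration.integrable_add i) simp
  show "(\<lambda>\<theta>. cis (r * \<theta>) *s F (cis \<theta>)) \<in> borel_measurable circle_measure"
    by (intro measurable_circle borel_measurable_vector_scalar borel_measurable_cis m)
  have "norm y \<le> 1 + (norm y)\<^sup>2" for y :: "complex ^ 'n"
  proof -
    have "2 * norm y \<le> 1 + (norm y)\<^sup>2" using sum_squares_bound[of 1 "norm y"] by simp
    then show ?thesis using norm_ge_zero[of y] by linarith
  qed
  then show "AE \<theta> in circle_measure. norm (cis (r * \<theta>) *s F (cis \<theta>)) \<le> norm (1 + (norm (F (cis \<theta>)))\<^sup>2)"
    by (simp add: norm_vector_scalar_mult)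
qed

lemma integral_cis:
  "(LINT \<theta>|circle_measure. cis (of_int m * \<theta>)) = (if m = 0 then 2 * pi else 0)"
proof (cases "m = 0")
  case True
  then show ?thesis by (simp add: integral_restrict_space measure_restrict_space space_restrict_space
        scaleR_conv_of_real)
next
  case False
  have "(LINT \<theta>|lborel. indicator {0..2*pi} \<theta> *\<^sub>R cis (of_int m * \<theta>))
      = cis (of_int m * (2 * pi)) / (\<i> * of_int m) - cis (of_int m * 0) / (\<i> * of_int m)"
  proof (rule integral_FTC_Icc)
    define a where "a = \<i> * complex_of_int m"
    have a: "a \<noteq> 0" using False by (simp add: a_def)
    have "((\<lambda>z. exp (a * z) / a) has_field_derivative exp (a * w)) (at w)" for w
      using a by (auto intro!: derivative_eq_intros)
    from has_vector_derivative_real_field[OF this, of "\<theta>" "{0..2*pi}" for \<theta>]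
    show "((\<lambda>\<theta>. cis (of_int m * \<theta>) / (\<i> * of_int m)) has_vector_derivative cis (of_int m * \<theta>))
        (at \<theta> within {0..2*pi})" for \<theta>
      unfolding a_def by (simp only: cis_conv_exp of_real_mult of_real_of_int_eq mult.assoc)
    show "continuous_on {0..2*pi} (\<lambda>\<theta>. cis (of_int m * \<theta>))" by (intro continuous_intros)
  qed simp
  also have "cis (of_int m * (2 * pi)) = 1"
    using cis_multiple_2pi[of "of_int m"] by (simp add: mult_ac)
  finally show ?thesis using False by (simp add: integral_restrict_space)
qed

lemma bounded_linear_vector_scalar_left: "bounded_linear (\<lambda>c. c *s (v :: complex ^ 'n::finite))"
  by (rule bounded_linear_intro[of _ "norm v"])
    (simp_all add: norm_vector_scalar_mult, simp_all add: vec_eq_iff algebra_simps)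

definition trig_poly :: "int set \<Rightarrow> (int \<Rightarrow> complex ^ 'n) \<Rightarrow> complex \<Rightarrow> complex ^ 'n" where
  "trig_poly J c u = (\<Sum>k\<in>J. (u powi k) *s c k)"

lemma trig_poly_cis: "trig_poly J c (cis \<theta>) = (\<Sum>k\<in>J. cis (of_int k * \<theta>) *s c k)"
  by (simp add: trig_poly_def cis_power_int)

lemma inner_cis_scale: "x \<bullet> (cis r *s y) = (cis (- r) *s x) \<bullet> (y :: complex ^ 'n::finite)"
  by (simp add: complex_scale_split[of "cis r"] complex_scale_split[of "cis (- r)"]
      inner_add_left inner_add_right inner_diff_left inner_ii_left)

text \<open>Pairing with a trigonometric polynomial sees only finitely many Fourier coefficients.
  Both Bessel's inequality and the norm of a trigonometric polynomial follow from this
  formula.\<close>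

lemma integral_inner_trig_poly:
  assumes g: "has_fourier_series g (G :: complex \<Rightarrow> complex ^ 'n::finite)"
  shows "integrable circle_measure (\<lambda>\<theta>. G (cis \<theta>) \<bullet> trig_poly J c (cis \<theta>))"
    "(LINT \<theta>|circle_measure. G (cis \<theta>) \<bullet> trig_poly J c (cis \<theta>)) = 2 * pi * (\<Sum>k\<in>J. ell2_nth g k \<bullet> c k)"
proof -
  have int: "integrable circle_measure (\<lambda>\<theta>. cis (- of_int k * \<theta>) *s G (cis \<theta>))" for k
    using g by (intro integrable_fourier) (auto simp: has_fourier_series_iff)
  have eq: "G (cis \<theta>) \<bullet> trig_poly J c (cis \<theta>) = (\<Sum>k\<in>J. (cis (- of_int k * \<theta>) *s G (cis \<theta>)) \<bullet> c k)" for \<theta>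
    by (simp add: trig_poly_cis inner_sum_right inner_cis_scale)
  show "integrable circle_measure (\<lambda>\<theta>. G (cis \<theta>) \<bullet> trig_poly J c (cis \<theta>))"
    unfolding eq by (intro Bochner_Integration.integrable_sum integrable_inner_left int)
  have "(LINT \<theta>|circle_measure. (cis (- of_int k * \<theta>) *s G (cis \<theta>)) \<bullet> c k) = 2 * pi * (ell2_nth g k \<bullet> c k)" for k
  proof -
    have "(LINT \<theta>|circle_measure. cis (- of_int k * \<theta>) *s G (cis \<theta>)) = (2 * pi) *\<^sub>R ell2_nth g k"
      using g by (simp add: has_fourier_series_iff)
    then show ?thesis by (subst integral_inner_left[OF int]) (simp only: inner_scaleR_left)
  qed
  moreover have "(LINT \<theta>|circle_measure. (\<Sum>k\<in>J. (cis (- of_int k * \<theta>) *s G (cis \<theta>)) \<bullet> c k))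
      = (\<Sum>k\<in>J. LINT \<theta>|circle_measure. (cis (- of_int k * \<theta>) *s G (cis \<theta>)) \<bullet> c k)"
    by (intro Bochner_Integration.integral_sum integrable_inner_left int)
  ultimately show "(LINT \<theta>|circle_measure. G (cis \<theta>) \<bullet> trig_poly J c (cis \<theta>)) = 2 * pi * (\<Sum>k\<in>J. ell2_nth g k \<bullet> c k)"
    unfolding eq by (simp only: sum_distrib_left)
qed

lift_definition ell2_delta :: "'i \<Rightarrow> 'a::real_inner \<Rightarrow> ('i, 'a) ell2"
  is "\<lambda>k v i. if i = k then v else 0"
  by (rule summable_on_cong_neutral[THEN iffD1, OF _ _ _ summable_on_finite[of "{k}" for k]])
    (auto split: if_splits)

lemma ell2_nth_sum: "ell2_nth (\<Sum>k\<in>J. f k) i = (\<Sum>k\<in>J. ell2_nth (f k) i)"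
  by (induction J rule: infinite_finite_induct) simp_all

lemma ell2_nth_sum_delta:
  "finite J \<Longrightarrow> ell2_nth (\<Sum>k\<in>J. ell2_delta k (c k)) i = (if i \<in> J then c i else 0)"
  by (simp add: ell2_nth_sum ell2_delta.rep_eq)

lemma has_fourier_series_trig_poly:
  assumes J: "finite J"
  shows "has_fourier_series (\<Sum>k\<in>J. ell2_delta k (c k)) (trig_poly J (c :: int \<Rightarrow> complex ^ 'n::finite))"
  unfolding has_fourier_series_iff
proof (intro conjI allI)
  interpret finite_measure circle_measure by (rule finite_circle_measure)
  have cont: "continuous_on S (\<lambda>\<theta>. trig_poly J c (cis \<theta>))" for S
    unfolding trig_poly_cis
    by (rule continuous_on_sum, rule continuous_on_vector_scalar)
      (auto intro!: continuous_on_cis continuous_on_mult continuous_on_const continuous_on_id)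
  then show meas: "(\<lambda>\<theta>. trig_poly J c (cis \<theta>)) \<in> borel_measurable borel"
    by (rule borel_measurable_continuous_onI)
  have "norm (trig_poly J c (cis \<theta>)) \<le> (\<Sum>k\<in>J. norm (c k))" for \<theta>
    unfolding trig_poly_cis
    by (rule order_trans[OF norm_sum]) (simp add: norm_vector_scalar_mult)
  then have "(norm (trig_poly J c (cis \<theta>)))\<^sup>2 \<le> (\<Sum>k\<in>J. norm (c k))\<^sup>2" for \<theta>
    by (intro power_mono) auto
  then show "integrable circle_measure (\<lambda>\<theta>. (norm (trig_poly J c (cis \<theta>)))\<^sup>2)"
    by (intro integrable_const_bound[of _ "(\<Sum>k\<in>J. norm (c k))\<^sup>2"] AE_I2)
      (auto intro: measurable_norm_power2[OF meas])
  show "ell2_nth (\<Sum>k\<in>J. ell2_delta k (c k)) k = (1 / (2 * pi)) *\<^sub>R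
      (LINT \<theta>|circle_measure. cis (- of_int k * \<theta>) *s trig_poly J c (cis \<theta>))" for k
  proof -
    have "cis (- of_int k * \<theta>) *s trig_poly J c (cis \<theta>) = (\<Sum>j\<in>J. cis (of_int (j - k) * \<theta>) *s c j)" for \<theta>
      by (simp add: trig_poly_cis vec.scale_sum_right vector_smult_assoc cis_mult algebra_simps)
    moreover have i: "integrable circle_measure (\<lambda>\<theta>. cis (of_int m * \<theta>))" for m
      by (intro integrable_const_bound[of _ 1] AE_I2 measurable_circle borel_measurable_cis) simp
    ultimately have "(LINT \<theta>|circle_measure. cis (- of_int k * \<theta>) *s trig_poly J c (cis \<theta>))
        = (\<Sum>j\<in>J. LINT \<theta>|circle_measure. cis (of_int (j - k) * \<theta>) *s c j)"
      by (simp only:) (intro Bochner_Integration.integral_sum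
          integrable_bounded_linear[OF bounded_linear_vector_scalar_left i])
    also have "\<dots> = (\<Sum>j\<in>J. (LINT \<theta>|circle_measure. cis (of_int (j - k) * \<theta>)) *s c j)"
      by (intro sum.cong refl integral_bounded_linear[OF bounded_linear_vector_scalar_left i])
    also have "\<dots> = (\<Sum>j\<in>J. if j = k then (2 * pi) *\<^sub>R c j else 0)"
      by (intro sum.cong refl) (auto simp: integral_cis vec_eq_iff scaleR_conv_of_real[where 'a = complex] simp del: of_int_diff)
    finally show ?thesis using J by (simp add: ell2_nth_sum_delta)
  qed
qed

lemma integral_trig_poly:
  assumes "finite J"
  shows "(LINT \<theta>|circle_measure. (norm (trig_poly J (c :: int \<Rightarrow> complex ^ 'n::finite) (cis \<theta>)))\<^sup>2)
    = 2 * pi * (\<Sum>k\<in>J. (norm (c k))\<^sup>2)"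
  unfolding power2_norm_eq_inner integral_inner_trig_poly(2)[OF has_fourier_series_trig_poly[OF assms]]
  using assms by (simp add: ell2_nth_sum_delta)

text \<open>The squared distance of \<open>G\<close> from its partial Fourier sum is
  nonnegative.\<close>

lemma bessel_inequality:
  assumes g: "has_fourier_series g (G :: complex \<Rightarrow> complex ^ 'n::finite)" and J: "finite J"
  shows "2 * pi * (\<Sum>k\<in>J. (norm (ell2_nth g k))\<^sup>2) \<le> (LINT \<theta>|circle_measure. (norm (G (cis \<theta>)))\<^sup>2)"
proof -
  let ?S = "trig_poly J (ell2_nth g)"
  have S: "has_fourier_series (\<Sum>k\<in>J. ell2_delta k (ell2_nth g k)) ?S"
    by (rule has_fourier_series_trig_poly[OF J])
  have iG: "integrable circle_measure (\<lambda>\<theta>. (norm (G (cis \<theta>)))\<^sup>2)"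
    and iS: "integrable circle_measure (\<lambda>\<theta>. (norm (?S (cis \<theta>)))\<^sup>2)"
    using g S by (simp_all add: has_fourier_series_iff)
  note iGS = integral_inner_trig_poly(1)[OF g, of J "ell2_nth g"]
  have "0 \<le> (LINT \<theta>|circle_measure. (norm (G (cis \<theta>) - ?S (cis \<theta>)))\<^sup>2)"
    by (rule Bochner_Integration.integral_nonneg) simp
  also have "\<dots> = (LINT \<theta>|circle_measure. (norm (G (cis \<theta>)))\<^sup>2 - 2 * (G (cis \<theta>) \<bullet> ?S (cis \<theta>)) + (norm (?S (cis \<theta>)))\<^sup>2)"
    by (simp add: power2_norm_eq_inner inner_diff_left inner_diff_right inner_commute algebra_simps)
  also have "\<dots> = (LINT \<theta>|circle_measure. (norm (G (cis \<theta>)))\<^sup>2)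
      - 2 * (LINT \<theta>|circle_measure. G (cis \<theta>) \<bullet> ?S (cis \<theta>)) + (LINT \<theta>|circle_measure. (norm (?S (cis \<theta>)))\<^sup>2)"
    using iG iS iGS by simp
  also have "\<dots> = (LINT \<theta>|circle_measure. (norm (G (cis \<theta>)))\<^sup>2) - 2 * pi * (\<Sum>k\<in>J. (norm (ell2_nth g k))\<^sup>2)"
    by (simp only: integral_inner_trig_poly(2)[OF g] integral_trig_poly[OF J] power2_norm_eq_inner[symmetric])
  finally show ?thesis by simp
qed

section \<open>Multiplication operators on the Fourier side\<close>

lemma ell2_delta_dense:
  assumes "e > 0"
  obtains J where "finite J" "(norm (f - (\<Sum>k\<in>J. ell2_delta k (ell2_nth f k))))\<^sup>2 < e"
proof -
  obtain J where J: "finite J" "(norm f)\<^sup>2 - e < (\<Sum>k\<in>J. (norm (ell2_nth f k))\<^sup>2)"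
    using norm_ell2_le[of f "(norm f)\<^sup>2 - e"] assms by force
  let ?t = "\<Sum>k\<in>J. ell2_delta k (ell2_nth f k)"
  have sum: "(\<Sum>\<^sub>\<infinity>i. ell2_nth g i \<bullet> (if i \<in> J then ell2_nth f i else 0)) = (\<Sum>i\<in>J. ell2_nth g i \<bullet> ell2_nth f i)" for g
  proof -
    have "(\<Sum>\<^sub>\<infinity>i. ell2_nth g i \<bullet> (if i \<in> J then ell2_nth f i else 0)) = (\<Sum>\<^sub>\<infinity>i\<in>J. ell2_nth g i \<bullet> ell2_nth f i)"
      by (rule infsum_cong_neutral) auto
    then show ?thesis using J by simp
  qed
  have t: "g \<bullet> ?t = (\<Sum>k\<in>J. ell2_nth g k \<bullet> ell2_nth f k)" for g
    unfolding inner_ell2_def ell2_nth_sum_delta[OF J(1)] by (rule sum)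
  have tt: "?t \<bullet> ?t = (\<Sum>k\<in>J. (norm (ell2_nth f k))\<^sup>2)"
    unfolding t
  proof (rule sum.cong[OF refl])
    fix k assume "k \<in> J"
    then show "ell2_nth ?t k \<bullet> ell2_nth f k = (norm (ell2_nth f k))\<^sup>2"
      using ell2_nth_sum_delta[OF J(1), of "ell2_nth f" k] by (simp add: power2_norm_eq_inner)
  qed
  have "(norm (f - ?t))\<^sup>2 = (norm f)\<^sup>2 - 2 * (f \<bullet> ?t) + ?t \<bullet> ?t"
    by (simp add: power2_norm_eq_inner inner_diff_left inner_diff_right inner_commute)
  also have "\<dots> = (norm f)\<^sup>2 - (\<Sum>k\<in>J. (norm (ell2_nth f k))\<^sup>2)"
    unfolding tt t[of f] by (simp add: power2_norm_eq_inner)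
  finally show thesis using J that by (simp add: power2_norm_eq_inner)
qed

text \<open>The property by which \<open>laurent_op\<close> selects its value, named so that
  existence and uniqueness can be treated separately.\<close>

definition multiplier ::
    "(complex \<Rightarrow> complex ^ 'n ^ 'n) \<Rightarrow> ((int, complex ^ 'n) ell2 \<Rightarrow> (int, complex ^ 'n) ell2) \<Rightarrow> bool" where
  "multiplier a M \<longleftrightarrow> bounded_linear M \<and>
     (\<forall>f F. has_fourier_series f F \<longrightarrow> has_fourier_series (M f) (\<lambda>u. a u *v F u))"

text \<open>For finitely supported sequences the representing function can be taken to be a
  trigonometric polynomial, whose norm is known exactly, so that Bessel's inequality for the image
  suffices. Boundedness of \<open>M\<close> and density give the general case. Neither Parseval's
  identity nor a function for an arbitrary sequence is involved.\<close>

lemma multiplier_norm_le: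
  fixes a :: "complex \<Rightarrow> complex ^ 'n ^ 'n::finite"
  assumes M: "multiplier a M" and B: "\<And>\<theta> v. norm (a (cis \<theta>) *v v) \<le> B * norm v" and B0: "0 \<le> B"
  shows "norm (M f) \<le> B * norm f"
proof -
  have lin: "bounded_linear M" using M by (simp add: multiplier_def)
  have finite_case: "norm (M (\<Sum>k\<in>J. ell2_delta k (c k))) \<le> B * norm (\<Sum>k\<in>J. ell2_delta k (c k))"
    if J: "finite J" for J c
  proof (rule power2_le_imp_le)
    let ?f = "\<Sum>k\<in>J. ell2_delta k (c k)"
    let ?F = "trig_poly J c"
    have F: "has_fourier_series ?f ?F" by (rule has_fourier_series_trig_poly[OF J])
    then have MF: "has_fourier_series (M ?f) (\<lambda>u. a u *v ?F u)" using M by (simp add: multiplier_def)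
    have "(\<Sum>k\<in>K. (norm (ell2_nth (M ?f) k))\<^sup>2) \<le> (B * norm ?f)\<^sup>2" if K: "finite K" for K
    proof -
      have "2 * pi * (\<Sum>k\<in>K. (norm (ell2_nth (M ?f) k))\<^sup>2)
          \<le> (LINT \<theta>|circle_measure. (norm (a (cis \<theta>) *v ?F (cis \<theta>)))\<^sup>2)"
        by (rule bessel_inequality[OF MF K])
      also have "\<dots> \<le> (LINT \<theta>|circle_measure. B\<^sup>2 * (norm (?F (cis \<theta>)))\<^sup>2)"
      proof (intro integral_mono Bochner_Integration.integrable_mult_right)
        show "integrable circle_measure (\<lambda>\<theta>. (norm (a (cis \<theta>) *v ?F (cis \<theta>)))\<^sup>2)"
          "integrable circle_measure (\<lambda>\<theta>. (norm (?F (cis \<theta>)))\<^sup>2)"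
          using F MF by (simp_all only: has_fourier_series_iff)
        show "(norm (a (cis \<theta>) *v ?F (cis \<theta>)))\<^sup>2 \<le> B\<^sup>2 * (norm (?F (cis \<theta>)))\<^sup>2" for \<theta>
          unfolding power_mult_distrib[symmetric] by (intro power_mono B) simp
      qed
      also have "\<dots> = 2 * pi * (B\<^sup>2 * (\<Sum>k\<in>J. (norm (c k))\<^sup>2))"
        by (simp add: integral_trig_poly[OF J])
      also have "(\<Sum>k\<in>J. (norm (c k))\<^sup>2) \<le> (norm ?f)\<^sup>2"
        using sum_le_norm_ell2[OF J, of ?f] J by (simp add: ell2_nth_sum_delta)
      finally show ?thesis by (simp add: power_mult_distrib mult_left_mono)
    qed
    then show "(norm (M ?f))\<^sup>2 \<le> (B * norm ?f)\<^sup>2" by (rule norm_ell2_le)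
  qed (simp add: B0)
  obtain K where K: "K > 0" "\<And>x. norm (M x) \<le> norm x * K"
    using bounded_linear.pos_bounded[OF lin] by blast
  have bound: "norm (M f) \<le> B * norm f + e * (K + B)" if e: "e > 0" for e
  proof -
    obtain J where J: "finite J" "(norm (f - (\<Sum>k\<in>J. ell2_delta k (ell2_nth f k))))\<^sup>2 < e\<^sup>2"
      using ell2_delta_dense[of "e\<^sup>2" f] e by auto
    let ?t = "\<Sum>k\<in>J. ell2_delta k (ell2_nth f k)"
    have d: "norm (f - ?t) \<le> e"
      by (intro less_imp_le power2_less_imp_less[OF J(2)]) (use e in simp)
    have "norm (M f) \<le> norm (M (f - ?t)) + norm (M ?t)"
      using norm_triangle_ineq[of "M (f - ?t)" "M ?t"] by (simp add: linear_simps(2)[OF lin])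
    also have "\<dots> \<le> e * K + B * norm ?t"
      using K(1) d by (intro add_mono order_trans[OF K(2)] mult_right_mono finite_case J) auto
    also have "B * norm ?t \<le> B * (norm f + e)"
      using norm_triangle_ineq4[of f "f - ?t"] d B0 by (intro mult_left_mono) auto
    finally show ?thesis by (simp add: algebra_simps)
  qed
  \<comment> \<open>The error of the approximation is amplified at most by
    \<open>K + B\<close>.\<close>
  have "norm (M f) \<le> B * norm f + e" if "e > 0" for e
    using that K(1) B0 bound[of "e / (K + B)"] by simp
  then show ?thesis by (rule field_le_epsilon)
qed

lemma multiplier_cong:
  assumes "\<And>\<theta>. a (cis \<theta>) = b (cis \<theta>)"
  shows "multiplier a M \<longleftrightarrow> multiplier b M"
  by (simp add: multiplier_def has_fourier_series_iff assms)

lemma has_fourier_series_add: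
  assumes f: "has_fourier_series f F" and g: "has_fourier_series g G"
  shows "has_fourier_series (f + g) (\<lambda>u. F u + G u :: complex ^ 'n::finite)"
proof -
  have fg: "(\<lambda>\<theta>. F (cis \<theta>)) \<in> borel_measurable borel" "(\<lambda>\<theta>. G (cis \<theta>)) \<in> borel_measurable borel"
    "integrable circle_measure (\<lambda>\<theta>. (norm (F (cis \<theta>)))\<^sup>2)"
    "integrable circle_measure (\<lambda>\<theta>. (norm (G (cis \<theta>)))\<^sup>2)"
    using f g by (simp_all add: has_fourier_series_iff)
  have m: "(\<lambda>\<theta>. F (cis \<theta>) + G (cis \<theta>)) \<in> borel_measurable borel"
    by (intro borel_measurable_add fg)
  have "integrable circle_measure (\<lambda>\<theta>. (norm (F (cis \<theta>) + G (cis \<theta>)))\<^sup>2)"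
  proof (rule Bochner_Integration.integrable_bound)
    show "integrable circle_measure (\<lambda>\<theta>. 2 * (norm (F (cis \<theta>)))\<^sup>2 + 2 * (norm (G (cis \<theta>)))\<^sup>2)"
      by (intro Bochner_Integration.integrable_add Bochner_Integration.integrable_mult_right fg)
    show "(\<lambda>\<theta>. (norm (F (cis \<theta>) + G (cis \<theta>)))\<^sup>2) \<in> borel_measurable circle_measure"
      by (intro measurable_norm_power2 m)
    have "(norm (x + y))\<^sup>2 \<le> 2 * (norm x)\<^sup>2 + 2 * (norm y)\<^sup>2" for x y :: "complex ^ 'n"
    proof -
      have "(norm (x + y))\<^sup>2 \<le> (norm x + norm y)\<^sup>2" by (intro power_mono norm_triangle_ineq) simp
      also have "\<dots> \<le> 2 * (norm x)\<^sup>2 + 2 * (norm y)\<^sup>2"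
        using sum_squares_bound[of "norm x" "norm y"] by (simp add: power2_sum)
      finally show ?thesis .
    qed
    then show "AE \<theta> in circle_measure. norm ((norm (F (cis \<theta>) + G (cis \<theta>)))\<^sup>2)
        \<le> norm (2 * (norm (F (cis \<theta>)))\<^sup>2 + 2 * (norm (G (cis \<theta>)))\<^sup>2)" by simp
  qed
  moreover have "integrable circle_measure (\<lambda>\<theta>. cis (- of_int k * \<theta>) *s F (cis \<theta>))"
    "integrable circle_measure (\<lambda>\<theta>. cis (- of_int k * \<theta>) *s G (cis \<theta>))" for k
    by (intro integrable_fourier fg)+
  ultimately show ?thesis
    using f g m unfolding has_fourier_series_iff vec.scale_right_distrib
    by (simp add: Bochner_Integration.integral_add scaleR_right_distrib del: minus_mult_minus mult_minus_left)
qed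

lemma norm_matrix_vector_le:
  "norm (M *v x) \<le> (real CARD('m) * real CARD('n)) * norm M * norm (x :: complex ^ 'n::finite)"
  for M :: "complex ^ 'n ^ 'm::finite"
proof -
  have "norm (M *v x) \<le> (\<Sum>i\<in>UNIV. norm ((M *v x) $ i))"
    unfolding norm_vec_def by (rule L2_set_le_sum) simp
  also have "\<dots> \<le> (\<Sum>i\<in>(UNIV :: 'm set). \<Sum>j\<in>(UNIV :: 'n set). norm M * norm x)"
  proof (rule sum_mono)
    fix i
    have "norm ((M *v x) $ i) \<le> (\<Sum>j\<in>UNIV. norm (M $ i $ j * x $ j))"
      by (simp add: matrix_vector_mult_def norm_sum)
    also have "\<dots> \<le> (\<Sum>j\<in>(UNIV :: 'n set). norm M * norm x)"
      unfolding norm_mult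
      by (intro sum_mono mult_mono Finite_Cartesian_Product.norm_nth_le
          order_trans[OF Finite_Cartesian_Product.norm_nth_le Finite_Cartesian_Product.norm_nth_le]) auto
    finally show "norm ((M *v x) $ i) \<le> (\<Sum>j\<in>(UNIV :: 'n set). norm M * norm x)" .
  qed
  finally show ?thesis by (simp add: mult_ac)
qed

lemma has_fourier_series_matrix:
  assumes f: "has_fourier_series f F"
  shows "has_fourier_series (ell2_map ((*v) B) f) (\<lambda>u. (B :: complex ^ 'n ^ 'n::finite) *v F u)"
proof -
  have m: "(\<lambda>\<theta>. F (cis \<theta>)) \<in> borel_measurable borel"
    and i: "integrable circle_measure (\<lambda>\<theta>. (norm (F (cis \<theta>)))\<^sup>2)"
    using f by (simp_all add: has_fourier_series_iff)
  note bl = bounded_linear_matrix_vector_mult[of B]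
  have mB: "(\<lambda>\<theta>. B *v F (cis \<theta>)) \<in> borel_measurable borel"
    by (intro borel_measurable_matrix_vector m) simp
  let ?c = "real CARD('n) * real CARD('n) * norm B"
  have "integrable circle_measure (\<lambda>\<theta>. (norm (B *v F (cis \<theta>)))\<^sup>2)"
  proof (rule Bochner_Integration.integrable_bound)
    show "integrable circle_measure (\<lambda>\<theta>. ?c\<^sup>2 * (norm (F (cis \<theta>)))\<^sup>2)"
      by (intro Bochner_Integration.integrable_mult_right i)
    show "(\<lambda>\<theta>. (norm (B *v F (cis \<theta>)))\<^sup>2) \<in> borel_measurable circle_measure"
      by (intro measurable_norm_power2 mB)
    show "AE \<theta> in circle_measure. norm ((norm (B *v F (cis \<theta>)))\<^sup>2) \<le> norm (?c\<^sup>2 * (norm (F (cis \<theta>)))\<^sup>2)"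
      unfolding power_mult_distrib[symmetric]
      by (intro AE_I2) (simp add: norm_matrix_vector_le power_mono)
  qed
  moreover have "(LINT \<theta>|circle_measure. cis (- of_int k * \<theta>) *s (B *v F (cis \<theta>)))
      = B *v (LINT \<theta>|circle_measure. cis (- of_int k * \<theta>) *s F (cis \<theta>))" for k
    using integral_bounded_linear[OF bl integrable_fourier[OF m i, of "- of_int k"]]
    by (simp only: vector_scalar_commute)
  ultimately show ?thesis
    using f mB by (simp add: has_fourier_series_iff ell2_nth_map bl linear_simps(5)[OF bl])
qed

lift_definition ell2_shift :: "int \<Rightarrow> (int, 'a::real_inner) ell2 \<Rightarrow> (int, 'a) ell2" is "\<lambda>m f k. f (k - m)"
proof -
  fix m and f :: "int \<Rightarrow> 'a"
  have "bij_betw (\<lambda>k. k - m) UNIV (UNIV :: int set)"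
    by (rule bij_betw_byWitness[where f' = "\<lambda>k. k + m"]) auto
  moreover assume "(\<lambda>i. (norm (f i))\<^sup>2) summable_on UNIV"
  ultimately show "(\<lambda>k. (norm (f (k - m)))\<^sup>2) summable_on UNIV"
    using summable_on_reindex_bij_betw[of "\<lambda>k. k - m" UNIV UNIV "\<lambda>i. (norm (f i))\<^sup>2"] by simp
qed

lemma has_fourier_series_shift:
  assumes f: "has_fourier_series f F"
  shows "has_fourier_series (ell2_shift m f) (\<lambda>u. (u powi m) *s F u :: complex ^ 'n::finite)"
proof -
  have mF: "(\<lambda>\<theta>. F (cis \<theta>)) \<in> borel_measurable borel" using f by (simp add: has_fourier_series_iff)
  have "cis (- of_int k * \<theta>) *s (cis (of_int m * \<theta>) *s F (cis \<theta>)) = cis (- of_int (k - m) * \<theta>) *s F (cis \<theta>)" for k \<theta>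
    by (simp add: vector_smult_assoc cis_mult algebra_simps)
  moreover have "(\<lambda>\<theta>. cis (of_int m * \<theta>) *s F (cis \<theta>)) \<in> borel_measurable borel"
    by (intro borel_measurable_vector_scalar borel_measurable_cis mF)
  ultimately show ?thesis
    using f unfolding has_fourier_series_iff cis_power_int ell2_shift.rep_eq
    by (simp only: norm_vector_scalar_mult norm_cis mult_1) simp
qed

lemma uminus_mat_1_vector [simp]: "(- mat 1) *v x = - (x :: complex ^ 'n::finite)"
  by (simp add: uminus_matrix_vector_mult)

lemma multiplier_add:
  fixes a b :: "complex \<Rightarrow> complex ^ 'n ^ 'n::finite"
  shows "multiplier a M \<Longrightarrow> multiplier b N \<Longrightarrow> multiplier (\<lambda>u. a u + b u) (\<lambda>f. M f + N f)"
  unfolding multiplier_def matrix_vector_mult_add_rdistrib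
  by (auto intro!: bounded_linear_add has_fourier_series_add)

lemma multiplier_mult:
  fixes a b :: "complex \<Rightarrow> complex ^ 'n ^ 'n::finite"
  shows "multiplier a M \<Longrightarrow> multiplier b N \<Longrightarrow> multiplier (\<lambda>u. a u ** b u) (\<lambda>f. M (N f))"
  unfolding multiplier_def matrix_vector_mul_assoc[symmetric]
  by (auto intro!: bounded_linear_compose[of M N])

lemma multiplier_const: "multiplier (\<lambda>_. B) (ell2_map ((*v) (B :: complex ^ 'n ^ 'n::finite)))"
  unfolding multiplier_def
  by (auto intro!: has_fourier_series_matrix bounded_linear_ell2_map bounded_linear_matrix_vector_mult)

lemma multiplier_diff:
  fixes a b :: "complex \<Rightarrow> complex ^ 'n ^ 'n::finite"
  assumes "multiplier a M" "multiplier b N"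
  shows "multiplier (\<lambda>u. a u - b u) (\<lambda>f. M f - N f)"
proof -
  have "ell2_map ((*v) (- mat 1 :: complex ^ 'n ^ 'n)) f = - f" for f :: "(int, complex ^ 'n) ell2"
    by (rule ell2_eqI) (simp add: ell2_nth_map bounded_linear_matrix_vector_mult)
  moreover have "(- mat 1) ** X = - X" for X :: "complex ^ 'n ^ 'n"
    by (rule matrix_eqI) (simp add: matrix_vector_mul_assoc[symmetric] uminus_matrix_vector_mult)
  ultimately show ?thesis
    using multiplier_add[OF assms(1) multiplier_mult[OF multiplier_const[of "- mat 1"] assms(2)]] by simp
qed

text \<open>The difference of two candidates is a multiplier with symbol 0, hence has norm
  0.\<close>

lemma multiplier_unique:
  fixes a :: "complex \<Rightarrow> complex ^ 'n ^ 'n::finite"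
  assumes "multiplier a M" "multiplier a N"
  shows "M = N"
proof
  fix f
  have "norm (M f - N f) \<le> 0 * norm f"
    by (rule multiplier_norm_le[OF multiplier_diff[OF assms]]) simp_all
  then show "M f = N f" by simp
qed

lemma laurent_op_eqI: "multiplier a M \<Longrightarrow> laurent_op a = M"
  unfolding laurent_op_def
  by (rule the_equality) (auto simp: multiplier_def intro: multiplier_unique[unfolded multiplier_def])

lemma bounded_linear_flip: "bounded_linear (flip :: (int, 'a::real_inner) ell2 \<Rightarrow> _)"
proof (rule bounded_linear_intro[of _ 1])
  have bij: "bij_betw (\<lambda>k. -1 - k) (UNIV :: int set) UNIV"
    by (rule bij_betw_byWitness[where f' = "\<lambda>k. -1 - k"]) auto
  show "norm (flip f) \<le> norm f * 1" for f :: "(int, 'a) ell2"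
    using infsum_reindex_bij_betw[OF bij, of "\<lambda>i. (norm (ell2_nth f i))\<^sup>2"]
    by - (rule power2_le_imp_le, simp_all add: norm_ell2_power2)
qed (rule ell2_eqI; simp)+

text \<open>A symbol in \<open>Re u\<close> is invariant under \<open>u \<mapsto> 1/u\<close>, so
  multiplication by it commutes with \<open>flip\<close>. Commutation and complex linearity are part
  of the definition because they can then be carried along sums, products and limits.\<close>

definition even_operator ::
    "(real \<Rightarrow> complex ^ 'n ^ 'n) \<Rightarrow> ((int, complex ^ 'n) ell2 \<Rightarrow> (int, complex ^ 'n) ell2) \<Rightarrow> bool" where
  "even_operator b M \<longleftrightarrow> multiplier (\<lambda>u. b (Re u)) M \<and>
     (\<forall>c f. M (ell2_scale c f) = ell2_scale c (M f)) \<and> (\<forall>f. M (flip f) = flip (M f))"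

lemma even_operator_norm_le:
  fixes b :: "real \<Rightarrow> complex ^ 'n ^ 'n::finite"
  assumes "even_operator b M" "\<And>x v. x \<in> {-1..1} \<Longrightarrow> norm (b x *v v) \<le> B * norm v" "0 \<le> B"
  shows "norm (M f) \<le> B * norm f"
  using assms by (intro multiplier_norm_le[of "\<lambda>u. b (Re u)"]) (auto simp: even_operator_def)

lemma even_operator_add:
  fixes b c :: "real \<Rightarrow> complex ^ 'n ^ 'n::finite"
  assumes "even_operator b M" "even_operator c N"
  shows "even_operator (\<lambda>x. b x + c x) (\<lambda>f. M f + N f)"
  using assms multiplier_add unfolding even_operator_def
  by (auto simp: ell2_eqI vec.scale_right_distrib linear_simps(1)[OF bounded_linear_flip] intro!: ell2_eqI)

lemma even_operator_mult:
  fixes b c :: "real \<Rightarrow> complex ^ 'n ^ 'n::finite"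
  assumes "even_operator b M" "even_operator c N"
  shows "even_operator (\<lambda>x. b x ** c x) (\<lambda>f. M (N f))"
  using assms multiplier_mult unfolding even_operator_def by auto

lemma even_operator_const: "even_operator (\<lambda>_. B) (ell2_map ((*v) (B :: complex ^ 'n ^ 'n::finite)))"
  unfolding even_operator_def
  by (auto intro!: multiplier_const ell2_eqI
      simp: ell2_nth_map bounded_linear_matrix_vector_mult vector_scalar_commute)

lemma scaleR_matrix_vector: "(r *\<^sub>R M) *v x = r *\<^sub>R (M *v (x :: complex ^ 'n::finite))"
  by (simp add: matrix_vector_mult_def vec_eq_iff scaleR_sum_right)

text \<open>The sum of the two shifts has the symbol \<open>u + 1/u\<close>, twice the real part on
  the circle; with constant matrices it generates all matrix polynomials in
  \<open>Re u\<close>.\<close>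

lemma even_operator_cos:
  "even_operator (\<lambda>x. (2 * x) *\<^sub>R mat 1) (\<lambda>f. ell2_shift 1 f + ell2_shift (- 1) f :: (int, complex ^ 'n::finite) ell2)"
proof -
  have bl: "bounded_linear (ell2_shift m :: (int, complex ^ 'n) ell2 \<Rightarrow> _)" for m
  proof (rule bounded_linear_intro[of _ 1])
    have bij: "bij_betw (\<lambda>k. k - m) (UNIV :: int set) UNIV"
      by (rule bij_betw_byWitness[where f' = "\<lambda>k. k + m"]) auto
    show "norm (ell2_shift m f) \<le> norm f * 1" for f :: "(int, complex ^ 'n) ell2"
      using infsum_reindex_bij_betw[OF bij, of "\<lambda>i. (norm (ell2_nth f i))\<^sup>2"]
      by - (rule power2_le_imp_le, simp_all add: norm_ell2_power2 ell2_shift.rep_eq)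
  qed (rule ell2_eqI; simp add: ell2_shift.rep_eq)+
  have "has_fourier_series (ell2_shift 1 f + ell2_shift (- 1) f) (\<lambda>u. ((2 * Re u) *\<^sub>R mat 1) *v F u)"
    if "has_fourier_series f F" for f and F :: "complex \<Rightarrow> complex ^ 'n"
  proof -
    have "(cis \<theta> powi 1) *s F (cis \<theta>) + (cis \<theta> powi - 1) *s F (cis \<theta>) = ((2 * Re (cis \<theta>)) *\<^sub>R mat 1) *v F (cis \<theta>)" for \<theta>
      by (simp add: scaleR_matrix_vector vec_eq_iff complex_eq_iff algebra_simps)
    then show ?thesis
      using has_fourier_series_add[OF has_fourier_series_shift[OF that, of 1] has_fourier_series_shift[OF that, of "- 1"]]
      unfolding has_fourier_series_iff by simp
  qed
  then have "multiplier (\<lambda>u. (2 * Re u) *\<^sub>R mat 1) (\<lambda>f. ell2_shift 1 f + ell2_shift (- 1) f :: (int, complex ^ 'n) ell2)"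
    unfolding multiplier_def by (auto intro!: bounded_linear_add bl)
  then show ?thesis
    unfolding even_operator_def
    by (auto intro!: ell2_eqI simp: ell2_shift.rep_eq vec.scale_right_distrib algebra_simps)
qed

lemma bounded_linear_limit:
  fixes M :: "nat \<Rightarrow> 'a::real_normed_vector \<Rightarrow> 'b::{real_normed_vector, complete_space}"
  assumes bl: "\<And>n. bounded_linear (M n)" and e0: "\<And>n. 0 < e n" "\<And>n. e n \<le> 1" and e_lim: "e \<longlonglongrightarrow> 0"
    and diff: "\<And>n m f. norm (M n f - M m f) \<le> (e n + e m) * norm f"
  obtains L where "bounded_linear L" "\<And>f. (\<lambda>n. M n f) \<longlonglongrightarrow> L f"
proof -
  have "Cauchy (\<lambda>n. M n f)" for f
  proof (rule CauchyI)
    fix r :: real assume r: "r > 0"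
    have "(\<lambda>n. e n * (norm f + 1)) \<longlonglongrightarrow> 0 * (norm f + 1)" by (intro tendsto_intros e_lim)
    then have "\<forall>\<^sub>F n in sequentially. e n * (norm f + 1) < r / 2"
      using r by (intro order_tendstoD(2)[of _ "0 * (norm f + 1)"]) auto
    then obtain N where N: "\<And>n. n \<ge> N \<Longrightarrow> e n * (norm f + 1) < r / 2"
      by (auto simp: eventually_sequentially)
    have "norm (M m f - M n f) < r" if "m \<ge> N" "n \<ge> N" for m n
    proof -
      have "norm (M m f - M n f) \<le> (e m + e n) * (norm f + 1)"
        using diff[of m f n] e0[of m] e0[of n]
        by (intro order_trans[OF diff] mult_left_mono) (auto intro: add_nonneg_nonneg less_imp_le)
      then show ?thesis using N[OF that(1)] N[OF that(2)] by (simp add: distrib_right)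
    qed
    then show "\<exists>N. \<forall>m\<ge>N. \<forall>n\<ge>N. norm (M m f - M n f) < r" by blast
  qed
  then have "\<exists>L. (\<lambda>n. M n f) \<longlonglongrightarrow> L" for f by (simp add: Cauchy_convergent_iff convergent_def)
  then obtain L where L: "\<And>f. (\<lambda>n. M n f) \<longlonglongrightarrow> L f" by metis
  have L_eq: "L f = T" if "(\<lambda>n. M n f) \<longlonglongrightarrow> T" for f T using LIMSEQ_unique[OF L that] .
  have bL: "bounded_linear L"
  proof -
    obtain K where K: "\<And>x. norm (M 0 x) \<le> norm x * K" using bounded_linear.bounded[OF bl] by blast
    show ?thesis
    proof (rule bounded_linear_intro)
      show "L (f + g) = L f + L g" for f g
        by (rule L_eq) (simp add: linear_simps(1)[OF bl] tendsto_add L)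
      show "L (c *\<^sub>R f) = c *\<^sub>R L f" for c f
        by (rule L_eq) (simp add: linear_simps(5)[OF bl] tendsto_scaleR L)
      show "norm (L f) \<le> norm f * (K + 2)" for f
      proof (rule LIMSEQ_le_const2[OF tendsto_norm[OF L]])
        have "norm (M n f) \<le> norm f * (K + 2)" for n
        proof -
          have "norm (M n f) \<le> norm (M n f - M 0 f) + norm (M 0 f)"
            using norm_triangle_ineq[of "M n f - M 0 f" "M 0 f"] by simp
          also have "\<dots> \<le> 2 * norm f + norm f * K"
            using e0[of n] e0[of 0]
            by (intro add_mono K order_trans[OF diff] mult_right_mono) auto
          finally show ?thesis by (simp add: algebra_simps)
        qed
        then show "\<exists>N. \<forall>n\<ge>N. norm (M n f) \<le> norm f * (K + 2)" by blast
      qed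
    qed
  qed
  with L that show thesis by blast
qed

lemma symbol_bound:
  fixes b :: "real \<Rightarrow> complex ^ 'n ^ 'n::finite"
  assumes b: "continuous_on {-1..1} b"
  obtains B where "B > 0" "\<And>x v. x \<in> {-1..1} \<Longrightarrow> norm (b x *v v) \<le> B * norm v"
proof -
  obtain B where "\<forall>x\<in>{-1..1}. norm (b x) \<le> B"
    using compact_imp_bounded[OF compact_continuous_image[OF b]] by (auto simp: bounded_iff)
  then have B: "norm (b x) \<le> \<bar>B\<bar> + 1" if "x \<in> {-1..1}" for x using that by fastforce
  let ?c = "real CARD('n) * real CARD('n) * (\<bar>B\<bar> + 1)"
  have "norm (b x *v v) \<le> ?c * norm v" if "x \<in> {-1..1}" for x v
    by (intro order_trans[OF norm_matrix_vector_le] mult_right_mono mult_left_mono B that) auto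
  moreover have "?c > 0" by simp
  ultimately show thesis using that by blast
qed

text \<open>The symbols control the operator norms, so the approximating operators form a Cauchy
  sequence. Fourier coefficients pass to the limit because \<open>F\<close> is integrable and the
  symbols converge uniformly.\<close>

lemma even_operator_limit:
  fixes b :: "real \<Rightarrow> complex ^ 'n ^ 'n::finite"
  assumes cont: "continuous_on {-1..1} b"
    and approx: "\<And>e. e > 0 \<Longrightarrow> \<exists>p M. even_operator p M \<and> continuous_on {-1..1} p \<and>
      (\<forall>x\<in>{-1..1}. \<forall>v. norm (p x *v v - b x *v v) \<le> e * norm v)"
  shows "\<exists>M. even_operator b M"
proof -
  define e where "e n = 1 / real (Suc n)" for n
  have e0: "e n > 0" "e n \<le> 1" for n by (simp_all add: e_def)
  have e_lim: "e \<longlonglongrightarrow> 0" unfolding e_def by (rule LIMSEQ_Suc[OF lim_1_over_n])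
  obtain p M where pM: "\<And>n. even_operator (p n) (M n)"
    and p_cont: "\<And>n. continuous_on {-1..1} (p n)"
    and p: "\<And>n x v. x \<in> {-1..1} \<Longrightarrow> norm (p n x *v v - b x *v v) \<le> e n * norm v"
    using approx[OF e0(1)] by metis
  have mult: "multiplier (\<lambda>u. p n (Re u)) (M n)" for n using pM by (simp add: even_operator_def)
  have bl: "bounded_linear (M n)" for n using mult by (simp add: multiplier_def)
  have diff: "norm (M n f - M m f) \<le> (e n + e m) * norm f" for n m f
  proof (rule multiplier_norm_le[OF multiplier_diff[OF mult mult]])
    fix \<theta> v
    let ?x = "Re (cis \<theta>)"
    have "(p n ?x - p m ?x) *v v = (p n ?x *v v - b ?x *v v) - (p m ?x *v v - b ?x *v v)"
      by (simp add: matrix_vector_mult_diff_rdistrib)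
    also have "norm \<dots> \<le> e n * norm v + e m * norm v"
      by (intro norm_triangle_le_diff add_mono p) auto
    finally show "norm ((p n ?x - p m ?x) *v v) \<le> (e n + e m) * norm v" by (simp add: distrib_right)
  qed (use e0 in \<open>auto intro: less_imp_le add_nonneg_nonneg\<close>)
  obtain L where bL: "bounded_linear L" and L: "\<And>f. (\<lambda>n. M n f) \<longlonglongrightarrow> L f"
    using bounded_linear_limit[OF bl e0 e_lim diff] by blast
  have L_eq: "L f = T" if "(\<lambda>n. M n f) \<longlonglongrightarrow> T" for f T using LIMSEQ_unique[OF L that] .
  have nth_lim: "(\<lambda>n. ell2_nth (M n f) k) \<longlonglongrightarrow> ell2_nth (L f) k" for f k
    by (rule bounded_linear.tendsto[OF bounded_linear_ell2_nth L])
  have bcos: "continuous_on UNIV (\<lambda>\<theta>. q (Re (cis \<theta>)))" if "continuous_on {-1..1} q" for q :: "real \<Rightarrow> complex ^ 'n ^ 'n"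
    by (rule continuous_on_compose2[OF that]) (auto intro!: continuous_intros)
  obtain B where B: "B > 0" "\<And>x v. x \<in> {-1..1} \<Longrightarrow> norm (b x *v v) \<le> B * norm v"
    using symbol_bound[OF cont] by blast
  have "has_fourier_series (L f) (\<lambda>u. b (Re u) *v F u)" if fF: "has_fourier_series f F" for f F
  proof -
    have mF: "(\<lambda>\<theta>. F (cis \<theta>)) \<in> borel_measurable borel"
      and iF: "integrable circle_measure (\<lambda>\<theta>. (norm (F (cis \<theta>)))\<^sup>2)"
      using fF by (simp_all add: has_fourier_series_iff)
    have mbF: "(\<lambda>\<theta>. b (Re (cis \<theta>)) *v F (cis \<theta>)) \<in> borel_measurable borel"
      by (intro borel_measurable_matrix_vector mF borel_measurable_continuous_onI bcos cont)
    have ibF: "integrable circle_measure (\<lambda>\<theta>. (norm (b (Re (cis \<theta>)) *v F (cis \<theta>)))\<^sup>2)"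
    proof (rule Bochner_Integration.integrable_bound)
      show "integrable circle_measure (\<lambda>\<theta>. B\<^sup>2 * (norm (F (cis \<theta>)))\<^sup>2)"
        by (intro Bochner_Integration.integrable_mult_right iF)
      show "(\<lambda>\<theta>. (norm (b (Re (cis \<theta>)) *v F (cis \<theta>)))\<^sup>2) \<in> borel_measurable circle_measure"
        by (rule measurable_norm_power2[OF mbF])
      have "norm (b (Re (cis \<theta>)) *v F (cis \<theta>)) \<le> B * norm (F (cis \<theta>))" for \<theta> by (rule B) auto
      then show "AE \<theta> in circle_measure. norm ((norm (b (Re (cis \<theta>)) *v F (cis \<theta>)))\<^sup>2)
          \<le> norm (B\<^sup>2 * (norm (F (cis \<theta>)))\<^sup>2)"
        unfolding power_mult_distrib[symmetric] by (intro AE_I2) (simp add: power_mono)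
    qed
    have nF: "integrable circle_measure (\<lambda>\<theta>. norm (F (cis \<theta>)))"
      using integrable_norm[OF integrable_fourier[OF mF iF, of 0]] by (simp add: norm_vector_scalar_mult)
    let ?I = "LINT \<theta>|circle_measure. norm (F (cis \<theta>))"
    have "ell2_nth (L f) k = (1 / (2 * pi)) *\<^sub>R (LINT \<theta>|circle_measure. cis (- of_int k * \<theta>) *s (b (Re (cis \<theta>)) *v F (cis \<theta>)))"
      (is "_ = ?R") for k
    proof (rule LIMSEQ_unique[OF nth_lim])
      have bound: "norm (ell2_nth (M n f) k - ?R) \<le> e n * ((1 / (2 * pi)) * ?I)" for n
      proof -
        have Mf: "has_fourier_series (M n f) (\<lambda>u. p n (Re u) *v F u)" using mult fF by (simp add: multiplier_def)
        have i1: "integrable circle_measure (\<lambda>\<theta>. cis (- of_int k * \<theta>) *s (p n (Re (cis \<theta>)) *v F (cis \<theta>)))"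
          using Mf by (intro integrable_fourier[of "\<lambda>u. p n (Re u) *v F u"]) (simp_all only: has_fourier_series_iff)
        have i2: "integrable circle_measure (\<lambda>\<theta>. cis (- of_int k * \<theta>) *s (b (Re (cis \<theta>)) *v F (cis \<theta>)))"
          by (intro integrable_fourier[of "\<lambda>u. b (Re u) *v F u"] mbF ibF)
        have "ell2_nth (M n f) k = (1 / (2 * pi)) *\<^sub>R
            (LINT \<theta>|circle_measure. cis (- of_int k * \<theta>) *s (p n (Re (cis \<theta>)) *v F (cis \<theta>)))"
          using Mf by (simp only: has_fourier_series_iff)
        then have "ell2_nth (M n f) k - ?R = (1 / (2 * pi)) *\<^sub>R (LINT \<theta>|circle_measure.
            cis (- of_int k * \<theta>) *s (p n (Re (cis \<theta>)) *v F (cis \<theta>)) - cis (- of_int k * \<theta>) *s (b (Re (cis \<theta>)) *v F (cis \<theta>)))"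
          (is "_ = _ *\<^sub>R ?D")
          by (simp only: Bochner_Integration.integral_diff[OF i1 i2] scaleR_right_diff_distrib)
        then have "norm (ell2_nth (M n f) k - ?R) = (1 / (2 * pi)) * norm ?D"
          by (simp only: norm_scaleR) simp
        also have "norm ?D \<le> (LINT \<theta>|circle_measure. e n * norm (F (cis \<theta>)))"
        proof (rule order_trans[OF integral_norm_bound], rule integral_mono)
          show "norm (cis (- of_int k * \<theta>) *s (p n (Re (cis \<theta>)) *v F (cis \<theta>)) - cis (- of_int k * \<theta>) *s (b (Re (cis \<theta>)) *v F (cis \<theta>)))
              \<le> e n * norm (F (cis \<theta>))" for \<theta>
            unfolding vec.scale_right_diff_distrib[symmetric] norm_vector_scalar_mult norm_cis mult_1
            by (rule p) auto
        qed (intro integrable_norm Bochner_Integration.integrable_diff i1 i2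
            Bochner_Integration.integrable_mult_right nF)+
        finally show ?thesis by (simp add: divide_right_mono)
      qed
      have "(\<lambda>n. e n * ((1 / (2 * pi)) * ?I)) \<longlonglongrightarrow> 0 * ((1 / (2 * pi)) * ?I)"
        by (intro tendsto_intros e_lim)
      then have lim: "(\<lambda>n. e n * ((1 / (2 * pi)) * ?I)) \<longlonglongrightarrow> 0" by (simp only: mult_zero_left)
      have "(\<lambda>n. ell2_nth (M n f) k - ?R) \<longlonglongrightarrow> 0"
        by (rule Lim_null_comparison[OF _ lim]) (intro always_eventually allI bound)
      then show "(\<lambda>n. ell2_nth (M n f) k) \<longlonglongrightarrow> ?R" by (rule LIM_zero_cancel)
    qed
    then show ?thesis unfolding has_fourier_series_iff using mbF ibF by blast
  qed
  then have "multiplier (\<lambda>u. b (Re u)) L" using bL by (simp add: multiplier_def)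
  moreover have "L (ell2_scale c f) = ell2_scale c (L f)" for c f
  proof (rule L_eq)
    have "M n (ell2_scale c f) = ell2_scale c (M n f)" for n using pM by (simp add: even_operator_def)
    then show "(\<lambda>n. M n (ell2_scale c f)) \<longlonglongrightarrow> ell2_scale c (L f)"
      unfolding ell2_scale_eq_map
      by (simp add: bounded_linear.tendsto[OF bounded_linear_ell2_map[OF bounded_linear_vector_scalar_mult] L])
  qed
  moreover have "L (flip f) = flip (L f)" for f
  proof (rule L_eq)
    have "M n (flip f) = flip (M n f)" for n using pM by (simp add: even_operator_def)
    then show "(\<lambda>n. M n (flip f)) \<longlonglongrightarrow> flip (L f)"
      by (simp add: bounded_linear.tendsto[OF bounded_linear_flip L])
  qed
  ultimately show ?thesis unfolding even_operator_def by blast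
qed

lemma even_operator_sum:
  fixes b :: "'i \<Rightarrow> real \<Rightarrow> complex ^ 'n ^ 'n::finite"
  assumes "finite I" "\<And>i. i \<in> I \<Longrightarrow> \<exists>M. even_operator (b i) M"
  shows "\<exists>M. even_operator (\<lambda>x. \<Sum>i\<in>I. b i x) M"
  using assms
proof (induction I rule: finite_induct)
  case empty
  then show ?case using even_operator_const[of 0] by auto
next
  case (insert i I)
  then obtain M N where "even_operator (b i) M" "even_operator (\<lambda>x. \<Sum>i\<in>I. b i x) N" by blast
  from even_operator_add[OF this] insert show ?case by auto
qed

lemma even_operator_polynomial:
  "real_polynomial_function r \<Longrightarrow>
     \<exists>M. even_operator (\<lambda>x. r x *\<^sub>R (mat 1 :: complex ^ 'n ^ 'n::finite)) M"
proof (induction r rule: real_polynomial_function.induct)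
  case (linear r)
  have eq: "r x *\<^sub>R (mat 1 :: complex ^ 'n ^ 'n) = ((r 1 / 2) *\<^sub>R mat 1) ** ((2 * x) *\<^sub>R mat 1)" for x
    using linear_scale[OF bounded_linear.linear[OF linear], of x 1]
    by (intro matrix_eqI) (simp add: matrix_vector_mul_assoc[symmetric] scaleR_matrix_vector)
  show ?case unfolding eq using even_operator_mult[OF even_operator_const even_operator_cos] by blast
next
  case (const c)
  show ?case using even_operator_const by blast
next
  case (add p q)
  then show ?case unfolding scaleR_left_distrib using even_operator_add by blast
next
  case (mult p q)
  have eq: "(p x * q x) *\<^sub>R (mat 1 :: complex ^ 'n ^ 'n) = (p x *\<^sub>R mat 1) ** (q x *\<^sub>R mat 1)" for x
    by (intro matrix_eqI) (simp add: matrix_vector_mul_assoc[symmetric] scaleR_matrix_vector)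
  show ?case unfolding eq using mult even_operator_mult by blast
qed

text \<open>Weierstrass approximation on \<open>{-1..1}\<close>, the set of values of
  \<open>Re u\<close> on the circle.\<close>

lemma even_operator_exists:
  fixes b :: "real \<Rightarrow> complex ^ 'n ^ 'n::finite"
  assumes "continuous_on {-1..1} b"
  shows "\<exists>M. even_operator b M"
proof (rule even_operator_limit[OF assms])
  fix e :: real assume e: "e > 0"
  let ?c = "real CARD('n) * real CARD('n)"
  have c: "?c > 0" by simp
  obtain p where p: "polynomial_function p" "\<And>x. x \<in> {-1..1} \<Longrightarrow> norm (b x - p x) < e / ?c"
    using Stone_Weierstrass_polynomial_function[OF compact_Icc assms, of "e / ?c"] e c by fastforce
  \<comment> \<open>Expansion in the real basis of the matrix space: a polynomial matrix function is
    a sum of real polynomials times constant matrices.\<close>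
  have eq: "p x = (\<Sum>i\<in>Basis. ((p x \<bullet> i) *\<^sub>R mat 1) ** i)" for x
  proof -
    have "((p x \<bullet> i) *\<^sub>R mat 1) ** i = (p x \<bullet> i) *\<^sub>R i" for i
      by (intro matrix_eqI) (simp add: matrix_vector_mul_assoc[symmetric] scaleR_matrix_vector)
    then show ?thesis by (simp add: euclidean_representation)
  qed
  have "\<exists>M. even_operator (\<lambda>x. ((p x \<bullet> i) *\<^sub>R mat 1) ** i) M" for i
  proof -
    have "real_polynomial_function (\<lambda>x. p x \<bullet> i)"
      using p(1) bounded_linear_inner_left[of i] unfolding polynomial_function_def o_def by blast
    then obtain M where "even_operator (\<lambda>x. (p x \<bullet> i) *\<^sub>R (mat 1 :: complex ^ 'n ^ 'n)) M"
      using even_operator_polynomial by blast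
    then show ?thesis using even_operator_mult[OF _ even_operator_const] by blast
  qed
  then have "\<exists>M. even_operator p M"
    using even_operator_sum[of Basis "\<lambda>i x. ((p x \<bullet> i) *\<^sub>R mat 1) ** i", folded eq] by simp
  moreover have "norm (p x *v v - b x *v v) \<le> e * norm v" if "x \<in> {-1..1}" for x v
  proof -
    have "norm (p x *v v - b x *v v) \<le> ?c * norm (p x - b x) * norm v"
      unfolding matrix_vector_mult_diff_rdistrib[symmetric] by (rule norm_matrix_vector_le)
    also have "\<dots> \<le> ?c * (e / ?c) * norm v"
      using p(2)[OF that] by (intro mult_right_mono mult_left_mono) (auto simp: norm_minus_commute)
    finally show ?thesis by simp
  qed
  ultimately show "\<exists>p M. even_operator p M \<and> continuous_on {-1..1} p \<and>
      (\<forall>x\<in>{-1..1}. \<forall>v. norm (p x *v v - b x *v v) \<le> e * norm v)"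
    using continuous_on_polymonial_function[OF p(1)] by blast
qed

subsection \<open>Folding even symbols\<close>

text \<open>The extension that is odd under the reflection about -1/2. With it the folding becomes:
  extend, apply the operator, restrict.\<close>

definition odd_extend :: "(nat, 'a::real_inner) ell2 \<Rightarrow> (int, 'a) ell2" where
  "odd_extend h = half_extend h - flip (half_extend h)"

lemma flip_odd_extend: "flip (odd_extend h) = - odd_extend h"
  by (rule ell2_eqI) (simp add: odd_extend_def)

lemma half_restrict_odd_extend [simp]: "half_restrict (odd_extend h) = h"
  by (rule ell2_eqI) (simp add: odd_extend_def)

lemma odd_extend_half_restrict:
  assumes "flip f = - f"
  shows "odd_extend (half_restrict f) = f"
proof (rule ell2_eqI)
  fix j
  have "ell2_nth f (- j - 1) = - ell2_nth f j"
    using arg_cong[OF assms, of "\<lambda>f. ell2_nth f j"] by (simp add: minus_diff_commute)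
  then show "ell2_nth (odd_extend (half_restrict f)) j = ell2_nth f j"
    by (auto simp: odd_extend_def)
qed

lemma linear_half_restrict:
  "half_restrict (f + g) = half_restrict f + half_restrict g"
  "half_restrict (f - g) = half_restrict f - half_restrict g"
  "half_restrict (c *\<^sub>R f) = c *\<^sub>R half_restrict f"
  "half_restrict (ell2_scale a k) = ell2_scale a (half_restrict k)"
  by (rule ell2_eqI, simp)+

lemma linear_odd_extend:
  "odd_extend (f + g) = odd_extend f + odd_extend g"
  "odd_extend (c *\<^sub>R f) = c *\<^sub>R odd_extend f"
  "odd_extend (ell2_scale a k) = ell2_scale a (odd_extend k)"
  by (rule ell2_eqI, simp add: odd_extend_def algebra_simps vec.scale_right_diff_distrib)+

text \<open>The two halves of an odd sequence have equal norms. The factor 2 cancels when norms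
  before and after an even operator are compared.\<close>

lemma norm_half_restrict_odd:
  assumes "flip f = - f"
  shows "(norm f)\<^sup>2 = 2 * (norm (half_restrict f))\<^sup>2"
proof -
  let ?g = "\<lambda>i. (norm (ell2_nth f i))\<^sup>2"
  have s: "?g summable_on A" for A by (rule summable_on_subset_banach[OF ell2_summable]) simp
  have bij: "bij_betw (\<lambda>k. - int k - 1) UNIV {..<0}"
    by (rule bij_betw_byWitness[where f' = "\<lambda>j. nat (- j - 1)"]) auto
  have bij': "bij_betw int UNIV {0..}"
    by (rule bij_betw_byWitness[where f' = nat]) auto
  have "ell2_nth f (- 1 - j) = - ell2_nth f j" for j
    using arg_cong[OF assms, of "\<lambda>f. ell2_nth f j"] by simp
  then have sym: "?g (- int k - 1) = ?g (int k)" for k by (metis add_diff_eq diff_minus_eq_add minus_diff_commute norm_minus_cancel uminus_add_conv_diff)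
  have "(norm f)\<^sup>2 = infsum ?g ({..<0} \<union> {0..})"
    unfolding norm_ell2_power2 by (rule arg_cong[of _ _ "infsum ?g"]) auto
  also have "\<dots> = infsum ?g {..<0} + infsum ?g {0..}"
    by (rule infsum_Un_disjoint) (auto intro: s)
  also have "infsum ?g {0..} = (\<Sum>\<^sub>\<infinity>k. ?g (int k))"
    by (rule infsum_reindex_bij_betw[OF bij', symmetric])
  also have "\<dots> = (\<Sum>\<^sub>\<infinity>k. ?g (- int k - 1))" by (simp only: sym)
  also have "infsum ?g {..<0} = (\<Sum>\<^sub>\<infinity>k. ?g (- int k - 1))"
    by (rule infsum_reindex_bij_betw[OF bij, symmetric])
  finally show ?thesis by (simp add: norm_ell2_power2)
qed

definition fold_symbol ::
    "(real \<Rightarrow> complex ^ 'n ^ 'n) \<Rightarrow> (nat, complex ^ 'n) ell2 \<Rightarrow> (nat, complex ^ 'n::finite) ell2" where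
  "fold_symbol b = half_fold_symbol (\<lambda>u. b (Re u))"

lemma half_fold_symbol_eq_fold:
  assumes "\<And>\<theta>. a (cis \<theta>) = b (cos \<theta>)"
  shows "half_fold_symbol a = fold_symbol b"
proof -
  have "laurent_op a = laurent_op (\<lambda>u. b (Re u))"
    unfolding laurent_op_def multiplier_def[symmetric]
    by (subst multiplier_cong[of a "\<lambda>u. b (Re u)"]) (simp_all add: assms)
  then show ?thesis by (simp add: fold_symbol_def)
qed

lemma fold_symbol_cong:
  assumes "\<And>x. x \<in> {-1..1} \<Longrightarrow> b x = c x"
  shows "fold_symbol b = fold_symbol c"
  using half_fold_symbol_eq_fold[of "\<lambda>u. b (Re u)" c] assms by (simp add: fold_symbol_def)

lemma fold_symbol_eq:
  assumes "even_operator b M"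
  shows "fold_symbol b h = half_restrict (M (odd_extend h))"
proof -
  have M: "multiplier (\<lambda>u. b (Re u)) M" using assms by (simp add: even_operator_def)
  then have bl: "bounded_linear M" by (simp add: multiplier_def)
  show ?thesis
    by (simp add: fold_symbol_def laurent_op_eqI[OF M] half_fold_def odd_extend_def
        linear_simps(2)[OF bl] linear_half_restrict)
qed

lemma even_operator_odd:
  assumes "even_operator b M" "flip f = - f"
  shows "flip (M f) = - M f"
proof -
  have bl: "bounded_linear M" using assms by (simp add: even_operator_def multiplier_def)
  have "flip (M f) = M (flip f)" using assms(1) by (simp add: even_operator_def)
  then show ?thesis by (simp add: assms(2) linear_simps(4)[OF bl])
qed

lemma fold_symbol_const: "fold_symbol (\<lambda>_. B) = ell2_map ((*v) B)"
proof
  fix h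
  show "fold_symbol (\<lambda>_. B) h = ell2_map ((*v) B) h"
    unfolding fold_symbol_eq[OF even_operator_const]
    by (rule ell2_eqI) (simp add: ell2_nth_map bounded_linear_matrix_vector_mult odd_extend_def)
qed

text \<open>The boundary term is a reflected value: at site 0, next to the half-line, the odd
  extension equals \<open>- ell2_nth h 0\<close>.\<close>

lemma fold_symbol_cos:
  "fold_symbol (\<lambda>x. (2 * x) *\<^sub>R mat 1) h = ell2_pop h + ell2_push h (- ell2_nth h 0)"
  unfolding fold_symbol_eq[OF even_operator_cos]
proof (rule ell2_eqI)
  fix i
  show "ell2_nth (half_restrict (ell2_shift 1 (odd_extend h) + ell2_shift (- 1) (odd_extend h))) i
      = ell2_nth (ell2_pop h + ell2_push h (- ell2_nth h 0)) i"
    by (cases i) (simp_all add: ell2_shift.rep_eq odd_extend_def nat_add_distrib)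
qed

context
  fixes b :: "real \<Rightarrow> complex ^ 'n ^ 'n::finite"
  assumes b: "continuous_on {-1..1} b"
begin

text \<open>Even operators preserve oddness, so that restricting and extending again between the two
  factors changes nothing.\<close>

lemma fold_symbol_mult:
  assumes c: "continuous_on {-1..1} c"
  shows "fold_symbol (\<lambda>x. b x ** c x) h = fold_symbol b (fold_symbol c h)"
proof -
  obtain M N where M: "even_operator b M" and N: "even_operator c N"
    using even_operator_exists[OF b] even_operator_exists[OF c] by blast
  show ?thesis
    by (simp add: fold_symbol_eq[OF even_operator_mult[OF M N]] fold_symbol_eq[OF M] fold_symbol_eq[OF N]
        odd_extend_half_restrict even_operator_odd[OF N] flip_odd_extend)
qed

lemma fold_symbol_add:
  assumes c: "continuous_on {-1..1} c"
  shows "fold_symbol (\<lambda>x. b x + c x) h = fold_symbol b h + fold_symbol c h"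
proof -
  obtain M N where M: "even_operator b M" and N: "even_operator c N"
    using even_operator_exists[OF b] even_operator_exists[OF c] by blast
  show ?thesis
    by (simp add: fold_symbol_eq[OF even_operator_add[OF M N]] fold_symbol_eq[OF M] fold_symbol_eq[OF N]
        linear_half_restrict)
qed

lemma fold_symbol_scale: "fold_symbol b (ell2_scale a h) = ell2_scale a (fold_symbol b h)"
proof -
  obtain M where M: "even_operator b M" using even_operator_exists[OF b] by blast
  then show ?thesis
    by (simp add: fold_symbol_eq[OF M] linear_odd_extend linear_half_restrict even_operator_def)
qed

lemma fold_symbol_norm_le:
  assumes B: "\<And>x v. x \<in> {-1..1} \<Longrightarrow> norm (b x *v v) \<le> B * norm v" "0 \<le> B"
  shows "norm (fold_symbol b h) \<le> B * norm h"
proof -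
  obtain M where M: "even_operator b M" using even_operator_exists[OF b] by blast
  let ?f = "odd_extend h"
  have "norm (M ?f) \<le> B * norm ?f" by (rule even_operator_norm_le[OF M B])
  then have "(norm (M ?f))\<^sup>2 \<le> (B * norm ?f)\<^sup>2" by (intro power_mono) auto
  moreover have "(norm (M ?f))\<^sup>2 = 2 * (norm (fold_symbol b h))\<^sup>2"
    unfolding fold_symbol_eq[OF M] by (intro norm_half_restrict_odd even_operator_odd[OF M] flip_odd_extend)
  moreover have "(norm ?f)\<^sup>2 = 2 * (norm h)\<^sup>2"
    using norm_half_restrict_odd[OF flip_odd_extend, of h] by simp
  ultimately have "(norm (fold_symbol b h))\<^sup>2 \<le> (B * norm h)\<^sup>2" by (simp add: power_mult_distrib)
  then show ?thesis using B(2) by (simp add: power2_le_iff_abs_le)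
qed

lemma bounded_linear_fold_symbol: "bounded_linear (fold_symbol b)"
proof -
  obtain M where M: "even_operator b M" using even_operator_exists[OF b] by blast
  then have bl: "bounded_linear M" by (simp add: even_operator_def multiplier_def)
  obtain B where B: "B > 0" "\<And>x v. x \<in> {-1..1} \<Longrightarrow> norm (b x *v v) \<le> B * norm v"
    using symbol_bound[OF b] by blast
  show ?thesis
  proof (rule bounded_linear_intro[of _ B])
    show "norm (fold_symbol b h) \<le> norm h * B" for h
      using fold_symbol_norm_le[OF B(2)] B(1) by (simp add: mult.commute)
  qed (simp_all add: fold_symbol_eq[OF M] linear_odd_extend linear_half_restrict linear_simps[OF bl])
qed

end

lemma inner_ell2_ii: "ell2_scale \<i> f \<bullet> g = - (f \<bullet> ell2_scale \<i> (g :: ('i, complex ^ 'n::finite) ell2))"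
  by (simp add: inner_ell2_def inner_ii_left infsum_uminus)

text \<open>
  Folding is a unital homomorphism that does not increase norms. Hence \<open>1 + i t b\<close> with \<open>b\<close>
  self-adjoint has norm at most \<open>1 + O(t\<^sup>2)\<close>, which forces the folded operator to be self-adjoint,
  and \<open>1 - t b\<close> with \<open>b\<close> nonnegative has the same property, which forces it to be nonnegative.
\<close>

lemma fold_symbol_one_plus:
  fixes b :: "real \<Rightarrow> complex ^ 'n ^ 'n::finite"
  assumes b: "continuous_on {-1..1} b"
    and ge: "\<And>x v. x \<in> {-1..1} \<Longrightarrow> v \<bullet> (c *s (b x *v v)) \<le> 0"
    and B: "\<And>x v. x \<in> {-1..1} \<Longrightarrow> norm (b x *v v) \<le> B * norm v"
  shows "2 * (h \<bullet> ell2_scale c (fold_symbol b h)) \<le> (norm c)\<^sup>2 * B\<^sup>2 * (norm h)\<^sup>2"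
proof -
  let ?C = "c *\<^sub>M mat 1 :: complex ^ 'n ^ 'n"
  let ?d = "\<lambda>x. ?C ** b x" and ?b = "\<lambda>x. mat 1 + ?C ** b x"
  have d: "continuous_on {-1..1} ?d"
    unfolding matrix_matrix_mult_def by (intro continuous_intros b)
  have cont: "continuous_on {-1..1} ?b" by (intro continuous_intros d)
  have C: "?C *v v = c *s v" for v by (simp add: cscale_matrix_vector)
  have id: "ell2_map ((*v) (mat 1 :: complex ^ 'n ^ 'n)) h = h" for h :: "(nat, complex ^ 'n) ell2"
    by (rule ell2_eqI) (simp add: ell2_nth_map bounded_linear_matrix_vector_mult)
  have scale: "ell2_map ((*v) ?C) h = ell2_scale c h" for h :: "(nat, complex ^ 'n) ell2"
    by (rule ell2_eqI) (simp add: ell2_nth_map bounded_linear_matrix_vector_mult C)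
  have eq: "fold_symbol ?b h = h + ell2_scale c (fold_symbol b h)"
    using fold_symbol_add[OF continuous_on_const[of _ "mat 1"] d, of h] fold_symbol_mult[OF continuous_on_const[of _ ?C] b, of h]
    by (simp add: fold_symbol_const id scale)
  \<comment> \<open>The cross term is nonpositive by \<open>ge\<close>; only the term of second
    order in \<open>c\<close> remains.\<close>
  let ?r = "sqrt (1 + (norm c)\<^sup>2 * B\<^sup>2)"
  have "norm (fold_symbol ?b h) \<le> ?r * norm h"
  proof (rule fold_symbol_norm_le[OF cont])
    fix x :: real and v :: "complex ^ 'n" assume x: "x \<in> {-1..1}"
    have "?b x *v v = v + c *s (b x *v v)"
      by (simp add: matrix_vector_mult_add_rdistrib matrix_vector_mul_assoc[symmetric] C)
    then have "(norm (?b x *v v))\<^sup>2 = (norm v)\<^sup>2 + 2 * (v \<bullet> (c *s (b x *v v))) + (norm c * norm (b x *v v))\<^sup>2"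
      unfolding norm_vector_scalar_mult[symmetric]
      by (simp add: power2_norm_eq_inner inner_add_left inner_add_right inner_commute)
    also have "\<dots> \<le> (norm v)\<^sup>2 + 2 * 0 + (norm c * (B * norm v))\<^sup>2"
      using ge[OF x, of v] B[OF x, of v] by (intro add_mono power_mono mult_left_mono) auto
    also have "\<dots> = (?r * norm v)\<^sup>2"
      by (simp add: power_mult_distrib distrib_right)
    finally show "norm (?b x *v v) \<le> ?r * norm v" by (rule power2_le_imp_le) simp
  qed simp
  then have "(norm (fold_symbol ?b h))\<^sup>2 \<le> (?r * norm h)\<^sup>2" by (intro power_mono) auto
  also have "\<dots> = (norm h)\<^sup>2 + (norm c)\<^sup>2 * B\<^sup>2 * (norm h)\<^sup>2" by (simp add: power_mult_distrib distrib_right)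
  finally have "(norm h)\<^sup>2 + 2 * (h \<bullet> ell2_scale c (fold_symbol b h)) + (norm (ell2_scale c (fold_symbol b h)))\<^sup>2
      \<le> (norm h)\<^sup>2 + (norm c)\<^sup>2 * B\<^sup>2 * (norm h)\<^sup>2"
    unfolding eq by (simp add: power2_norm_eq_inner inner_add_left inner_add_right inner_commute)
  then show ?thesis using zero_le_power2[of "norm (ell2_scale c (fold_symbol b h))"] by linarith
qed

text \<open>After division by \<open>t\<close> the choice \<open>t = e / (C + 1)\<close> leaves at
  most \<open>e\<close>; the added 1 covers \<open>C = 0\<close>.\<close>

lemma small_slope_zero:
  fixes a :: real
  assumes "\<And>t. t > 0 \<Longrightarrow> t * a \<le> t\<^sup>2 * C" and C: "0 \<le> C"
  shows "a \<le> 0"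
proof (rule field_le_epsilon)
  fix e :: real assume e: "e > 0"
  define t where "t = e / (C + 1)"
  have t: "t > 0" using e C by (simp add: t_def)
  have "t * a \<le> t * (t * C)" using assms(1)[OF t] by (simp add: power2_eq_square mult.assoc)
  then have "a \<le> t * C" using t by simp
  also have "\<dots> \<le> e" using e C by (simp add: t_def field_simps)
  finally show "a \<le> 0 + e" by simp
qed

lemma ell2_scale_of_real:
  "ell2_scale (complex_of_real t * c) (h :: ('i, complex ^ 'n::finite) ell2) = t *\<^sub>R ell2_scale c h"
  by (rule ell2_eqI) (simp add: vec_eq_iff scaleR_conv_of_real[where 'a = complex])

lemma fold_symbol_nonneg:
  fixes b :: "real \<Rightarrow> complex ^ 'n ^ 'n::finite"
  assumes b: "continuous_on {-1..1} b" and pos: "\<And>x v. x \<in> {-1..1} \<Longrightarrow> 0 \<le> op_form ((*v) (b x)) v"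
  shows "0 \<le> op_form (fold_symbol b) h"
proof -
  obtain B where B: "B > 0" "\<And>x v. x \<in> {-1..1} \<Longrightarrow> norm (b x *v v) \<le> B * norm v"
    using symbol_bound[OF b] by blast
  have "t * (- 2 * op_form (fold_symbol b) h) \<le> t\<^sup>2 * (B\<^sup>2 * (norm h)\<^sup>2)" if t: "t > 0" for t
  proof -
    have s: "(complex_of_real t * (- 1)) *s v = - (t *\<^sub>R v)" for v :: "complex ^ 'n"
      by (simp add: vec_eq_iff scaleR_conv_of_real[where 'a = complex])
    have "v \<bullet> ((complex_of_real t * (- 1)) *s (b x *v v)) \<le> 0" if "x \<in> {-1..1}" for x v
      unfolding s using pos[OF that, of v] t by (simp add: op_form_def)
    from fold_symbol_one_plus[OF b this B(2), of h]
    have "2 * (h \<bullet> ell2_scale (complex_of_real t * (- 1)) (fold_symbol b h)) \<le> t\<^sup>2 * (B\<^sup>2 * (norm h)\<^sup>2)"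
      by (simp add: norm_mult mult.assoc)
    moreover have "ell2_scale (- 1) x = - x" for x :: "(nat, complex ^ 'n) ell2"
      by (rule ell2_eqI) (simp add: vec_eq_iff)
    ultimately show ?thesis unfolding ell2_scale_of_real by (simp add: op_form_def)
  qed
  then have "- 2 * op_form (fold_symbol b) h \<le> 0"
    by (rule small_slope_zero) simp_all
  then show ?thesis by simp
qed

lemma fold_symbol_symmetric:
  fixes b :: "real \<Rightarrow> complex ^ 'n ^ 'n::finite"
  assumes b: "continuous_on {-1..1} b" and sa: "\<And>x. x \<in> {-1..1} \<Longrightarrow> self_adjoint_matrix (b x)"
  shows "symmetric_op (fold_symbol b)"
proof -
  let ?H = "fold_symbol b"
  note bl = bounded_linear_fold_symbol[OF b]
  obtain B where B: "B > 0" "\<And>x v. x \<in> {-1..1} \<Longrightarrow> norm (b x *v v) \<le> B * norm v"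
    using symbol_bound[OF b] by blast
  \<comment> \<open>The two signs of \<open>\<sigma>\<close> belong to \<open>1 + i t b\<close> and
    \<open>1 - i t b\<close>; its absolute value 2 matches the factor 2 in
    \<open>fold_symbol_one_plus\<close>.\<close>
  have le: "\<sigma> * (h \<bullet> ell2_scale \<i> (?H h)) \<le> 0" if \<sigma>: "\<bar>\<sigma>\<bar> = 2" for \<sigma> h
  proof (rule small_slope_zero)
    fix t :: real assume t: "t > 0"
    let ?c = "complex_of_real (t * \<sigma> / 2) * \<i>"
    have "v \<bullet> (?c *s (b x *v v)) \<le> 0" if "x \<in> {-1..1}" for x v
      unfolding self_adjoint_inner_scale[OF sa[OF that]] by simp
    from fold_symbol_one_plus[OF b this B(2), of h]
    show "t * (\<sigma> * (h \<bullet> ell2_scale \<i> (?H h))) \<le> t\<^sup>2 * (B\<^sup>2 * (norm h)\<^sup>2)"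
      unfolding ell2_scale_of_real using \<sigma> t by (simp add: norm_mult abs_mult mult_ac)
  qed simp
  have zero: "h \<bullet> ell2_scale \<i> (?H h) = 0" for h using le[of 2 h] le[of "- 2" h] by simp
  have add: "ell2_scale \<i> (f + g) = ell2_scale \<i> f + ell2_scale \<i> g" for f g :: "(nat, complex ^ 'n) ell2"
    by (rule ell2_eqI) (simp add: vec.scale_right_distrib)
  \<comment> \<open>Polarization of the vanishing form; inserting \<open>ell2_scale \<i> h\<close>
    for \<open>h\<close> then turns it into symmetry of the folded operator.\<close>
  have bil: "g \<bullet> ell2_scale \<i> (?H h) = - (h \<bullet> ell2_scale \<i> (?H g))" for g h
    using zero[of "g + h"] zero[of g] zero[of h]
    by (simp add: linear_simps(1)[OF bl] add inner_add_left inner_add_right)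
  have ii: "ell2_scale \<i> (ell2_scale \<i> h) = - h" for h :: "(nat, complex ^ 'n) ell2"
    by (rule ell2_eqI) (simp add: vec_eq_iff)
  have "?H h \<bullet> g = h \<bullet> ?H g" for g h
  proof -
    have "g \<bullet> ?H h = - (g \<bullet> ell2_scale \<i> (?H (ell2_scale \<i> h)))"
      by (simp add: fold_symbol_scale[OF b] ii)
    also have "\<dots> = ell2_scale \<i> h \<bullet> ell2_scale \<i> (?H g)" using bil[of g "ell2_scale \<i> h"] by simp
    also have "\<dots> = h \<bullet> ?H g" by (simp add: inner_ell2_ii ii)
    finally show ?thesis by (simp add: inner_commute)
  qed
  with bl show ?thesis by (simp add: symmetric_op_def)
qed

section \<open>Dihedral faces\<close>

lemma face_map_dihedral:
  "face_map (dihedral_blocks T A U) (s, n, w, e) =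
     (T *v s + A *v n + U *v (w + e), A *v s + T *v n + U *v (w + e),
      U *v (s + n) + T *v w + A *v e, U *v (s + n) + A *v w + T *v e)"
  by (simp add: face_map_def dihedral_blocks_def matrix_vector_right_distrib doubleton_eq_iff add.assoc)

lemma to_complex_sum: "to_complex (\<Sum>i\<in>I. f i) = (\<Sum>i\<in>I. to_complex (f i :: 'k::real_or_complex))"
  by (induction I rule: infinite_finite_induct) (simp_all add: to_complex_add)

lemma to_complex_matrix_vector:
  "to_complex_vec (M *v x) = map_matrix to_complex M *v to_complex_vec (x :: 'k::real_or_complex ^ 'n::finite)"
  by (simp add: to_complex_vec_def map_matrix_def matrix_vector_mult_def vec_eq_iff to_complex_sum to_complex_mult)

lemma to_complex_vec_add: "to_complex_vec (x + y) = to_complex_vec x + to_complex_vec y"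
  by (simp add: to_complex_vec_def vec_eq_iff to_complex_add)

lemma to_complex_dihedral:
  "to_complex_blocks (dihedral_blocks T A U) =
     dihedral_blocks (map_matrix to_complex T) (map_matrix to_complex A) (map_matrix to_complex U)"
  by (simp add: to_complex_blocks_def dihedral_blocks_def fun_eq_iff)

lemma face_map_to_complex:
  "face_map (to_complex_blocks Q) (to_complex_vec s, to_complex_vec n, to_complex_vec w, to_complex_vec e) =
     map_prod to_complex_vec (map_prod to_complex_vec (map_prod to_complex_vec to_complex_vec))
       (face_map Q (s, n, w, e))"
  by (simp add: face_map_def Let_def to_complex_blocks_def to_complex_matrix_vector to_complex_vec_add)

lemma inner_to_complex_vec: "to_complex_vec x \<bullet> to_complex_vec y = x \<bullet> (y :: 'k::real_or_complex ^ 'n)"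
  by (simp add: to_complex_vec_def inner_vec_def inner_to_complex)

text \<open>
  A complex vector is \<open>x + i y\<close> with \<open>x, y\<close> in the image of \<open>to_complex_vec\<close>; if the scalars are
  complex already, \<open>y = 0\<close> is chosen, so that the mixed inner products vanish in both cases.
\<close>

definition scalar_parts :: "'k::real_or_complex itself \<Rightarrow> complex ^ 'n \<Rightarrow> 'k ^ 'n \<Rightarrow> 'k ^ 'n \<Rightarrow> bool" where
  "scalar_parts _ z x y \<longleftrightarrow> z = to_complex_vec x + \<i> *s to_complex_vec y \<and>
     (range (to_complex :: 'k \<Rightarrow> complex) = \<real> \<or> y = 0)"

lemma scalar_parts_exist: "\<exists>x y. scalar_parts TYPE('k::real_or_complex) (z :: complex ^ 'n) x y"
proof (cases "range (to_complex :: 'k \<Rightarrow> complex) = \<real>")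
  case True
  then have "\<exists>a. to_complex (a :: 'k) = of_real r" for r by (metis Reals_of_real rangeE)
  then obtain g where g: "\<And>r. to_complex (g r :: 'k) = of_real r" by metis
  have "z = to_complex_vec (\<chi> i. g (Re (z $ i))) + \<i> *s to_complex_vec (\<chi> i. g (Im (z $ i)))"
    by (simp add: to_complex_vec_def vec_eq_iff g complex_eq)
  then show ?thesis using True unfolding scalar_parts_def by blast
next
  case False
  then have "range (to_complex :: 'k \<Rightarrow> complex) = UNIV" using range_to_complex by blast
  then have "\<forall>r. \<exists>a. to_complex (a :: 'k) = r"
    by (metis surjD)
  then obtain g where g: "\<And>r. to_complex (g r :: 'k) = r" by metis
  have "z = to_complex_vec (\<chi> i. g (z $ i)) + \<i> *s to_complex_vec (0 :: 'k ^ 'n)"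
    by (simp add: to_complex_vec_def vec_eq_iff g)
  then show ?thesis unfolding scalar_parts_def by blast
qed

lemma to_complex_vec_0 [simp]: "to_complex_vec 0 = 0"
  by (simp add: to_complex_vec_def vec_eq_iff)

lemma inner_ii_ii: "(\<i> *s x) \<bullet> (\<i> *s y) = x \<bullet> (y :: complex ^ 'n::finite)"
  by (simp add: inner_vec_def inner_complex_def add.commute)

lemma inner_mixed:
  fixes a b :: "'k::real_or_complex ^ 'n::finite"
  assumes "range (to_complex :: 'k \<Rightarrow> complex) = \<real> \<or> b = 0"
  shows "to_complex_vec a \<bullet> (\<i> *s to_complex_vec b) = 0" "(\<i> *s to_complex_vec b) \<bullet> to_complex_vec a = 0"
proof -
  show "to_complex_vec a \<bullet> (\<i> *s to_complex_vec b) = 0"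
    using assms
  proof
    assume r: "range (to_complex :: 'k \<Rightarrow> complex) = \<real>"
    have "Im (to_complex x) = 0" for x :: 'k using r by (metis complex_is_Real_iff rangeI)
    then show ?thesis by (simp add: inner_vec_def inner_complex_def to_complex_vec_def)
  qed simp
  then show "(\<i> *s to_complex_vec b) \<bullet> to_complex_vec a = 0" by (simp add: inner_commute)
qed

lemma inner_scalar_parts:
  assumes "scalar_parts TYPE('k::real_or_complex) z x y" "scalar_parts TYPE('k) z' x' y'"
  shows "z \<bullet> z' = x \<bullet> x' + y \<bullet> (y' :: 'k ^ 'n::finite)"
  using assms
  by (auto simp: scalar_parts_def inner_add_left inner_add_right inner_mixed inner_ii_ii inner_to_complex_vec)

lemma scalar_parts_add:
  assumes "scalar_parts TYPE('k::real_or_complex) z x y" "scalar_parts TYPE('k) z' x' y'"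
  shows "scalar_parts TYPE('k) (z + z') (x + x') (y + y')"
  using assms by (auto simp: scalar_parts_def to_complex_vec_add vec.scale_right_distrib)

lemma scalar_parts_matrix:
  fixes M :: "'k::real_or_complex ^ 'n ^ 'n::finite"
  assumes "scalar_parts TYPE('k) z x y"
  shows "scalar_parts TYPE('k) (map_matrix to_complex M *v z) (M *v x) (M *v y)"
  using assms
  by (auto simp: scalar_parts_def to_complex_matrix_vector matrix_vector_right_distrib vector_scalar_commute)

text \<open>The form of the complexified face is the sum of the forms of \<open>Q\<close> at the two
  parts of the vector, so that symmetry and positivity carry over.\<close>

lemma face_operator_to_complex:
  fixes Q :: "('k::real_or_complex, 'n::finite) blocks"
  assumes Q: "face_operator Q"
  shows "face_operator (to_complex_blocks Q)"
proof -
  let ?sp = "scalar_parts TYPE('k)"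
  have parts: "?sp z x y \<Longrightarrow> ?sp z' x' y' \<Longrightarrow> ?sp z'' x'' y'' \<Longrightarrow> ?sp z3 x3 y3 \<Longrightarrow>
      ?sp (to_complex_blocks Q a South *v z + to_complex_blocks Q a North *v z' +
          to_complex_blocks Q a West *v z'' + to_complex_blocks Q a East *v z3)
        (Q a South *v x + Q a North *v x' + Q a West *v x'' + Q a East *v x3)
        (Q a South *v y + Q a North *v y' + Q a West *v y'' + Q a East *v y3)" for a z z' z'' z3 x x' x'' x3 y y' y'' y3
    unfolding to_complex_blocks_def by (intro scalar_parts_add scalar_parts_matrix)
  have form: "\<exists>x y x' y'. face_map (to_complex_blocks Q) z \<bullet> z' = face_map Q x \<bullet> x' + face_map Q y \<bullet> y' \<and>
      z \<bullet> face_map (to_complex_blocks Q) z' = x \<bullet> face_map Q x' + y \<bullet> face_map Q y' \<and>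
      (z \<noteq> 0 \<longrightarrow> x \<noteq> 0 \<or> y \<noteq> 0) \<and> (z = z' \<longrightarrow> x = x' \<and> y = y')" for z z'
  proof -
    \<comment> \<open>The parts are chosen as functions of the vector, so that equal vectors get
      equal parts; positivity compares a vector with itself.\<close>
    obtain px py where "\<And>z :: complex ^ 'n. ?sp z (px z) (py z)"
      using scalar_parts_exist[where 'k = 'k and 'n = 'n] by metis
    then obtain p where p: "\<And>z :: complex ^ 'n. ?sp z (fst (p z)) (snd (p z))"
      using that[of "\<lambda>z. (px z, py z)"] by simp
    obtain s n w e where z: "z = (s, n, w, e)" by (metis surj_pair)
    obtain s' n' w' e' where z': "z' = (s', n', w', e')" by (metis surj_pair)
    let ?x = "\<lambda>f. (f (p s), f (p n), f (p w), f (p e))" and ?x' = "\<lambda>f. (f (p s'), f (p n'), f (p w'), f (p e'))"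
    have "z \<noteq> 0 \<longrightarrow> ?x fst \<noteq> 0 \<or> ?x snd \<noteq> 0"
      using p[of s] p[of n] p[of w] p[of e] unfolding z scalar_parts_def zero_prod_def by auto
    moreover have "face_map (to_complex_blocks Q) z \<bullet> z' = face_map Q (?x fst) \<bullet> ?x' fst + face_map Q (?x snd) \<bullet> ?x' snd"
      unfolding z z' by (simp add: face_map_def Let_def inner_prod_def inner_scalar_parts[OF parts[OF p p p p] p])
    moreover have "z \<bullet> face_map (to_complex_blocks Q) z' = ?x fst \<bullet> face_map Q (?x' fst) + ?x snd \<bullet> face_map Q (?x' snd)"
      unfolding z z' by (simp add: face_map_def Let_def inner_prod_def inner_scalar_parts[OF p parts[OF p p p p]])
    moreover have "z = z' \<longrightarrow> ?x fst = ?x' fst \<and> ?x snd = ?x' snd" unfolding z z' by simp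
    ultimately show ?thesis by blast
  qed
  have sym: "face_map Q x \<bullet> y = x \<bullet> face_map Q y" for x y using Q unfolding face_operator_def by blast
  have nonneg: "0 \<le> x \<bullet> face_map Q x" for x
    using coercive_nonneg[OF coercive_face_map[OF Q], of x] by (simp only: op_form_def)
  show ?thesis
    unfolding face_operator_def
  proof (intro conjI allI impI)
    fix z z' :: "(complex, 'n) face_space"
    show "face_map (to_complex_blocks Q) z \<bullet> z' = z \<bullet> face_map (to_complex_blocks Q) z'"
      using form[of z z'] sym by metis
  next
    fix z :: "(complex, 'n) face_space"
    assume "z \<noteq> 0"
    then obtain x y where xy: "z \<bullet> face_map (to_complex_blocks Q) z = x \<bullet> face_map Q x + y \<bullet> face_map Q y" "x \<noteq> 0 \<or> y \<noteq> 0"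
      using form[of z z] by blast
    have pos: "x \<noteq> 0 \<Longrightarrow> 0 < x \<bullet> face_map Q x" for x using Q unfolding face_operator_def by blast
    show "0 < z \<bullet> face_map (to_complex_blocks Q) z"
      using xy(2) pos[of x] pos[of y] nonneg[of x] nonneg[of y] unfolding xy(1)
      by (auto intro: add_pos_nonneg add_nonneg_pos)
  qed
qed

context
  fixes T A U :: "'k::real_or_complex ^ 'n ^ 'n::finite" and Q :: "('k, 'n) blocks"
  assumes Q: "face_operator Q" and dihedral: "Q = dihedral_blocks T A U"
begin

text \<open>Reflection in the diagonal exchanges South with West and North with East and preserves
  the face, so that the two half-strip equations are literally the same.\<close>

lemma dihedral_west_south:
  "transport (\<lambda>(s, n, w, e). ((w, e, n), s)) (face_map Q) = transport (\<lambda>(s, n, w, e). ((s, n, e), w)) (face_map Q)"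
proof
  fix z :: "(('k ^ 'n) \<times> ('k ^ 'n) \<times> ('k ^ 'n)) \<times> ('k ^ 'n)"
  obtain a b c d where z: "z = ((a, b, c), d)" by (metis surj_pair)
  show "transport (\<lambda>(s, n, w, e). ((w, e, n), s)) (face_map Q) z
      = transport (\<lambda>(s, n, w, e). ((s, n, e), w)) (face_map Q) z"
    using transport_apply[OF unitary_bij[OF unitary_rearrange(3)], of "face_map Q" "(d, c, a, b)"]
      transport_apply[OF unitary_bij[OF unitary_rearrange(2)], of "face_map Q" "(a, b, d, c)"]
    by (simp add: z dihedral face_map_dihedral add.commute add.left_commute)
qed

lemma is_south_fixed_point_eq: "is_south_fixed_point Q M \<longleftrightarrow> is_west_fixed_point Q M"
  unfolding is_south_fixed_point_def is_west_fixed_point_def dihedral_west_south ..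

lemma strip_fixed_points: "west_fixed_point Q = strip_op Q" "south_fixed_point Q = strip_op Q"
proof -
  have "is_west_fixed_point Q = (\<lambda>M. M = strip_op Q)" "is_south_fixed_point Q = (\<lambda>M. M = strip_op Q)"
    by (simp_all add: fun_eq_iff is_south_fixed_point_eq is_west_fixed_point_iff[OF Q])
  then show "west_fixed_point Q = strip_op Q" "south_fixed_point Q = strip_op Q"
    by (simp_all add: west_fixed_point_def south_fixed_point_def)
qed

lemma dihedral_form_sym: "op_form (face_map Q) (a, b, c, d) = op_form (face_map Q) (c, d, a, b)"
  by (simp add: op_form_def dihedral face_map_dihedral inner_prod_def add_ac)

lemma dihedral_corner_iff: "is_corner_fixed_point Q C \<longleftrightarrow> C = half_line_op (corner_step (strip_op Q))"
  by (rule is_corner_fixed_point_iff[OF Q strip_fixed_points dihedral_form_sym])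

text \<open>Exchanging the two half-lines turns the North equation of the corner into the East
  equation, which determines the corner.\<close>

lemma dihedral_corner_swap:
  "transport prod.swap (half_line_op (corner_step (strip_op Q))) = half_line_op (corner_step (strip_op Q))"
    (is "?C' = ?C")
proof (rule corner_form_unique[OF coercive_strip_op[OF Q]])
  note S = coercive_strip_op[OF Q] and C = coercive_corner_op[OF coercive_strip_op[OF Q]]
  show "coercive ?C'" by (intro coercive_transport unitary_rearrange C)
  have "is_corner_fixed_point Q ?C" by (simp add: dihedral_corner_iff)
  then have "transport (\<lambda>(g, (f, a)). (f, ell2_push g a))
      (glue (transport prod.swap ?C) (transport (\<lambda>((s, n), e). ((n, e), s)) (strip_op Q))) = ?C"
    unfolding is_corner_fixed_point_def strip_fixed_points by blast
  then have "is_min (op_form ?C (f, ell2_push g a)) (\<lambda>h. op_form ?C (h, g) + op_form (strip_op Q) ((h, f), a))" for f g a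
    using corner_equation_iff'[OF S coercive_symmetric[OF C] C] by blast
  then show "is_min (op_form ?C' (ell2_push f a, g)) (\<lambda>v. op_form ?C' (f, v) + op_form (strip_op Q) ((v, g), a))" for f a g
    unfolding op_form_rearrange .
qed

lemma self_adjoint_dihedral: "self_adjoint_matrix T" "self_adjoint_matrix A" "self_adjoint_matrix U"
proof -
  have sym: "face_map Q x \<bullet> y = x \<bullet> face_map Q y" for x y using Q unfolding face_operator_def by blast
  show "self_adjoint_matrix T" "self_adjoint_matrix A" "self_adjoint_matrix U"
    unfolding self_adjoint_matrix_def
    using sym[of "(x, 0, 0, 0)" "(y, 0, 0, 0)" for x y] sym[of "(x, 0, 0, 0)" "(0, y, 0, 0)" for x y]
      sym[of "(x, 0, 0, 0)" "(0, 0, y, 0)" for x y]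
    by (simp_all add: dihedral face_map_dihedral inner_prod_def)
qed

lemma op_form_dihedral:
  "op_form (face_map Q) (s, n, w, e) =
     op_form (line_op ((*v) T) ((*v) A)) (s, n) + op_form (line_op ((*v) T) ((*v) A)) (w, e) +
     2 * ((s + n) \<bullet> (U *v (w + e)))"
proof -
  have "w \<bullet> (U *v (s + n)) + e \<bullet> (U *v (s + n)) = s \<bullet> (U *v (w + e)) + n \<bullet> (U *v (w + e))"
    using self_adjoint_dihedral(3) inner_commute[of "w + e" "U *v (s + n)"]
    by (simp only: self_adjoint_matrix_def inner_add_left[symmetric])
  then show ?thesis
    by (simp add: op_form_def dihedral face_map_dihedral inner_prod_def line_op_def inner_add_left
        inner_add_right)
qed

end

section \<open>Strip symbols\<close>

text \<open>
  With \<open>u\<close> on the unit circle and \<open>x = Re u\<close>, \<open>strip_phi T A x\<close> is $\phi^{WE}(u) = \phi^{SN}(u)$, and both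
  strip functions have the diagonal block \<open>strip_T T A U x\<close> and the off-diagonal block \<open>strip_A T A U x\<close>.
\<close>

definition strip_phi :: "complex ^ 'n ^ 'n \<Rightarrow> complex ^ 'n ^ 'n \<Rightarrow> real \<Rightarrow> complex ^ 'n ^ 'n::finite" where
  "strip_phi T A x = 2 *\<^sub>R T + (2 * x) *\<^sub>R A"

definition strip_inv :: "complex ^ 'n ^ 'n \<Rightarrow> complex ^ 'n ^ 'n \<Rightarrow> real \<Rightarrow> complex ^ 'n ^ 'n::finite" where
  "strip_inv T A x = matrix_inv (strip_phi T A x)"

text \<open>The correction that both strip functions subtract; on the circle
  \<open>(1 + u) (1 + 1/u) = 2 + 2 * x\<close>. The scalar factor is written as a matrix, so that
  folding can be applied factor by factor.\<close>

definition strip_D ::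
    "complex ^ 'n ^ 'n \<Rightarrow> complex ^ 'n ^ 'n \<Rightarrow> complex ^ 'n ^ 'n \<Rightarrow> real \<Rightarrow> complex ^ 'n ^ 'n::finite" where
  "strip_D T A U x = U ** ((2 *\<^sub>R mat 1 + (2 * x) *\<^sub>R mat 1) ** (strip_inv T A x ** U))"

definition strip_T ::
    "complex ^ 'n ^ 'n \<Rightarrow> complex ^ 'n ^ 'n \<Rightarrow> complex ^ 'n ^ 'n \<Rightarrow> real \<Rightarrow> complex ^ 'n ^ 'n::finite" where
  "strip_T T A U x = T - strip_D T A U x"

definition strip_A ::
    "complex ^ 'n ^ 'n \<Rightarrow> complex ^ 'n ^ 'n \<Rightarrow> complex ^ 'n ^ 'n \<Rightarrow> real \<Rightarrow> complex ^ 'n ^ 'n::finite" where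
  "strip_A T A U x = A - strip_D T A U x"

text \<open>Chosen as a Riccati solution, not as \<open>W_left\<close> of the strip: continuity can
  then be shown without eigenvectors, and the two are identified afterwards in
  \<open>W_hat_dihedral\<close>.\<close>

definition strip_W ::
    "complex ^ 'n ^ 'n \<Rightarrow> complex ^ 'n ^ 'n \<Rightarrow> complex ^ 'n ^ 'n \<Rightarrow> real \<Rightarrow> complex ^ 'n ^ 'n::finite" where
  "strip_W T A U x = (SOME W. \<exists>G. riccati (strip_T T A U x) (strip_A T A U x) G W)"

definition strip_G ::
    "complex ^ 'n ^ 'n \<Rightarrow> complex ^ 'n ^ 'n \<Rightarrow> complex ^ 'n ^ 'n \<Rightarrow> real \<Rightarrow> complex ^ 'n ^ 'n::finite" where
  "strip_G T A U x = strip_T T A U x + strip_A T A U x ** strip_W T A U x"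

lemma norm_matrix_le:
  fixes M :: "complex ^ 'n ^ 'm::finite"
  assumes "\<And>v. norm (M *v v) \<le> c * norm v"
  shows "norm M \<le> real CARD('m) * real CARD('n::finite) * c"
proof -
  have c: "norm (M $ i $ j) \<le> c" for i j
  proof -
    have "M $ i $ j = (M *v axis j 1) $ i"
      by (simp add: matrix_vector_mult_def axis_def if_distrib cong: if_cong)
    then have "norm (M $ i $ j) \<le> norm (M *v axis j 1)"
      by (metis Finite_Cartesian_Product.norm_nth_le)
    also have "\<dots> \<le> c" using assms[of "axis j 1"] by (simp add: norm_axis_1)
    finally show ?thesis .
  qed
  have "norm M \<le> (\<Sum>i\<in>UNIV. norm (M $ i))" unfolding norm_vec_def[of M] by (rule L2_set_le_sum) simp
  also have "\<dots> \<le> (\<Sum>i\<in>(UNIV :: 'm set). \<Sum>j\<in>(UNIV :: 'n set). c)"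
  proof (rule sum_mono)
    fix i
    have "norm (M $ i) \<le> (\<Sum>j\<in>UNIV. norm (M $ i $ j))"
      unfolding norm_vec_def[of "M $ i"] by (rule L2_set_le_sum) simp
    also have "\<dots> \<le> (\<Sum>j\<in>(UNIV :: 'n set). c)" by (intro sum_mono c)
    finally show "norm (M $ i) \<le> (\<Sum>j\<in>(UNIV :: 'n set). c)" .
  qed
  finally show ?thesis by (simp add: mult.assoc)
qed

lemma continuous_on_matrix_matrix [continuous_intros]:
  fixes M N :: "'a::topological_space \<Rightarrow> complex ^ 'n ^ 'n::finite"
  shows "continuous_on S M \<Longrightarrow> continuous_on S N \<Longrightarrow> continuous_on S (\<lambda>x. M x ** N x)"
  unfolding matrix_matrix_mult_def by (intro continuous_intros)

text \<open>A function with values in a compact set and with a closed graph is continuous. The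
  relation \<open>P\<close> serves to describe the graph by visibly closed conditions.\<close>

lemma continuous_on_matrix_closed_graph:
  fixes f :: "real \<Rightarrow> complex ^ 'n ^ 'n::finite"
  assumes bound: "\<And>x v. x \<in> {-1..1} \<Longrightarrow> norm (f x *v v) \<le> c * norm v"
    and P: "\<And>x y. x \<in> {-1..1} \<Longrightarrow> P x y \<longleftrightarrow> y = f x" and closed: "closed {z \<in> {-1..1} \<times> UNIV. P (fst z) (snd z)}"
  shows "continuous_on {-1..1} f"
proof (rule continuous_from_closed_graph)
  show "compact (cball (0 :: complex ^ 'n ^ 'n) (real CARD('n) * real CARD('n) * c))" by (rule compact_cball)
  show "f \<in> {-1..1} \<rightarrow> cball 0 (real CARD('n) * real CARD('n) * c)"
    using norm_matrix_le[OF bound] by auto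
  have "(\<lambda>x. (x, f x)) ` {-1..1} = {z \<in> {-1..1} \<times> UNIV. P (fst z) (snd z)}"
    using P by fastforce
  then show "closed ((\<lambda>x. (x, f x)) ` {-1..1})" using closed by simp
qed

lemma norm_of_positive_le:
  fixes M :: "complex ^ 'n ^ 'n::finite"
  assumes d: "d > 0" "d * (norm y)\<^sup>2 \<le> op_form ((*v) M) y" and y: "norm (M *v y) \<le> c"
  shows "norm y \<le> c / d"
proof (cases "y = 0")
  case True
  then show ?thesis using d(1) y by (simp add: field_simps)
next
  case False
  have "d * (norm y)\<^sup>2 \<le> norm y * norm (M *v y)"
    using d(2) norm_cauchy_schwarz[of y "M *v y"] by (simp add: op_form_def)
  also have "\<dots> \<le> norm y * c" by (intro mult_left_mono y) simp
  finally have "norm y * (norm y * d) \<le> norm y * c" by (simp add: power2_eq_square mult_ac)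
  then show ?thesis using False d(1) by (simp add: field_simps)
qed

lemma matrix_inv_positive:
  fixes M :: "complex ^ 'n ^ 'n::finite"
  assumes d: "d > 0" "\<And>v. d * (norm v)\<^sup>2 \<le> op_form ((*v) M) v"
  shows "M ** matrix_inv M = mat 1" "matrix_inv M ** M = mat 1"
proof -
  have inj: "inj ((*v) M)"
  proof (rule injI)
    fix x y assume "M *v x = M *v y"
    then have "op_form ((*v) M) (x - y) = 0" by (simp add: op_form_def matrix_vector_mult_diff_distrib)
    then have "d * (norm (x - y))\<^sup>2 \<le> 0" using d(2)[of "x - y"] by simp
    then show "x = y" using d(1) by (simp add: mult_le_0_iff)
  qed
  then obtain N where "N ** M = mat 1" using matrix_left_invertible_injective[of M] by (auto simp: inj_def)
  then have "\<exists>N. M ** N = mat 1 \<and> N ** M = mat 1" using matrix_left_right_inverse by blast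
  then have "M ** matrix_inv M = mat 1 \<and> matrix_inv M ** M = mat 1"
    unfolding matrix_inv_def by (rule someI_ex)
  then show "M ** matrix_inv M = mat 1" "matrix_inv M ** M = mat 1" by blast+
qed

lemma self_adjoint_matrix_inv:
  assumes M: "self_adjoint_matrix (M :: complex ^ 'n ^ 'n::finite)" and R: "M ** R = mat 1"
  shows "self_adjoint_matrix R"
proof -
  have MR: "M *v (R *v x) = x" for x by (simp add: matrix_vector_mul_assoc R)
  have "(R *v x) \<bullet> y = x \<bullet> (R *v y)" for x y
  proof -
    have "(R *v x) \<bullet> y = (R *v x) \<bullet> (M *v (R *v y))" by (simp add: MR)
    also have "\<dots> = (M *v (R *v x)) \<bullet> (R *v y)" using M by (simp add: self_adjoint_matrix_def)
    finally show ?thesis by (simp add: MR)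
  qed
  then show ?thesis by (simp add: self_adjoint_matrix_def)
qed

lemma self_adjoint_matrix_ops:
  fixes M N :: "complex ^ 'n ^ 'n::finite"
  assumes "self_adjoint_matrix M" "self_adjoint_matrix N"
  shows "self_adjoint_matrix (M + N)" "self_adjoint_matrix (M - N)"
  using assms
  by (simp_all add: self_adjoint_matrix_def matrix_vector_mult_add_rdistrib inner_add_left inner_add_right
      matrix_vector_mult_diff_rdistrib inner_diff_left inner_diff_right)

lemma self_adjoint_matrix_scaleR:
  "self_adjoint_matrix M \<Longrightarrow> self_adjoint_matrix (r *\<^sub>R M)" for M :: "complex ^ 'n ^ 'n::finite"
  by (simp add: self_adjoint_matrix_def scaleR_matrix_vector)

lemma closed_zero_set:
  fixes h :: "'a::topological_space \<Rightarrow> 'b::real_normed_vector"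
  assumes "closed S" "continuous_on S h"
  shows "closed {z \<in> S. h z = 0}"
  using continuous_closed_preimage[OF assms(2,1), of "{0}"] by (simp add: vimage_def Int_def)

lemma closed_nonneg_set:
  fixes h :: "'a::topological_space \<Rightarrow> real"
  assumes "closed S" "continuous_on S h"
  shows "closed {z \<in> S. 0 \<le> h z}"
  using continuous_closed_preimage[OF assms(2,1), of "{0..}"] by (simp add: vimage_def Int_def)

text \<open>With \<open>U = 0\<close> the two directions decouple. Such faces make the half-strip
  construction available for an arbitrary coercive pair, in particular for the strip symbols at a
  fixed \<open>x\<close>.\<close>

lemma face_operator_line:
  fixes T A :: "complex ^ 'n ^ 'n::finite"
  assumes "self_adjoint_matrix T" "self_adjoint_matrix A" "coercive (line_op ((*v) T) ((*v) A))"
  shows "face_operator (dihedral_blocks T A 0)"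
  unfolding face_operator_def
proof (intro conjI allI impI)
  fix x y :: "(complex, 'n) face_space"
  obtain s n w e s' n' w' e' where x: "x = (s, n, w, e)" and y: "y = (s', n', w', e')" by (metis surj_pair)
  show "face_map (dihedral_blocks T A 0) x \<bullet> y = x \<bullet> face_map (dihedral_blocks T A 0) y"
    using assms(1,2) unfolding x y face_map_dihedral self_adjoint_matrix_def
    by (simp add: inner_prod_def inner_add_left inner_add_right)
next
  fix x :: "(complex, 'n) face_space"
  assume x0: "x \<noteq> 0"
  obtain s n w e where x: "x = (s, n, w, e)" by (metis surj_pair)
  obtain d where d: "d > 0" "\<And>z. d * (norm z)\<^sup>2 \<le> op_form (line_op ((*v) T) ((*v) A)) z"
    using assms(3) unfolding coercive_def by blast
  have "x \<bullet> face_map (dihedral_blocks T A 0) x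
      = op_form (line_op ((*v) T) ((*v) A)) (s, n) + op_form (line_op ((*v) T) ((*v) A)) (w, e)"
    unfolding x face_map_dihedral by (simp add: op_form_def line_op_def inner_prod_def)
  moreover have "0 < d * ((norm (s, n))\<^sup>2 + (norm (w, e))\<^sup>2)"
  proof -
    have "0 < d * (norm x)\<^sup>2" using x0 d(1) by simp
    then show ?thesis unfolding x norm_Pair_power2 by (simp add: add.assoc)
  qed
  ultimately show "0 < x \<bullet> face_map (dihedral_blocks T A 0) x"
    using d(2)[of "(s, n)"] d(2)[of "(w, e)"] by (simp add: distrib_left)
qed

context
  fixes T A U :: "complex ^ 'n ^ 'n::finite" and Q :: "(complex, 'n) blocks"
  assumes Q: "face_operator Q" and dihedral: "Q = dihedral_blocks T A U"
begin

private lemmas sa = self_adjoint_dihedral[OF Q dihedral]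

text \<open>With zero values on the South and North sides, the half-strip equation becomes the
  Riccati equation for the end block \<open>G\<close>. The stationary next state is
  \<open>W *v n\<close>, and unrolling the equation along the strip yields the values on the two
  long sides.\<close>

lemma strip_op_end:
  "\<exists>G W. riccati T A G W \<and>
    (\<forall>n. \<exists>f. strip_op Q ((0, 0), n) = ((f, f), G *v n) \<and>
      (\<forall>k. ell2_nth f k = U *v ((mat 1 + W) *v (((*v) W ^^ k) n))))"
proof -
  let ?S = "strip_op Q"
  note S = coercive_strip_op[OF Q] and F = coercive_face_map[OF Q]
  note s = coercive_symmetric[OF S]
  \<comment> \<open>To be a matrix, the end block has to be complex-linear; this follows from the
    intertwining with scalar multiplication.\<close>
  define G where "G = matrix (\<lambda>n. snd (?S ((0, 0), n)))"
  have "Vector_Spaces.linear (*s) (*s) (\<lambda>n. snd (?S ((0, 0), n)))"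
    unfolding Vector_Spaces.linear_iff
  proof (intro conjI allI vec.vector_space_axioms)
    fix n m :: "complex ^ 'n" and c
    show "snd (?S ((0, 0), n + m)) = snd (?S ((0, 0), n)) + snd (?S ((0, 0), m))"
      using symmetric_opD(4)[OF s, of "((0, 0), n)" "((0, 0), m)"] by simp
    have "ell2_map ((*s) c) (0 :: (nat, complex ^ 'n) ell2) = 0"
      by (rule ell2_eqI) (simp add: ell2_nth_map bounded_linear_vector_scalar_mult)
    then show "snd (?S ((0, 0), c *s n)) = c *s snd (?S ((0, 0), n))"
      using strip_op_intertwine[OF Q Q bounded_linear_vector_scalar_mult face_map_scale, of c 0 0 n]
      by simp
  qed
  then have G: "G *v n = snd (?S ((0, 0), n))" for n by (simp add: G_def matrix_works)
  have C: "coercive ((*v) G)"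
  proof -
    obtain d where d: "d > 0" "\<And>z. d * (norm z)\<^sup>2 \<le> op_form ?S z"
      using S unfolding coercive_def by blast
    have "d * (norm n)\<^sup>2 \<le> op_form ((*v) G) n" for n
      using d(2)[of "((0, 0), n)"] by (simp add: op_form_def G inner_prod_def norm_Pair_power2)
    moreover have "symmetric_op ((*v) G)"
      using coercive_symmetric[OF coercive_snd[OF S]]
      by (simp add: symmetric_op_def G bounded_linear_matrix_vector_mult zero_prod_def)
    ultimately show ?thesis using d(1) by (auto simp: coercive_def)
  qed
  obtain c where c: "c > 0" "\<And>z. c * (norm z)\<^sup>2 \<le> op_form ((*v) G) z"
    using C unfolding coercive_def by blast
  have T0: "0 \<le> op_form ((*v) T) v" for v
    using coercive_nonneg[OF F, of "(v, 0, 0, 0)"] by (simp add: op_form_def dihedral face_map_dihedral inner_prod_def)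
  have GT: "c * (norm z)\<^sup>2 \<le> op_form ((*v) (G + T)) z" for z
    using c(2)[of z] T0[of z] by (simp add: op_form_def matrix_vector_mult_add_rdistrib inner_add_right)
  \<comment> \<open>The stationary next state for the end value \<open>n\<close> solves
    \<open>(G + T) v = - A n\<close>.\<close>
  define W where "W = matrix_inv (G + T) ** (- A)"
  have GTW: "(G + T) ** W = - A"
    using matrix_inv_positive(1)[OF c(1) GT] by (simp add: W_def matrix_mul_assoc)
  have stat: "G *v (W *v n) + (T *v (W *v n) + A *v n) = 0" for n
  proof -
    have "((G + T) ** W) *v n = (- A) *v n" by (simp only: GTW)
    then have "G *v (W *v n) + T *v (W *v n) = - (A *v n)"
      by (simp only: matrix_vector_mul_assoc[symmetric] matrix_vector_mult_add_rdistrib uminus_matrix_vector_mult)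
    then show ?thesis by (simp add: add.assoc[symmetric])
  qed
  have step: "?S ((0, 0), n) = strip_join (fst (?S ((0, 0), W *v n)),
      (U *v (W *v n + n), U *v (W *v n + n), A *v (W *v n) + T *v n))" for n
  proof -
    let ?B = "transport (\<lambda>(s, n, w, e). ((s, n, e), w)) (face_map Q)"
    have B: "?B ((0, 0, n), v) = ((U *v (v + n), U *v (v + n), A *v v + T *v n), T *v v + A *v n)" for v
      using transport_apply[OF unitary_bij[OF unitary_rearrange(2)], of "face_map Q" "(0, 0, v, n)"]
      by (simp add: dihedral face_map_dihedral)
    have "transport strip_join (glue ?S ?B) = ?S"
      using is_west_fixed_point_iff[OF Q, of ?S] unfolding is_west_fixed_point_def by blast
    with transport_apply[OF unitary_bij[OF unitary_strip_join], of "glue ?S ?B" "((0, 0), (0, 0, n))"]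
    have "?S (strip_join ((0, 0), (0, 0, n))) = strip_join (glue ?S ?B ((0, 0), (0, 0, n)))" by simp
    also have "glue ?S ?B ((0, 0), (0, 0, n)) = (fst (?S ((0, 0), W *v n)), fst (?B ((0, 0, n), W *v n)))"
      by (rule glue_coercive(3)[OF S coercive_transport[OF unitary_rearrange(2) F]])
        (simp add: B G[symmetric] stat)
    finally show ?thesis by (simp add: B strip_join_def linear_ell2_push)
  qed
  have GW: "G *v n = T *v n + A *v (W *v n)" for n
    using arg_cong[OF step[of n], of snd] by (cases "?S ((0, 0), W *v n)") (auto simp: strip_join_def G case_prod_unfold)
  have "riccati T A G W"
    unfolding riccati_def
  proof (intro conjI allI)
    show "self_adjoint_matrix G" using coercive_symmetric[OF C] by (simp add: symmetric_op_matrix_iff)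
    show "0 \<le> op_form ((*v) G) x" for x by (rule coercive_nonneg[OF C])
    show "G = T + A ** W"
      by (rule matrix_eqI) (simp add: GW matrix_vector_mult_add_rdistrib matrix_vector_mul_assoc[symmetric])
  qed (rule GTW)
  moreover have "\<exists>f. ?S ((0, 0), n) = ((f, f), G *v n) \<and>
      (\<forall>k. ell2_nth f k = U *v ((mat 1 + W) *v (((*v) W ^^ k) n)))" for n
  proof -
    define a b where "a n = fst (fst (?S ((0, 0), n)))" and "b n = snd (fst (?S ((0, 0), n)))" for n
    have ab: "a n = ell2_push (a (W *v n)) (U *v (W *v n + n))" "b n = ell2_push (b (W *v n)) (U *v (W *v n + n))" for n
      using step[of n] by (simp_all add: a_def b_def strip_join_def case_prod_unfold)
    have ab_nth: "ell2_nth (a n) 0 = U *v (W *v n + n)" "ell2_nth (a n) (Suc k) = ell2_nth (a (W *v n)) k"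
      "ell2_nth (b n) 0 = U *v (W *v n + n)" "ell2_nth (b n) (Suc k) = ell2_nth (b (W *v n)) k" for n k
      using arg_cong[OF ab(1)[of n], of "\<lambda>f. ell2_nth f 0"] arg_cong[OF ab(1)[of n], of "\<lambda>f. ell2_nth f (Suc k)"]
        arg_cong[OF ab(2)[of n], of "\<lambda>f. ell2_nth f 0"] arg_cong[OF ab(2)[of n], of "\<lambda>f. ell2_nth f (Suc k)"]
      by simp_all
    have nth: "ell2_nth (a n) k = U *v ((mat 1 + W) *v (((*v) W ^^ k) n)) \<and>
        ell2_nth (b n) k = U *v ((mat 1 + W) *v (((*v) W ^^ k) n))" for n k
    proof (induction k arbitrary: n)
      case 0
      show ?case by (simp add: ab_nth matrix_vector_mult_add_rdistrib add.commute)
    next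
      case (Suc k)
      show ?case using Suc[of "W *v n"] by (simp add: ab_nth funpow_swap1)
    qed
    then have "b n = a n" by (intro ell2_eqI) simp
    then have "?S ((0, 0), n) = ((a n, a n), G *v n)" by (simp add: G a_def b_def prod_eq_iff)
    with nth show ?thesis by blast
  qed
  ultimately show ?thesis by blast
qed

section \<open>Positivity and continuity of the strip symbols\<close>

lemma face_form_lower:
  obtains d where "d > 0"
    "\<And>s n w e. d * ((norm s)\<^sup>2 + (norm n)\<^sup>2 + (norm w)\<^sup>2 + (norm e)\<^sup>2) \<le> op_form (face_map Q) (s, n, w, e)"
proof -
  obtain d where d: "d > 0" "\<And>z. d * (norm z)\<^sup>2 \<le> op_form (face_map Q) z"
    using coercive_face_map[OF Q] unfolding coercive_def by blast
  have "d * ((norm s)\<^sup>2 + (norm n)\<^sup>2 + (norm w)\<^sup>2 + (norm e)\<^sup>2) \<le> op_form (face_map Q) (s, n, w, e)" for s n w e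
    using d(2)[of "(s, n, w, e)"] unfolding norm_Pair_power2 by (simp add: add.assoc)
  with d(1) that show thesis by blast
qed

lemma strip_phi_ge:
  obtains d where "d > 0" "\<And>x v. x \<in> {-1..1} \<Longrightarrow> d * (norm v)\<^sup>2 \<le> op_form ((*v) (strip_phi T A x)) v"
proof -
  obtain d where d: "d > 0"
    "\<And>s n w e. d * ((norm s)\<^sup>2 + (norm n)\<^sup>2 + (norm w)\<^sup>2 + (norm e)\<^sup>2) \<le> op_form (face_map Q) (s, n, w, e)"
    using face_form_lower by blast
  have "d * (norm z)\<^sup>2 \<le> op_form (line_op ((*v) T) ((*v) A)) z" for z
    using d(2)[of "fst z" "snd z" 0 0]
    by (cases z) (simp add: op_form_dihedral[OF Q dihedral] norm_Pair_power2, simp add: op_form_def line_op_def inner_prod_def)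
  from line_op_ge[OF _ _ this] sa
  have "d * (norm v)\<^sup>2 \<le> op_form ((*v) T) v + x * op_form ((*v) A) v" if "x \<in> {-1..1}" for x v
    using that by (auto simp: symmetric_op_matrix_iff)
  moreover have "op_form ((*v) (strip_phi T A x)) v = 2 * (op_form ((*v) T) v + x * op_form ((*v) A) v)" for x v
    by (simp add: op_form_def strip_phi_def matrix_vector_mult_add_rdistrib scaleR_matrix_vector inner_add_right)
  ultimately have "2 * d * (norm v)\<^sup>2 \<le> op_form ((*v) (strip_phi T A x)) v" if "x \<in> {-1..1}" for x v
    using that by (simp only:) (simp only: mult.assoc mult_le_cancel_left_pos zero_less_numeral)
  with d(1) that[of "2 * d"] show thesis by simp
qed

lemma strip_inv_inverse:
  assumes "x \<in> {-1..1}"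
  shows "strip_phi T A x ** strip_inv T A x = mat 1" "strip_inv T A x ** strip_phi T A x = mat 1"
proof -
  obtain d where "d > 0" "\<And>v. d * (norm v)\<^sup>2 \<le> op_form ((*v) (strip_phi T A x)) v"
    using strip_phi_ge assms by metis
  from matrix_inv_positive[OF this]
  show "strip_phi T A x ** strip_inv T A x = mat 1" "strip_inv T A x ** strip_phi T A x = mat 1"
    by (simp_all add: strip_inv_def)
qed

lemma strip_phi_inv_apply: "x \<in> {-1..1} \<Longrightarrow> strip_phi T A x *v (strip_inv T A x *v v) = v"
  using strip_inv_inverse(1)[of x] by (simp add: matrix_vector_mul_assoc)

lemma self_adjoint_strip_phi: "self_adjoint_matrix (strip_phi T A x)"
  unfolding strip_phi_def by (intro self_adjoint_matrix_ops self_adjoint_matrix_scaleR sa)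

lemma self_adjoint_strip_inv: "x \<in> {-1..1} \<Longrightarrow> self_adjoint_matrix (strip_inv T A x)"
  by (rule self_adjoint_matrix_inv[OF self_adjoint_strip_phi strip_inv_inverse(1)])

lemma strip_D_apply: "strip_D T A U x *v v = (2 + 2 * x) *\<^sub>R (U *v (strip_inv T A x *v (U *v v)))"
proof -
  have "U *v (r *\<^sub>R y) = r *\<^sub>R (U *v y)" for r y
    by (rule linear_simps(5)[OF bounded_linear_matrix_vector_mult])
  then show ?thesis
    by (simp add: strip_D_def matrix_vector_mul_assoc[symmetric] matrix_vector_mult_add_rdistrib
        scaleR_matrix_vector scaleR_left_distrib[symmetric])
qed

lemma self_adjoint_strip:
  assumes x: "x \<in> {-1..1}"
  shows "self_adjoint_matrix (strip_T T A U x)" "self_adjoint_matrix (strip_A T A U x)"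
proof -
  have D: "self_adjoint_matrix (strip_D T A U x)"
    using sa(3) self_adjoint_strip_inv[OF x] by (simp add: self_adjoint_matrix_def strip_D_apply)
  show "self_adjoint_matrix (strip_T T A U x)" "self_adjoint_matrix (strip_A T A U x)"
    unfolding strip_T_def strip_A_def by (intro self_adjoint_matrix_ops(2) sa D)+
qed

lemma continuous_strip_inv: "continuous_on {-1..1} (strip_inv T A)"
proof -
  obtain d where d: "d > 0" "\<And>x v. x \<in> {-1..1} \<Longrightarrow> d * (norm v)\<^sup>2 \<le> op_form ((*v) (strip_phi T A x)) v"
    using strip_phi_ge by blast
  show ?thesis
  proof (rule continuous_on_matrix_closed_graph[where P = "\<lambda>x Y. strip_phi T A x ** Y = mat 1"])
    fix x :: real and v :: "complex ^ 'n" assume x: "x \<in> {-1..1}"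
    show "norm (strip_inv T A x *v v) \<le> (1 / d) * norm v"
      using norm_of_positive_le[OF d(1) d(2)[OF x], of "strip_inv T A x *v v" "norm v"]
      by (simp add: strip_phi_inv_apply[OF x])
  next
    fix x :: real and Y assume x: "x \<in> {-1..1}"
    show "strip_phi T A x ** Y = mat 1 \<longleftrightarrow> Y = strip_inv T A x"
    proof
      assume "strip_phi T A x ** Y = mat 1"
      then have "strip_inv T A x ** (strip_phi T A x ** Y) = strip_inv T A x" by simp
      then show "Y = strip_inv T A x" by (simp add: matrix_mul_assoc strip_inv_inverse[OF x])
    qed (simp add: strip_inv_inverse[OF x])
  next
    let ?S = "{-1..1} \<times> UNIV :: (real \<times> (complex ^ 'n ^ 'n)) set"
    have "closed {z \<in> ?S. strip_phi T A (fst z) ** snd z - mat 1 = 0}"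
      unfolding strip_phi_def
      by (intro closed_zero_set closed_Times closed_UNIV closed_atLeastAtMost continuous_intros)
    then show "closed {z \<in> ?S. strip_phi T A (fst z) ** snd z = mat 1}" by simp
  qed
qed

lemma continuous_strip:
  "continuous_on {-1..1} (strip_D T A U)" "continuous_on {-1..1} (strip_T T A U)"
  "continuous_on {-1..1} (strip_A T A U)"
proof -
  show D: "continuous_on {-1..1} (strip_D T A U)"
    unfolding strip_D_def by (intro continuous_intros continuous_strip_inv)
  show "continuous_on {-1..1} (strip_T T A U)" "continuous_on {-1..1} (strip_A T A U)"
    unfolding strip_T_def strip_A_def by (intro continuous_intros D)+
qed

text \<open>
  The form of the strip symbols at \<open>Re u\<close> is the minimum over \<open>s\<close> of the form of the face at
  \<open>(s, u s, w, e)\<close>.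
\<close>

lemma strip_line_ge:
  obtains d where "d > 0"
    "\<And>x z. x \<in> {-1..1} \<Longrightarrow> d * (norm z)\<^sup>2 \<le> op_form (line_op ((*v) (strip_T T A U x)) ((*v) (strip_A T A U x))) z"
proof -
  obtain d where d: "d > 0"
    "\<And>s n w e. d * ((norm s)\<^sup>2 + (norm n)\<^sup>2 + (norm w)\<^sup>2 + (norm e)\<^sup>2) \<le> op_form (face_map Q) (s, n, w, e)"
    using face_form_lower by blast
  have "d * (norm z)\<^sup>2 \<le> op_form (line_op ((*v) (strip_T T A U x)) ((*v) (strip_A T A U x))) z"
    if x: "x \<in> {-1..1}" for x z
  proof -
    obtain w e where z: "z = (w, e)" by (metis surj_pair)
    \<comment> \<open>Any \<open>u\<close> on the circle with real part \<open>x\<close> would do;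
      the arc cosine provides one.\<close>
    define u where "u = cis (arccos x)"
    have u: "Re u = x" "norm u = 1" using x by (simp_all add: u_def cos_arccos)
    define p r where "p = U *v (w + e)" and "r = strip_inv T A x *v p"
    \<comment> \<open>The minimizing \<open>s\<close> solves
      \<open>strip_phi T A x s = - (1 + cnj u) p\<close>, and \<open>r\<close> solves the same
      equation with right-hand side \<open>p\<close>.\<close>
    define c where "c = - (1 + cnj u)"
    define s where "s = c *s r"
    have phi_r: "2 *\<^sub>R (T *v r) + (2 * x) *\<^sub>R (A *v r) = p"
      using strip_phi_inv_apply[OF x, of p]
      by (simp add: r_def strip_phi_def matrix_vector_mult_add_rdistrib scaleR_matrix_vector)
    have scale: "(c *s a) \<bullet> (c *s b) = (norm c)\<^sup>2 * (a \<bullet> b)" for c and a b :: "complex ^ 'n"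
      unfolding cmod_power2
      by (simp add: complex_scale_split[of c] inner_add_left inner_add_right inner_ii_ii inner_ii_left
          power2_eq_square algebra_simps)
    have us: "s + u *s s = - ((2 + 2 * x) *\<^sub>R r)"
    proof -
      have c: "(1 + u) * c = - of_real (2 + 2 * x)"
        using u complex_mult_cnj[of u] cmod_power2[of u]
        by (simp add: c_def complex_eq_iff algebra_simps power2_eq_square)
      have "s + u *s s = ((1 + u) * c) *s r"
        by (simp add: s_def vec_eq_iff algebra_simps)
      then show ?thesis
        unfolding c by (simp add: vec_eq_iff scaleR_conv_of_real[where 'a = complex] algebra_simps)
    qed
    have n1: "(norm c)\<^sup>2 = 2 + 2 * x"
      using u cmod_power2[of u] unfolding cmod_power2[of c]
      by (simp add: c_def power2_eq_square algebra_simps)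
    have line: "op_form (line_op ((*v) T) ((*v) A)) (s, u *s s) = (2 + 2 * x) * (r \<bullet> p)"
    proof -
      have sform: "op_form ((*v) M) s = (2 + 2 * x) * op_form ((*v) M) r" for M
        by (simp add: op_form_def s_def vector_scalar_commute scale n1)
      have "op_form (line_op ((*v) T) ((*v) A)) (s, u *s s)
          = op_form ((*v) T) s + op_form ((*v) T) (u *s s) + 2 * ((A *v (u *s s)) \<bullet> s)"
        by (rule op_form_line_op) (simp add: symmetric_op_matrix_iff sa)
      also have "op_form ((*v) T) (u *s s) = op_form ((*v) T) s"
        by (simp add: op_form_def vector_scalar_commute scale u)
      also have "(A *v (u *s s)) \<bullet> s = x * op_form ((*v) A) s"
        using self_adjoint_inner_scale[OF sa(2), of s u] u by (simp add: vector_scalar_commute inner_commute)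
      finally show ?thesis
        unfolding phi_r[symmetric] sform by (simp add: op_form_def inner_add_right algebra_simps)
    qed
    have pr: "p \<bullet> r = w \<bullet> (U *v r) + e \<bullet> (U *v r)"
      using sa(3) by (simp add: p_def self_adjoint_matrix_def inner_add_left)
    have "d * (norm z)\<^sup>2 \<le> d * ((norm s)\<^sup>2 + (norm (u *s s))\<^sup>2 + (norm w)\<^sup>2 + (norm e)\<^sup>2)"
      using d(1) by (simp add: z norm_Pair_power2)
    also have "\<dots> \<le> op_form (face_map Q) (s, u *s s, w, e)" by (rule d(2))
    also have "\<dots> = op_form (line_op ((*v) T) ((*v) A)) (w, e) - (2 + 2 * x) * (p \<bullet> r)"
      unfolding op_form_dihedral[OF Q dihedral] line us p_def[symmetric]
      by (simp add: inner_commute algebra_simps)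
    also have "\<dots> = op_form (line_op ((*v) (strip_T T A U x)) ((*v) (strip_A T A U x))) z"
    proof -
      have D: "strip_D T A U x *v w + strip_D T A U x *v e = (2 + 2 * x) *\<^sub>R (U *v r)"
        by (simp add: strip_D_apply r_def p_def matrix_vector_right_distrib scaleR_right_distrib)
      have "op_form (line_op ((*v) (strip_T T A U x)) ((*v) (strip_A T A U x))) z
          = op_form (line_op ((*v) T) ((*v) A)) (w, e)
            - w \<bullet> (strip_D T A U x *v w + strip_D T A U x *v e) - e \<bullet> (strip_D T A U x *v w + strip_D T A U x *v e)"
        by (simp add: z op_form_def line_op_def strip_T_def strip_A_def matrix_vector_mult_diff_rdistrib
            inner_prod_def inner_add_right inner_diff_right)
      then show ?thesis unfolding D pr by (simp add: algebra_simps)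
    qed
    finally show ?thesis .
  qed
  with d(1) that show thesis by blast
qed

lemma coercive_strip_line:
  assumes x: "x \<in> {-1..1}"
  shows "coercive (line_op ((*v) (strip_T T A U x)) ((*v) (strip_A T A U x)))"
  using strip_line_ge x symmetric_op_line_op self_adjoint_strip[OF x]
  unfolding coercive_def symmetric_op_matrix_iff[symmetric] by metis

end

lemma strip_riccati:
  fixes T A U :: "complex ^ 'n ^ 'n::finite"
  assumes Q: "face_operator (dihedral_blocks T A U)" and x: "x \<in> {-1..1}"
  shows "riccati (strip_T T A U x) (strip_A T A U x) (strip_G T A U x) (strip_W T A U x)"
proof -
  let ?T = "strip_T T A U x" and ?A = "strip_A T A U x"
  have "face_operator (dihedral_blocks ?T ?A 0)"
    by (intro face_operator_line self_adjoint_strip[OF Q refl x] coercive_strip_line[OF Q refl x])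
  then have "\<exists>W G. riccati ?T ?A G W" using strip_op_end[OF _ refl] by blast
  then have "\<exists>G. riccati ?T ?A G (strip_W T A U x)"
    unfolding strip_W_def by (rule someI_ex)
  then obtain G where G: "riccati ?T ?A G (strip_W T A U x)" by blast
  then have "G = strip_G T A U x" unfolding riccati_def strip_G_def by blast
  with G show ?thesis by simp
qed

text \<open>The Riccati conditions are closed in \<open>(x, W)\<close>, uniqueness makes them a
  description of the graph, and a lower bound for \<open>G + T\<close> that is uniform in
  \<open>x\<close> bounds \<open>W\<close>.\<close>

lemma continuous_strip_W:
  fixes T A U :: "complex ^ 'n ^ 'n::finite"
  assumes Q: "face_operator (dihedral_blocks T A U)"
  shows "continuous_on {-1..1} (strip_W T A U)"
proof -
  note cont = continuous_strip[OF Q refl]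
  obtain d where d: "d > 0"
    "\<And>x z. x \<in> {-1..1} \<Longrightarrow> d * (norm z)\<^sup>2 \<le> op_form (line_op ((*v) (strip_T T A U x)) ((*v) (strip_A T A U x))) z"
    using strip_line_ge[OF Q refl] by blast
  obtain B where B: "B > 0" "\<And>x v. x \<in> {-1..1} \<Longrightarrow> norm (strip_A T A U x *v v) \<le> B * norm v"
    using symbol_bound[OF cont(3)] by blast
  let ?R = "\<lambda>x W. riccati (strip_T T A U x) (strip_A T A U x) (strip_T T A U x + strip_A T A U x ** W) W"
  show ?thesis
  proof (rule continuous_on_matrix_closed_graph[where P = ?R])
    fix x :: real and v :: "complex ^ 'n" assume x: "x \<in> {-1..1}"
    let ?T = "strip_T T A U x" and ?A = "strip_A T A U x" and ?G = "strip_G T A U x" and ?W = "strip_W T A U x"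
    note r = strip_riccati[OF Q x]
    note sa = self_adjoint_strip[OF Q refl x] and co = coercive_strip_line[OF Q refl x]
    have "d * (norm y)\<^sup>2 \<le> op_form ((*v) (?G + ?T)) y" for y
    proof -
      have "d * (norm y)\<^sup>2 \<le> op_form ((*v) ?T) y"
        using line_op_ge[OF _ _ d(2)[OF x], of 0 y] sa by (simp add: symmetric_op_matrix_iff)
      moreover have "0 \<le> op_form ((*v) ?G) y" using r unfolding riccati_def by blast
      ultimately show ?thesis by (simp add: op_form_def matrix_vector_mult_add_rdistrib inner_add_right)
    qed
    from norm_of_positive_le[OF d(1) this, of "?W *v v" "B * norm v"]
    show "norm (?W *v v) \<le> (B / d) * norm v"
      using riccati_apply(2)[OF sa co r, of v] B(2)[OF x, of v]
      by (simp add: matrix_vector_mult_add_rdistrib)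
  next
    fix x :: real and W assume x: "x \<in> {-1..1}"
    show "?R x W \<longleftrightarrow> W = strip_W T A U x"
      using riccati_unique(2)[OF self_adjoint_strip[OF Q refl x] coercive_strip_line[OF Q refl x]] strip_riccati[OF Q x]
      unfolding strip_G_def by blast
  next
    let ?S = "{-1..1} \<times> UNIV :: (real \<times> (complex ^ 'n ^ 'n)) set"
    have S: "closed ?S" by (intro closed_Times) auto
    have c: "continuous_on ?S (\<lambda>z. strip_T T A U (fst z))" "continuous_on ?S (\<lambda>z. strip_A T A U (fst z))"
      by (auto intro!: continuous_on_compose2[OF cont(2)] continuous_on_compose2[OF cont(3)] continuous_intros)
    let ?G = "\<lambda>z. strip_T T A U (fst z) + strip_A T A U (fst z) ** snd z"
    have "{z \<in> ?S. ?R (fst z) (snd z)} =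
        (\<Inter>v. \<Inter>w. {z \<in> ?S. (?G z *v v) \<bullet> w - v \<bullet> (?G z *v w) = 0}) \<inter> (\<Inter>v. {z \<in> ?S. 0 \<le> v \<bullet> (?G z *v v)}) \<inter>
        {z \<in> ?S. (?G z + strip_T T A U (fst z)) ** snd z + strip_A T A U (fst z) = 0}"
      unfolding riccati_def self_adjoint_matrix_def op_form_def by (auto simp: eq_neg_iff_add_eq_0)
    also have "closed \<dots>"
      by (intro closed_Int closed_INT ballI closed_zero_set closed_nonneg_set S continuous_intros c)
    finally show "closed {z \<in> ?S. ?R (fst z) (snd z)}" .
  qed
qed

section \<open>Blocks of the corner\<close>

lemma inverse_cis_add: "cis \<theta> + inverse (cis \<theta>) = complex_of_real (2 * cos \<theta>)"
  by (simp add: complex_eq_iff)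

context
  fixes T A U :: "complex ^ 'n ^ 'n::finite" and Q :: "(complex, 'n) blocks"
  assumes Q: "face_operator Q" and dihedral: "Q = dihedral_blocks T A U"
begin

private abbreviation (input) "fT \<equiv> fold_symbol (strip_T T A U)"
private abbreviation (input) "fA \<equiv> fold_symbol (strip_A T A U)"
private abbreviation (input) "fG \<equiv> fold_symbol (strip_G T A U)"
private abbreviation (input) "fW \<equiv> fold_symbol (strip_W T A U)"

private lemmas Q' = Q[unfolded dihedral]
private lemmas self_adjoint = self_adjoint_dihedral[OF Q dihedral]

lemma dihedral_line_symbol:
  "line_symbol Q West East (cis \<theta>) = strip_phi T A (cos \<theta>)"
  "line_symbol Q South North (cis \<theta>) = strip_phi T A (cos \<theta>)"
proof -
  have "T + T + cis \<theta> *\<^sub>M A + inverse (cis \<theta>) *\<^sub>M A = strip_phi T A (cos \<theta>)"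
  proof (rule matrix_eqI)
    fix v :: "complex ^ 'n"
    have "cis \<theta> *s (A *v v) + inverse (cis \<theta>) *s (A *v v) = (2 * cos \<theta>) *\<^sub>R (A *v v)"
      unfolding vec.scale_left_distrib[symmetric] inverse_cis_add
      by (simp add: vec_eq_iff scaleR_conv_of_real[where 'a = complex])
    then show "(T + T + cis \<theta> *\<^sub>M A + inverse (cis \<theta>) *\<^sub>M A) *v v = strip_phi T A (cos \<theta>) *v v"
      unfolding strip_phi_def matrix_vector_mult_add_rdistrib cscale_matrix_vector scaleR_matrix_vector scaleR_2
      by (simp only: add.assoc)
  qed
  then show "line_symbol Q West East (cis \<theta>) = strip_phi T A (cos \<theta>)"
    "line_symbol Q South North (cis \<theta>) = strip_phi T A (cos \<theta>)"
    by (simp_all only: line_symbol_def dihedral dihedral_blocks_def side.distinct simp_thms if_True if_False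
        doubleton_eq_iff)
qed

lemma strip_product:
  assumes "c * d = complex_of_real (2 + 2 * cos \<theta>)"
  shows "(c *\<^sub>M U) ** matrix_inv (strip_phi T A (cos \<theta>)) ** (d *\<^sub>M U) = strip_D T A U (cos \<theta>)"
proof (rule matrix_eqI)
  fix v :: "complex ^ 'n"
  have "((c *\<^sub>M U) ** matrix_inv (strip_phi T A (cos \<theta>)) ** (d *\<^sub>M U)) *v v
      = (c * d) *s (U *v (strip_inv T A (cos \<theta>) *v (U *v v)))"
    by (simp add: matrix_vector_mul_assoc[symmetric] cscale_matrix_vector vector_scalar_commute
        vector_smult_assoc strip_inv_def)
  also have "\<dots> = strip_D T A U (cos \<theta>) *v v"
    unfolding assms strip_D_apply[OF Q dihedral]
    by (simp add: vec_eq_iff scaleR_conv_of_real[where 'a = complex] distrib_right)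
  finally show "((c *\<^sub>M U) ** matrix_inv (strip_phi T A (cos \<theta>)) ** (d *\<^sub>M U)) *v v = strip_D T A U (cos \<theta>) *v v" .
qed

lemma cscale_add: "U + c *\<^sub>M U = (1 + c) *\<^sub>M U"
  by (rule matrix_eqI) (simp add: matrix_vector_mult_add_rdistrib cscale_matrix_vector vec.scale_left_distrib)

lemma one_plus_cis:
  "(1 + cis \<theta>) * (1 + inverse (cis \<theta>)) = complex_of_real (2 + 2 * cos \<theta>)"
  "(1 + inverse (cis \<theta>)) * (1 + cis \<theta>) = complex_of_real (2 + 2 * cos \<theta>)"
proof -
  have "(1 + cis \<theta>) * (1 + inverse (cis \<theta>)) = 2 + (cis \<theta> + inverse (cis \<theta>))"
    by (simp add: algebra_simps cis_mult)
  then show "(1 + cis \<theta>) * (1 + inverse (cis \<theta>)) = complex_of_real (2 + 2 * cos \<theta>)"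
    unfolding inverse_cis_add by simp
  then show "(1 + inverse (cis \<theta>)) * (1 + cis \<theta>) = complex_of_real (2 + 2 * cos \<theta>)"
    by (simp only: mult.commute)
qed

lemma strip_WE_dihedral:
  "strip_WE Q (cis \<theta>) South South = strip_T T A U (cos \<theta>)" "strip_WE Q (cis \<theta>) North North = strip_T T A U (cos \<theta>)"
  "strip_WE Q (cis \<theta>) South North = strip_A T A U (cos \<theta>)" "strip_WE Q (cis \<theta>) North South = strip_A T A U (cos \<theta>)"
  unfolding strip_WE_def dihedral_line_symbol strip_T_def strip_A_def strip_product[OF one_plus_cis(1), symmetric]
  by (simp_all add: dihedral dihedral_blocks_def doubleton_eq_iff cscale_add)

lemma strip_SN_dihedral:
  "strip_SN Q (cis \<theta>) West West = strip_T T A U (cos \<theta>)" "strip_SN Q (cis \<theta>) East East = strip_T T A U (cos \<theta>)"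
  "strip_SN Q (cis \<theta>) West East = strip_A T A U (cos \<theta>)" "strip_SN Q (cis \<theta>) East West = strip_A T A U (cos \<theta>)"
  unfolding strip_SN_def dihedral_line_symbol strip_T_def strip_A_def strip_product[OF one_plus_cis(2), symmetric]
  by (simp_all add: dihedral dihedral_blocks_def doubleton_eq_iff cscale_add)

lemma cos_mem: "cos (\<theta> :: real) \<in> {-1..1}" by simp

lemma W_hat_dihedral:
  "W_hat_S Q (cis \<theta>) = strip_W T A U (cos \<theta>)" "W_hat_W Q (cis \<theta>) = strip_W T A U (cos \<theta>)"
  unfolding W_hat_S_def W_hat_W_def
  by (rule W_left_riccati[OF self_adjoint_strip[OF Q dihedral cos_mem] coercive_strip_line[OF Q dihedral cos_mem]
        strip_riccati[OF Q' cos_mem] strip_WE_dihedral(1,2,3,4)],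
      rule W_left_riccati[OF self_adjoint_strip[OF Q dihedral cos_mem] coercive_strip_line[OF Q dihedral cos_mem]
        strip_riccati[OF Q' cos_mem] strip_SN_dihedral(1,2,3,4)])

lemma half_fold_dihedral:
  "half_fold_symbol (W_hat_S Q) = fW" "half_fold_symbol (W_hat_W Q) = fW"
  "half_fold_symbol (G_inf_S Q) = fG" "half_fold_symbol (G_inf_W Q) = fG"
  by (rule half_fold_symbol_eq_fold,
      simp only: W_hat_dihedral G_inf_S_def G_inf_W_def strip_WE_dihedral strip_SN_dihedral strip_G_def)+

lemma continuous_strip_GW:
  "continuous_on {-1..1} (strip_W T A U)" "continuous_on {-1..1} (strip_G T A U)"
proof -
  show W: "continuous_on {-1..1} (strip_W T A U)" by (rule continuous_strip_W[OF Q'])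
  show "continuous_on {-1..1} (strip_G T A U)"
    unfolding strip_G_def by (intro continuous_intros continuous_strip[OF Q dihedral] W)
qed

lemma fold_riccati:
  "fG h = fT h + fA (fW h)" "fG (fW h) + fT (fW h) = - fA h"
proof -
  note c = continuous_strip[OF Q dihedral] continuous_strip_GW
  have AW: "continuous_on {-1..1} (\<lambda>x. strip_A T A U x ** strip_W T A U x)"
    and GT: "continuous_on {-1..1} (\<lambda>x. strip_G T A U x + strip_T T A U x)"
    and GTW: "continuous_on {-1..1} (\<lambda>x. (strip_G T A U x + strip_T T A U x) ** strip_W T A U x)"
    by (intro continuous_intros c)+
  have "fG h = fold_symbol (\<lambda>x. strip_T T A U x + strip_A T A U x ** strip_W T A U x) h"
    by (rule arg_cong[of _ _ "\<lambda>f. f h"], rule fold_symbol_cong) (simp add: strip_G_def)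
  then show "fG h = fT h + fA (fW h)"
    by (simp add: fold_symbol_add[OF c(2) AW] fold_symbol_mult[OF c(3) c(4)])
  have "fold_symbol (\<lambda>x. (strip_G T A U x + strip_T T A U x) ** strip_W T A U x + strip_A T A U x) = fold_symbol (\<lambda>_. 0)"
  proof (rule fold_symbol_cong)
    fix x :: real assume "x \<in> {-1..1}"
    then have "(strip_G T A U x + strip_T T A U x) ** strip_W T A U x = - strip_A T A U x"
      using strip_riccati[OF Q'] unfolding riccati_def by blast
    then show "(strip_G T A U x + strip_T T A U x) ** strip_W T A U x + strip_A T A U x = 0" by simp
  qed
  then have "fold_symbol (\<lambda>x. (strip_G T A U x + strip_T T A U x) ** strip_W T A U x) h + fA h = 0"
    unfolding fold_symbol_add[OF GTW c(3), symmetric]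
    by (simp add: fold_symbol_const) (rule ell2_eqI, simp add: ell2_nth_map bounded_linear_matrix_vector_mult)
  then show "fG (fW h) + fT (fW h) = - fA h"
    by (simp add: fold_symbol_mult[OF GT c(4)] fold_symbol_add[OF c(5) c(2)] eq_neg_iff_add_eq_0)
qed

section \<open>The blocks of the half-strip operator, computed by folding\<close>

lemma strip_step_dihedral:
  "strip_step Q ((a, b), v, v') = ((T *v a + A *v b + U *v (v + v'), A *v a + T *v b + U *v (v + v')),
     U *v (a + b) + T *v v + A *v v', U *v (a + b) + A *v v + T *v v')"
  by (simp add: strip_step_apply dihedral face_map_dihedral)

text \<open>
  The states \<open>y\<close> solve the fold of $\phi^{WE}$; on the half-line they are moved to the
  vertices by \<open>y + ell2_pop y\<close>, which intertwines the two boundary conditions.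
\<close>

lemma strip_op_sides:
  "fst (strip_op Q ((w, e), 0)) = (fT w + fA e, fA w + fT e)"
proof -
  let ?lift = "\<lambda>B :: complex ^ 'n ^ 'n. ell2_map ((*v) B)"
  define x where "x = ell2_map ((*v) U) (w + e)"
  define y where "y = fold_symbol (strip_inv T A) x"
  \<comment> \<open>Neighbouring values of \<open>y\<close> are added because the equation at a
    state contains the inputs of the two adjacent faces. The reflected value
    \<open>- ell2_nth y 0\<close> beyond the end makes the sum 0 there, which is the prescribed end
    state.\<close>
  define v where "v = - (y + ell2_pop y)"
  note cR = continuous_strip_inv[OF Q dihedral]
  note nth = ell2_nth_map bounded_linear_matrix_vector_mult
  define z where "z = fold_symbol (\<lambda>x. (2 * x) *\<^sub>R mat 1) y"
  have z: "ell2_nth z 0 = ell2_nth y 1 - ell2_nth y 0" "ell2_nth z (Suc k) = ell2_nth y (Suc (Suc k)) + ell2_nth y k" for k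
    by (simp_all add: z_def fold_symbol_cos)
  have phi: "2 *\<^sub>R (T *v ell2_nth y k) + A *v ell2_nth z k = U *v (ell2_nth w k + ell2_nth e k)" for k
  proof -
    have c1: "continuous_on {-1..1} (\<lambda>x. (2 * x) *\<^sub>R (mat 1 :: complex ^ 'n ^ 'n))"
      and c2: "continuous_on {-1..1} (\<lambda>x. A ** ((2 * x) *\<^sub>R mat 1))"
      and c3: "continuous_on {-1..1} (strip_phi T A)" and c4: "continuous_on {-1..1} (\<lambda>_. A)"
      and c5: "continuous_on {-1..1} (\<lambda>_. 2 *\<^sub>R T)"
      unfolding strip_phi_def by (intro continuous_intros)+
    have phi_eq: "strip_phi T A = (\<lambda>x. 2 *\<^sub>R T + A ** ((2 * x) *\<^sub>R mat 1))"
      by (rule ext, rule matrix_eqI)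
        (simp add: strip_phi_def matrix_vector_mult_add_rdistrib scaleR_matrix_vector matrix_vector_mul_assoc[symmetric]
          linear_simps(5)[OF bounded_linear_matrix_vector_mult])
    have "fold_symbol (strip_phi T A) y = fold_symbol (\<lambda>x. strip_phi T A x ** strip_inv T A x) x"
      unfolding y_def by (rule fold_symbol_mult[OF c3 cR, symmetric])
    also have "\<dots> = fold_symbol (\<lambda>_. mat 1) x"
      by (rule arg_cong[of _ _ "\<lambda>f. f x"], rule fold_symbol_cong) (simp add: strip_inv_inverse[OF Q dihedral])
    also have "\<dots> = x" by (rule ell2_eqI) (simp add: fold_symbol_const nth)
    also have "fold_symbol (strip_phi T A) y = ?lift (2 *\<^sub>R T) y + ?lift A z"
      unfolding phi_eq fold_symbol_add[OF c5 c2] fold_symbol_mult[OF c4 c1] z_def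
      by (simp only: fold_symbol_const)
    finally have "?lift (2 *\<^sub>R T) y + ?lift A z = x" .
    from arg_cong[OF this, of "\<lambda>f. ell2_nth f k"] show ?thesis
      by (simp add: nth x_def scaleR_matrix_vector)
  qed
  let ?c = "ell2_map (strip_step Q) (chain_states ((ell2_zip w e, 0), v))"
  note bK = symmetric_opD(1)[OF coercive_symmetric[OF coercive_strip_step[OF Q]]]
  have c_nth: "ell2_nth ?c k = strip_step Q ((ell2_nth w k, ell2_nth e k), ell2_nth v k, ell2_nth (ell2_push v 0) k)" for k
    by (simp add: ell2_nth_map bK chain_states_def)
  note mv = matrix_vector_right_distrib matrix_vector_mult_diff_distrib linear_simps(4)[OF bounded_linear_matrix_vector_mult]
  have snd0: "snd (chain_op (strip_step Q) ((ell2_zip w e, 0), v)) = 0"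
  proof (rule ell2_eqI)
    fix k
    have "ell2_nth (snd (chain_op (strip_step Q) ((ell2_zip w e, 0), v))) k
        = fst (snd (ell2_nth ?c k)) + snd (snd (ell2_nth ?c (Suc k)))"
      by (simp add: chain_op_def chain_states_adjoint_def Let_def)
    also have "\<dots> = U *v (ell2_nth w k + ell2_nth e k) + T *v ell2_nth v k + A *v ell2_nth (ell2_push v 0) k
        + (U *v (ell2_nth w (Suc k) + ell2_nth e (Suc k)) + A *v ell2_nth v (Suc k) + T *v ell2_nth v k)"
      unfolding c_nth strip_step_dihedral by simp
    \<comment> \<open>The sum of the equations \<open>phi\<close> at \<open>k\<close> and at
      \<open>k + 1\<close>; the end state enters for \<open>k = 0\<close>.\<close>
    also have "\<dots> = 0"
      unfolding phi[symmetric] scaleR_2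
      by (cases k) (simp_all add: v_def z mv)
    finally show "ell2_nth (snd (chain_op (strip_step Q) ((ell2_zip w e, 0), v))) k = ell2_nth 0 k" by simp
  qed
  have H: "half_line_op (strip_step Q) (ell2_zip w e, 0) = fst (chain_op (strip_step Q) ((ell2_zip w e, 0), v))"
    by (rule half_line_op_stationary[OF coercive_strip_step[OF Q] snd0])
  have fD: "fold_symbol (strip_D T A U) (w + e) = ?lift U (2 *\<^sub>R y + z)"
  proof -
    have c1: "continuous_on {-1..1} (\<lambda>x. (2 * x) *\<^sub>R (mat 1 :: complex ^ 'n ^ 'n))"
      and c2: "continuous_on {-1..1} (\<lambda>x. 2 *\<^sub>R mat 1 + (2 * x) *\<^sub>R (mat 1 :: complex ^ 'n ^ 'n))"
      and c3: "continuous_on {-1..1} (\<lambda>x. strip_inv T A x ** U)"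
      and c4: "continuous_on {-1..1} (\<lambda>x. (2 *\<^sub>R mat 1 + (2 * x) *\<^sub>R mat 1) ** (strip_inv T A x ** U))"
      and cc: "\<And>B :: complex ^ 'n ^ 'n. continuous_on {-1..1} (\<lambda>_ :: real. B)"
      by (intro continuous_intros cR)+
    have two: "?lift (2 *\<^sub>R mat 1) y = 2 *\<^sub>R y"
      by (rule ell2_eqI) (simp add: nth scaleR_matrix_vector)
    show ?thesis
      unfolding strip_D_def fold_symbol_mult[OF cc c4] fold_symbol_mult[OF c2 c3] fold_symbol_mult[OF cR cc]
        fold_symbol_add[OF cc c1] fold_symbol_const x_def[symmetric] y_def[symmetric] z_def[symmetric] two ..
  qed
  have fTA: "fT h = ?lift T h - fold_symbol (strip_D T A U) h" "fA h = ?lift A h - fold_symbol (strip_D T A U) h" for h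
  proof -
    note cD = continuous_strip(1)[OF Q dihedral]
    have c1: "continuous_on {-1..1} (\<lambda>x. (- mat 1) ** strip_D T A U x)"
      and cc: "\<And>B :: complex ^ 'n ^ 'n. continuous_on {-1..1} (\<lambda>_ :: real. B)"
      by (intro continuous_intros cD)+
    have m: "B - strip_D T A U x = B + (- mat 1) ** strip_D T A U x" for B x
      by (rule matrix_eqI) (simp add: matrix_vector_mult_add_rdistrib matrix_vector_mult_diff_rdistrib
          matrix_vector_mul_assoc[symmetric])
    have neg: "?lift (- mat 1) h = - h" for h :: "(nat, complex ^ 'n) ell2"
      by (rule ell2_eqI) (simp add: nth)
    show "fT h = ?lift T h - fold_symbol (strip_D T A U) h" "fA h = ?lift A h - fold_symbol (strip_D T A U) h"
      unfolding strip_T_def strip_A_def m fold_symbol_add[OF cc c1] fold_symbol_mult[OF cc cD] fold_symbol_const neg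
      by simp_all
  qed
  have fD_add: "fold_symbol (strip_D T A U) w + fold_symbol (strip_D T A U) e = ?lift U (2 *\<^sub>R y + z)"
    using fD linear_simps(1)[OF bounded_linear_fold_symbol[OF continuous_strip(1)[OF Q dihedral]]] by metis
  \<comment> \<open>Up to sign, the sum of the two states of a face is the folded factor
    \<open>2 + 2 * x\<close> of \<open>strip_D\<close> applied to \<open>y\<close>.\<close>
  have vz: "ell2_nth v k + ell2_nth (ell2_push v 0) k = - (2 *\<^sub>R ell2_nth y k + ell2_nth z k)" for k
    by (cases k) (simp_all add: v_def z scaleR_2)
  have "fst (strip_op Q ((w, e), 0)) = (ell2_map fst (ell2_map fst ?c), ell2_map snd (ell2_map fst ?c))"
    by (simp add: strip_op_apply H) (simp add: chain_op_def chain_states_adjoint_def Let_def)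
  also have "ell2_map fst (ell2_map fst ?c) = ?lift T w + ?lift A e - ?lift U (2 *\<^sub>R y + z)"
    unfolding c_nth[symmetric]
    by (rule ell2_eqI) (simp add: c_nth strip_step_dihedral vz nth mv algebra_simps)
  also have "ell2_map snd (ell2_map fst ?c) = ?lift A w + ?lift T e - ?lift U (2 *\<^sub>R y + z)"
    by (rule ell2_eqI) (simp add: c_nth strip_step_dihedral vz nth mv algebra_simps)
  finally show ?thesis
    unfolding fD_add[symmetric] fTA by (simp add: algebra_simps)
qed

lemma coercive_line: "coercive (line_op ((*v) T) ((*v) A))"
proof -
  obtain d where d: "d > 0"
    "\<And>s n w e. d * ((norm s)\<^sup>2 + (norm n)\<^sup>2 + (norm w)\<^sup>2 + (norm e)\<^sup>2) \<le> op_form (face_map Q) (s, n, w, e)"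
    using face_form_lower[OF Q dihedral] by blast
  have "d * (norm z)\<^sup>2 \<le> op_form (line_op ((*v) T) ((*v) A)) z" for z
    using d(2)[of "fst z" "snd z" 0 0]
    by (cases z) (simp add: op_form_dihedral[OF Q dihedral] norm_Pair_power2, simp add: op_form_def line_op_def inner_prod_def)
  with d(1) symmetric_op_line_op[OF self_adjoint(1,2)[folded symmetric_op_matrix_iff]] show ?thesis unfolding coercive_def by blast
qed

lemma strip_op_end_U:
  "\<exists>G. strip_op Q ((0, 0), n) = ((U_West U Q n, U_West U Q n), G)"
  "U_South U Q = U_West U Q"
proof -
  obtain G W where GW: "riccati T A G W"
    and S: "\<And>n. \<exists>f. strip_op Q ((0, 0), n) = ((f, f), G *v n) \<and>
      (\<forall>k. ell2_nth f k = U *v ((mat 1 + W) *v (((*v) W ^^ k) n)))"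
    using strip_op_end[OF Q dihedral] by blast
  have W: "W_left Q West East = W" "W_left Q South North = W"
    by (rule W_left_riccati[OF self_adjoint(1,2) coercive_line GW]; simp add: dihedral dihedral_blocks_def doubleton_eq_iff)+
  obtain f where f: "strip_op Q ((0, 0), n) = ((f, f), G *v n)"
    "\<And>k. ell2_nth f k = U *v ((mat 1 + W) *v (((*v) W ^^ k) n))"
    using S[of n] by blast
  have "U_West U Q n = f"
    unfolding U_West_def U_line_def W f(2)[symmetric] by (rule ell2_nth_inverse)
  with f(1) show "\<exists>G. strip_op Q ((0, 0), n) = ((U_West U Q n, U_West U Q n), G)" by blast
  show "U_South U Q = U_West U Q" by (simp add: U_West_def U_South_def W)
qed

text \<open>By self-adjointness, the response at the end to values on the long sides is adjoint to
  the response on the long sides to an end value, which is the same sequence on both.\<close>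

lemma strip_op_sides_end: "snd (strip_op Q ((w, e), 0)) = adjoint (U_West U Q) (w + e)"
proof -
  note s = coercive_symmetric[OF coercive_strip_op[OF Q]]
  have S: "snd (strip_op Q ((f, g), 0)) \<bullet> n = (f + g) \<bullet> U_West U Q n" for f g n
  proof -
    obtain G where "strip_op Q ((0, 0), n) = ((U_West U Q n, U_West U Q n), G)"
      using strip_op_end_U(1) by blast
    then show ?thesis
      using symmetric_opD(2)[OF s, of "((f, g), 0)" "((0, 0), n)"] by (simp add: inner_prod_def inner_add_left)
  qed
  have "adjoint (U_West U Q) = (\<lambda>f. snd (strip_op Q ((f, 0), 0)))"
    by (rule adjoint_unique) (metis S add.right_neutral inner_commute)
  moreover have "snd (strip_op Q ((w, e), 0)) = snd (strip_op Q ((w + e, 0), 0))"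
    by (rule vector_eq_rdot[THEN iffD1]) (simp add: S)
  ultimately show ?thesis by simp
qed

section \<open>The corner as a chain of half-strips with zero inputs\<close>

private abbreviation (input) "corner \<equiv> half_line_op (corner_step (strip_op Q))"

private lemmas co_S = coercive_strip_op[OF Q]
private lemmas co_C = coercive_corner_op[OF coercive_strip_op[OF Q]]

lemma symmetric_fold: "symmetric_op fT" "symmetric_op fA" "symmetric_op fG"
proof -
  have "self_adjoint_matrix (strip_G T A U x)" if "x \<in> {-1..1}" for x
    using strip_riccati[OF Q' that] unfolding riccati_def by blast
  then show "symmetric_op fG" by (intro fold_symbol_symmetric continuous_strip_GW)
  show "symmetric_op fT" "symmetric_op fA"
    using fold_symbol_symmetric[OF continuous_strip(2)[OF Q dihedral] self_adjoint_strip(1)[OF Q dihedral]]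
      fold_symbol_symmetric[OF continuous_strip(3)[OF Q dihedral] self_adjoint_strip(2)[OF Q dihedral]]
    by blast+
qed

lemma op_form_strip_sides:
  "op_form (strip_op Q) ((v, e), 0) = op_form fT v + op_form fT e + 2 * (fA e \<bullet> v)"
  using symmetric_opD(2)[OF symmetric_fold(2), of e v]
  unfolding op_form_Pair strip_op_sides
  by (simp add: op_form_def inner_add_right inner_commute)

text \<open>With zero values on the North side both forms satisfy the same minimum equation, whose
  step is the half-strip form with end value 0; for the folded \<open>G\<close> this is the folded
  Riccati equation. Comparison in both directions gives equality.\<close>

lemma corner_EE_dihedral: "corner_EE corner = fG"
proof (rule symmetric_op_eqI)
  show "symmetric_op (corner_EE corner)"
    unfolding corner_EE_def by (rule coercive_symmetric[OF coercive_snd[OF co_C]])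
  show "symmetric_op fG" by (rule symmetric_fold)
  fix g
  obtain d where d: "d > 0" "\<And>z. d * (norm z)\<^sup>2 \<le> op_form (strip_op Q) z"
    using co_S unfolding coercive_def by blast
  let ?k = "\<lambda>v e. op_form (strip_op Q) ((v, e), 0)"
  have k: "d * (norm v)\<^sup>2 \<le> ?k v e" for v e
  proof -
    have "d * (norm v)\<^sup>2 \<le> d * (norm ((v, e), 0 :: complex ^ 'n))\<^sup>2" using d(1) by (simp add: norm_Pair_power2)
    then show ?thesis using d(2) by (rule order_trans)
  qed
  have T0: "0 \<le> op_form fT v" for v
    using coercive_nonneg[OF co_S, of "((v, 0), 0)"] unfolding op_form_strip_sides
    by (simp add: op_form_def symmetric_opD(7)[OF symmetric_fold(2)])
  have G0: "0 \<le> op_form fG v" for v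
    using strip_riccati[OF Q'] unfolding riccati_def
    by (intro fold_symbol_nonneg continuous_strip_GW) blast
  have minG: "is_min (op_form fG e) (\<lambda>v. op_form fG v + ?k v e)" for e
    unfolding op_form_strip_sides
    by (rule riccati_is_min[OF symmetric_fold(3,1,2) G0 T0 fold_riccati])
  have minC: "is_min (op_form corner (0, e)) (\<lambda>v. op_form corner (0, v) + ?k v e)" for e
    using corner_op_min[OF co_S, of 0 0 e] by (simp only: linear_ell2_push)
  obtain C where C: "\<And>x. \<bar>op_form corner x\<bar> \<le> C * (norm x)\<^sup>2"
    using bounded_op_form_le[OF symmetric_opD(1)[OF coercive_symmetric[OF co_C]]] by blast
  obtain B where B: "\<And>x. \<bar>op_form fG x\<bar> \<le> B * (norm x)\<^sup>2"
    using bounded_op_form_le[OF symmetric_opD(1)[OF symmetric_fold(3)]] by blast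
  have "op_form corner (0, e) \<le> C * (norm e)\<^sup>2" for e
    using C[of "(0, e)"] by (simp add: norm_Pair_power2)
  then have "op_form corner (0, g) \<le> op_form fG g"
    by (rule no_input_form_le[OF _ G0 d(1) k minC minG])
  moreover have "op_form fG e \<le> B * (norm e)\<^sup>2" for e using B[of e] by linarith
  then have "op_form fG g \<le> op_form corner (0, g)"
    by (rule no_input_form_le[OF _ coercive_nonneg[OF co_C] d(1) k minG minC])
  moreover have "op_form (corner_EE corner) g = op_form corner (0, g)"
    by (simp add: op_form_Pair) (simp add: op_form_def corner_EE_def)
  ultimately show "op_form (corner_EE corner) g = op_form fG g" by simp
qed

text \<open>By the second folded Riccati equation, the stationary state for the East value
  \<open>g\<close> is the folded \<open>W\<close> applied to \<open>g\<close>. Each unrolling of the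
  East gluing contributes one entry of the North side, namely the end component of a half-strip with
  sides \<open>fW g\<close> and \<open>g\<close>.\<close>

lemma corner_NE_dihedral:
  "ell2_nth (corner_NE corner g) k = adjoint (U_West U Q) ((fW ^^ k) g + fW ((fW ^^ k) g))"
proof -
  let ?B = "transport (\<lambda>((w, e), n). ((e, n), w)) (strip_op Q)"
  have eq: "transport (\<lambda>(f, (g, a)). (ell2_push f a, g)) (glue corner ?B) = corner"
    using corner_equation_iff[OF co_S coercive_symmetric[OF co_C] co_C] corner_op_min[OF co_S] by blast
  have step: "corner_NE corner g = ell2_push (corner_NE corner (fW g)) (adjoint (U_West U Q) (g + fW g))" for g
  proof -
    have B: "?B ((g, 0), v) = (\<lambda>((w, e), n). ((e, n), w)) (strip_op Q ((v, g), 0))" for v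
      using transport_apply[OF unitary_bij[OF unitary_rearrange(5)], of "strip_op Q" "((v, g), 0)"] by simp
    have "snd (corner (0, fW g)) + snd (?B ((g, 0), fW g)) = fG (fW g) + (fT (fW g) + fA g)"
      using strip_op_sides[of "fW g" g] corner_EE_dihedral unfolding B
      by (cases "strip_op Q ((fW g, g), 0)") (auto simp: corner_EE_def fun_eq_iff)
    also have "\<dots> = 0" using fold_riccati(2)[of g] by (simp add: add.assoc[symmetric])
    finally have "glue corner ?B (0, (g, 0)) = (fst (corner (0, fW g)), fst (?B ((g, 0), fW g)))"
      by (rule glue_coercive(3)[OF co_C coercive_transport[OF unitary_rearrange(5) co_S]])
    moreover have "corner (ell2_push 0 0, g) = (\<lambda>(f, (g, a)). (ell2_push f a, g)) (glue corner ?B (0, (g, 0)))"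
      using transport_apply[OF unitary_bij[OF unitary_push_fst], of "glue corner ?B" "(0, (g, 0))"] eq by simp
    moreover have "snd (fst (?B ((g, 0), fW g))) = adjoint (U_West U Q) (g + fW g)"
      using strip_op_sides_end[of "fW g" g] unfolding B
      by (cases "strip_op Q ((fW g, g), 0)") (auto simp: add.commute)
    ultimately show ?thesis by (simp add: corner_NE_def linear_ell2_push case_prod_unfold)
  qed
  show ?thesis
  proof (induction k arbitrary: g)
    case 0
    show ?case by (subst step) simp
  next
    case (Suc k)
    show ?case using Suc[of "fW g"] by (subst step) (simp add: funpow_swap1)
  qed
qed

end

lemma corner_swap_blocks:
  assumes "transport prod.swap C = C"
  shows "C (g, f) = prod.swap (C (f, g))" "corner_NN C = corner_EE C" "corner_EN C = corner_NE C"
proof -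
  show swap: "C (g, f) = prod.swap (C (f, g))" for f g
    using transport_apply[of prod.swap C "(f, g)"] assms by simp
  show "corner_NN C = corner_EE C" "corner_EN C = corner_NE C"
    by (simp_all add: fun_eq_iff corner_NN_def corner_EE_def corner_EN_def corner_NE_def swap[of _ 0])
qed

theorem theorem3p11:
  fixes T A U :: "'k::real_or_complex ^ 'n ^ 'n::finite"
    and Q :: "('k, 'n) blocks"
  assumes "face_operator Q"
    and "self_adjoint_matrix T" and "self_adjoint_matrix A" and "self_adjoint_matrix U"
    and "Q = dihedral_blocks T A U"
    and "simple_2d (to_complex_blocks Q)"
  shows "let Qc = to_complex_blocks Q; Uc = map_matrix to_complex U; C = corner_fixed_point Q;
             F_S = half_fold_symbol (W_hat_S Qc); F_W = half_fold_symbol (W_hat_W Qc)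
         in (\<exists>!M. is_west_fixed_point Q M) \<and> (\<exists>!M. is_south_fixed_point Q M) \<and>
            (\<exists>!M. is_corner_fixed_point Q M) \<and>
            (\<forall>h. to_complex_ell2 (corner_NN C h) = half_fold (Q_half_plane_S Qc) (to_complex_ell2 h)) \<and>
            half_fold (Q_half_plane_S Qc) = half_fold_symbol (G_inf_S Qc) \<and>
            (\<forall>g. to_complex_ell2 (corner_EE C g) = half_fold (Q_half_plane_W Qc) (to_complex_ell2 g)) \<and>
            half_fold (Q_half_plane_W Qc) = half_fold_symbol (G_inf_W Qc) \<and>
            (\<exists>V_SE V_NW :: (nat, complex ^ 'n) ell2 \<Rightarrow> (nat, complex ^ 'n) ell2.
               bounded_linear V_SE \<and> bounded_linear V_NW \<and>
               (\<forall>h k. ell2_nth (V_SE h) k =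
                  adjoint (U_West Uc Qc) ((F_S ^^ k) h + F_S ((F_S ^^ k) h))) \<and>
               (\<forall>g k. ell2_nth (V_NW g) k =
                  adjoint (U_South Uc Qc) ((F_W ^^ k) g + F_W ((F_W ^^ k) g))) \<and>
               (\<forall>h. to_complex_ell2 (corner_EN C h) = V_SE (to_complex_ell2 h)) \<and>
               (\<forall>g. to_complex_ell2 (corner_NE C g) = V_NW (to_complex_ell2 g)) \<and>
               (\<forall>h g. V_SE h \<bullet> g = h \<bullet> V_NW g))"
proof -
  let ?Qc = "to_complex_blocks Q" and ?Uc = "map_matrix to_complex U"
  define C where "C = half_line_op (corner_step (strip_op Q))"
  define Cc where "Cc = half_line_op (corner_step (strip_op ?Qc))"
  note Q = assms(1,5)
  have Qc: "face_operator ?Qc" "?Qc = dihedral_blocks (map_matrix to_complex T) (map_matrix to_complex A) ?Uc"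
    using face_operator_to_complex[OF assms(1)] to_complex_dihedral assms(5) by auto
  have corner: "is_corner_fixed_point Q = (\<lambda>M. M = C)"
    by (simp add: fun_eq_iff dihedral_corner_iff[OF Q] C_def)
  then have C: "corner_fixed_point Q = C" by (simp add: corner_fixed_point_def)
  have "Cc (ell2_map to_complex_vec f, ell2_map to_complex_vec g) =
      map_prod (ell2_map to_complex_vec) (ell2_map to_complex_vec) (C (f, g))" for f g
    unfolding C_def Cc_def
    by (rule corner_op_intertwine[OF assms(1) Qc(1) bounded_linear_to_complex_vec face_map_to_complex])
  then have cx: "Cc (to_complex_ell2 f, to_complex_ell2 g) =
      map_prod to_complex_ell2 to_complex_ell2 (C (f, g))" for f g
    by (simp add: to_complex_ell2_eq_map)
  have zero: "to_complex_ell2 (0 :: ('k, 'n) half_line) = 0"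
    by (rule ell2_eqI) (simp add: to_complex_ell2.rep_eq zero_ell2.rep_eq)
  have blocks: "to_complex_ell2 (corner_NN C h) = corner_NN Cc (to_complex_ell2 h)"
      "to_complex_ell2 (corner_EE C h) = corner_EE Cc (to_complex_ell2 h)"
      "to_complex_ell2 (corner_EN C h) = corner_EN Cc (to_complex_ell2 h)"
      "to_complex_ell2 (corner_NE C h) = corner_NE Cc (to_complex_ell2 h)" for h
    using cx[of h 0] cx[of 0 h] by (simp_all add: zero corner_NN_def corner_EE_def corner_EN_def corner_NE_def)
  note swap = corner_swap_blocks[OF dihedral_corner_swap[OF Qc, folded Cc_def]]
  note sym = coercive_symmetric[OF coercive_corner_op[OF coercive_strip_op[OF Qc(1)]], folded Cc_def]
  note EE = corner_EE_dihedral[OF Qc, folded Cc_def]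
  note fold = half_fold_dihedral[OF Qc]
  have bl: "bounded_linear (corner_NE Cc)"
    unfolding corner_NE_def
    by (intro bounded_linear_fst[THEN bounded_linear_compose] bounded_linear_compose[OF symmetric_opD(1)[OF sym]]
        bounded_linear_Pair bounded_linear_zero bounded_linear_ident)
  have adj: "corner_NE Cc h \<bullet> g = h \<bullet> corner_NE Cc g" for g h
    using symmetric_opD(2)[OF sym, of "(0, h)" "(g, 0)"] swap(1)[of g 0]
    by (simp add: corner_NE_def inner_prod_def)
  \<comment> \<open>Both operators of the statement are the block \<open>corner_NE Cc\<close>: by
    the reflection symmetry it coincides with \<open>corner_EN Cc\<close>, and together with
    self-adjointness of \<open>Cc\<close> this makes it its own adjoint.\<close>
  show ?thesis
    unfolding Let_def C Q_half_plane_S_def Q_half_plane_W_def corner is_south_fixed_point_eq[OF Q]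
      is_west_fixed_point_iff[OF assms(1)] blocks swap(2,3) EE fold strip_op_end_U(2)[OF Qc]
    using bl adj corner_NE_dihedral[OF Qc, folded Cc_def] by blast
qed

end
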